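(* For every $n\ge 2$, the space $\mathfrak{C}(\mathbb{RP}^n)$ of projective classes of properly convex domains in $\mathbb{RP}^n$ contains minimal closed sets that are not points.
   Context: A domain in $\mathbb{RP}^n$ is a nonempty open connected subset $\Omega$; it is convex if any two of its points are joined by a line segment contained in $\Omega$, and properly convex if moreover $\overline\Omega$ is contained in a single affine chart. The set of properly convex domains in $\mathbb{RP}^n$ is topologized by the Hausdorff topology on closures, and $\mathfrak{C}(\mathbb{RP}^n)$ is its quotient by the action of the group of projective transformations of $\mathbb{RP}^n$, with the quotient topology (it is not $T_0$). A nonempty closed subset of a topological space is minimal if it contains no proper nonempty closed subset. *)

theory Defs
  imports "HOL-Analysis.Analysis"
begin

section \<open>Real projective space\<close>

definition proportional :: "'a::real_vector \<Rightarrow> 'a \<Rightarrow> bool" where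
  "proportional u v \<longleftrightarrow> u \<noteq> 0 \<and> v \<noteq> 0 \<and> (\<exists>c. c \<noteq> 0 \<and> v = c *\<^sub>R u)"

lemma part_equivp_proportional: "part_equivp (proportional :: 'a::euclidean_space \<Rightarrow> 'a \<Rightarrow> bool)"
proof (rule part_equivpI)
  obtain b :: 'a where "b \<in> Basis"
    using nonempty_Basis by blast
  then have "proportional b b"
    unfolding proportional_def using nonzero_Basis[of b] by (auto intro!: exI[of _ 1])
  then show "\<exists>x::'a. proportional x x" ..
  show "symp (proportional :: 'a \<Rightarrow> 'a \<Rightarrow> bool)"
  proof (rule sympI)
    fix u v :: 'a assume "proportional u v"
    then obtain c where "u \<noteq> 0" "v \<noteq> 0" "c \<noteq> 0" "v = c *\<^sub>R u"
      unfolding proportional_def by blast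
    then show "proportional v u"
      unfolding proportional_def by (auto intro!: exI[of _ "inverse c"])
  qed
  show "transp (proportional :: 'a \<Rightarrow> 'a \<Rightarrow> bool)"
  proof (rule transpI)
    fix u v w :: 'a assume "proportional u v" "proportional v w"
    then obtain c d where "u \<noteq> 0" "w \<noteq> 0" "c \<noteq> 0" "v = c *\<^sub>R u" "d \<noteq> 0" "w = d *\<^sub>R v"
      unfolding proportional_def by blast
    then show "proportional u w"
      unfolding proportional_def by (auto intro!: exI[of _ "d * c"])
  qed
qed

text \<open>
  The projective space of lines in \<open>'a\<close>: nonzero vectors up to nonzero scalars. For
  \<open>'a = real ^ 'n\<close> with \<open>CARD('n) = n + 1\<close> this is \<open>n\<close>-dimensional real projective space.
  \<open>homog v\<close> is the point with homogeneous coordinates \<open>v\<close>; it is meaningful only for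
  \<open>v \<noteq> 0\<close>.
\<close>
quotient_type (overloaded) 'a proj_space = "'a::euclidean_space" / partial: proportional
  morphisms rep_proj homog
  by (rule part_equivp_proportional)

lemma homog_eq_iff: "u \<noteq> 0 \<Longrightarrow> v \<noteq> 0 \<Longrightarrow> homog u = homog v \<longleftrightarrow> (\<exists>c. c \<noteq> 0 \<and> v = c *\<^sub>R u)"
proof -
  assume "u \<noteq> 0" "v \<noteq> 0"
  then have "proportional u u" "proportional v v"
    unfolding proportional_def by (auto intro!: exI[of _ 1])
  then show ?thesis
    using Quotient_rel[OF Quotient_proj_space, of u v] \<open>u \<noteq> 0\<close> \<open>v \<noteq> 0\<close>
    by (simp add: proportional_def)
qed

lemma homog_scaleR: "u \<noteq> 0 \<Longrightarrow> c \<noteq> 0 \<Longrightarrow> homog (c *\<^sub>R u) = homog u"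
  using homog_eq_iff[of u "c *\<^sub>R u"] by auto

lemma homog_cases:
  obtains v where "v \<noteq> 0" "norm v = 1" "p = homog v"
proof -
  have "proportional (rep_proj p) (rep_proj p)"
    using Quotient_rep_reflp[OF Quotient_proj_space] .
  then have nz: "rep_proj p \<noteq> 0"
    by (simp add: proportional_def)
  have "homog (rep_proj p) = p"
    using Quotient_abs_rep[OF Quotient_proj_space] .
  then have "homog (sgn (rep_proj p)) = p"
    using homog_scaleR[OF nz, of "inverse (norm (rep_proj p))"] nz by (simp add: sgn_div_norm)
  with nz that[of "sgn (rep_proj p)"] show ?thesis
    by (simp add: norm_sgn sgn_zero_iff)
qed

text \<open>
  The metric is the chordal metric (the distance between pairs of antipodal unit vectors), the
  topology is the quotient topology; the instance proof shows that they agree.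
\<close>
instantiation proj_space :: (euclidean_space) metric_space
begin

lift_definition dist_proj_space :: "'a proj_space \<Rightarrow> 'a proj_space \<Rightarrow> real"
  is "\<lambda>u v. min (norm (sgn u - sgn v)) (norm (sgn u + sgn v))"
proof -
  have *: "sgn v = sgn u \<or> sgn v = - sgn u" if "proportional u v" for u v :: 'a
  proof -
    obtain c where "c \<noteq> 0" "v = c *\<^sub>R u"
      using \<open>proportional u v\<close> unfolding proportional_def by blast
    then show ?thesis
      by (cases "c > 0") (auto simp: sgn_scaleR)
  qed
  fix u u' v v' :: 'a
  assume "proportional u u'" "proportional v v'"
  from *[OF this(1)] *[OF this(2)]
  show "min (norm (sgn u - sgn v)) (norm (sgn u + sgn v)) =
        min (norm (sgn u' - sgn v')) (norm (sgn u' + sgn v'))"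
    by (elim disjE) (simp_all add: norm_minus_commute min.commute add.commute)
qed

definition uniformity_proj_space :: "('a proj_space \<times> 'a proj_space) filter" where
  "uniformity_proj_space = (INF e\<in>{0 <..}. principal {(x, y). dist x y < e})"

definition open_proj_space :: "'a proj_space set \<Rightarrow> bool" where
  "open_proj_space U \<longleftrightarrow> open {v. v \<noteq> 0 \<and> homog v \<in> U}"

lemma dist_homog:
  "u \<noteq> 0 \<Longrightarrow> v \<noteq> 0 \<Longrightarrow>
    dist (homog u) (homog v) = min (norm (sgn u - sgn v)) (norm (sgn u + sgn v))"
  by (rule dist_proj_space.abs_eq) (auto simp: proportional_def intro!: exI[of _ 1])

lemma open_proj_space_dist:
  "open U \<longleftrightarrow> (\<forall>p\<in>U. \<exists>e>0. \<forall>q. dist p q < e \<longrightarrow> q \<in> U)" for U :: "'a proj_space set"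
proof
  assume "open U"
  then have op: "open {v. v \<noteq> 0 \<and> homog v \<in> U}" (is "open ?V")
    by (simp add: open_proj_space_def)
  show "\<forall>p\<in>U. \<exists>e>0. \<forall>q. dist p q < e \<longrightarrow> q \<in> U"
  proof
    fix p assume "p \<in> U"
    obtain v where v: "v \<noteq> 0" "norm v = 1" "p = homog v"
      by (rule homog_cases)
    then have "v \<in> ?V" using \<open>p \<in> U\<close> by simp
    then obtain e where e: "e > 0" "\<And>w. dist w v < e \<Longrightarrow> w \<in> ?V"
      using op unfolding open_dist by blast
    have "q \<in> U" if "dist p q < e" for q
    proof -
      obtain w where w: "w \<noteq> 0" "norm w = 1" "q = homog w"
        by (rule homog_cases)
      have [simp]: "sgn v = v" "sgn w = w"
        using v w by (simp_all add: sgn_div_norm)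
      have "norm (v - w) < e \<or> norm (v + w) < e"
        using that v w by (auto simp: dist_homog)
      then have "w \<in> ?V \<or> - w \<in> ?V"
        using e(2)[of w] e(2)[of "- w"] norm_minus_commute[of v w] norm_minus_commute[of "- w" v]
        by (auto simp: dist_norm simp del: mem_Collect_eq)
      then show "q \<in> U"
        using w homog_scaleR[of w "- 1"] by auto
    qed
    with e(1) show "\<exists>e>0. \<forall>q. dist p q < e \<longrightarrow> q \<in> U" by blast
  qed
next
  assume R: "\<forall>p\<in>U. \<exists>e>0. \<forall>q. dist p q < e \<longrightarrow> q \<in> U"
  have "\<exists>T. open T \<and> v \<in> T \<and> T \<subseteq> {v. v \<noteq> 0 \<and> homog v \<in> U}" if v: "v \<noteq> 0" "homog v \<in> U" for v
  proof -
    obtain e where e: "e > 0" "\<And>q. dist (homog v) q < e \<Longrightarrow> q \<in> U"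
      using R v by blast
    have "continuous_on (- {0}) (sgn :: 'a \<Rightarrow> 'a)"
      by (intro continuous_intros) auto
    then have "open (sgn -` ball (sgn v) e \<inter> - {0::'a})"
      by (intro continuous_open_preimage[of "- {0}" sgn, simplified Int_commute]) auto
    moreover have "v \<in> sgn -` ball (sgn v) e \<inter> - {0}"
      using v e by simp
    moreover have "w \<noteq> 0 \<and> homog w \<in> U" if "w \<in> sgn -` ball (sgn v) e \<inter> - {0}" for w
      using that v e(2)[of "homog w"] by (auto simp: dist_homog dist_norm)
    ultimately show ?thesis by blast
  qed
  then show "open U"
    unfolding open_proj_space_def by (subst open_subopen) auto
qed

instance
proof
  show "uniformity = (INF e\<in>{0 <..}. principal {(x::'a proj_space, y). dist x y < e})"
    by (rule uniformity_proj_space_def)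
next
  fix U :: "'a proj_space set"
  have eventually_unif: "eventually P uniformity \<longleftrightarrow> (\<exists>e>0. \<forall>p q. dist p q < e \<longrightarrow> P (p, q))"
    for P :: "'a proj_space \<times> 'a proj_space \<Rightarrow> bool"
    unfolding uniformity_proj_space_def
    by (subst eventually_INF_base)
       (auto simp: eventually_principal subset_eq intro: bexI[of _ "min _ _"])
  show "open U \<longleftrightarrow> (\<forall>x\<in>U. \<forall>\<^sub>F (x', y) in uniformity. x' = x \<longrightarrow> y \<in> U)"
    unfolding open_proj_space_dist eventually_unif by auto
next
  fix p q r :: "'a proj_space"
  obtain u where u: "u \<noteq> 0" "norm u = 1" "p = homog u" by (rule homog_cases)
  obtain v where v: "v \<noteq> 0" "norm v = 1" "q = homog v" by (rule homog_cases)
  obtain w where w: "w \<noteq> 0" "norm w = 1" "r = homog w" by (rule homog_cases)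
  have [simp]: "sgn u = u" "sgn v = v" "sgn w = w"
    using u v w by (simp_all add: sgn_div_norm)
  show "dist p q = 0 \<longleftrightarrow> p = q"
  proof
    assume "dist p q = 0"
    then have "norm (u - v) = 0 \<or> norm (u + v) = 0"
      using u v by (simp add: dist_homog min_def split: if_splits)
    then have "v = 1 *\<^sub>R u \<or> v = (- 1) *\<^sub>R u"
      by (auto simp: eq_neg_iff_add_eq_0 add.commute)
    then show "p = q"
      using u v homog_scaleR[of u 1] homog_scaleR[of u "- 1"] by auto
  next
    assume "p = q"
    then have "dist p q = dist (homog u) (homog u)"
      using u by simp
    also have "\<dots> = 0"
      using u(1) by (simp add: dist_homog)
    finally show "dist p q = 0" .
  qed
  have "norm (u - v) \<le> norm (u - w) + norm (v - w)" "norm (u - v) \<le> norm (u + w) + norm (v + w)"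
    "norm (u + v) \<le> norm (u - w) + norm (v + w)" "norm (u + v) \<le> norm (u + w) + norm (v - w)"
    using norm_triangle_ineq4[of "u - w" "v - w"] norm_triangle_ineq4[of "u + w" "v + w"]
      norm_triangle_ineq[of "u - w" "v + w"] norm_triangle_ineq[of "u + w" "v - w"] by simp_all
  then show "dist p q \<le> dist p r + dist q r"
    using u v w by (simp add: dist_homog min_def)
qed

end

lemma quotient_map_homog:
  "quotient_map (top_of_set (- {0})) euclidean (homog :: 'a::euclidean_space \<Rightarrow> 'a proj_space)"
proof -
  have "p \<in> homog ` (- {0::'a})" for p
    by (rule homog_cases[of p]) auto
  moreover have "{x. x \<noteq> 0 \<and> homog x \<in> U} = {x \<in> - {0::'a}. homog x \<in> U}" for U
    by auto
  ultimately show ?thesis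
    unfolding quotient_map_def
    by (auto simp: open_proj_space_def openin_open_eq open_Compl)
qed

lemma bounded_proj_space: "bounded (S :: 'a::euclidean_space proj_space set)"
proof -
  have "dist p q \<le> 2" for p q :: "'a proj_space"
  proof -
    obtain u where u: "u \<noteq> 0" "norm u = 1" "p = homog u" by (rule homog_cases)
    obtain v where v: "v \<noteq> 0" "norm v = 1" "q = homog v" by (rule homog_cases)
    show ?thesis
      using u v norm_triangle_ineq4[of u v] by (simp add: dist_homog sgn_div_norm min_le_iff_disj)
  qed
  then show ?thesis
    unfolding bounded_def by blast
qed

definition projective_transformation :: "('a::euclidean_space proj_space \<Rightarrow> 'a proj_space) \<Rightarrow> bool" where
  "projective_transformation g \<longleftrightarrow>
    (\<exists>f. linear f \<and> bij f \<and> (\<forall>v. v \<noteq> 0 \<longrightarrow> g (homog v) = homog (f v)))"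


section \<open>Properly convex domains\<close>

text \<open>
  Two distinct points bound two segments, corresponding to the two relative signs of their
  representatives. The condition on \<open>0\<close> only matters for \<open>p = q\<close>, where it leaves the
  degenerate segment \<open>{p}\<close>.
\<close>
definition proj_segment :: "'a::euclidean_space proj_space set \<Rightarrow> 'a proj_space \<Rightarrow> 'a proj_space \<Rightarrow> bool" where
  "proj_segment S p q \<longleftrightarrow>
    (\<exists>u v. u \<noteq> 0 \<and> v \<noteq> 0 \<and> homog u = p \<and> homog v = q \<and>
      0 \<notin> closed_segment u v \<and> S = homog ` closed_segment u v)"

definition proj_domain :: "'a::euclidean_space proj_space set \<Rightarrow> bool" where
  "proj_domain \<Omega> \<longleftrightarrow> \<Omega> \<noteq> {} \<and> open \<Omega> \<and> connected \<Omega>"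

definition proj_convex :: "'a::euclidean_space proj_space set \<Rightarrow> bool" where
  "proj_convex \<Omega> \<longleftrightarrow> (\<forall>p\<in>\<Omega>. \<forall>q\<in>\<Omega>. \<exists>S. proj_segment S p q \<and> S \<subseteq> \<Omega>)"

text \<open>An affine chart is the complement of the projective hyperplane \<open>a \<bullet> v = 0\<close>.\<close>
definition affine_chart :: "'a::euclidean_space proj_space set \<Rightarrow> bool" where
  "affine_chart A \<longleftrightarrow> (\<exists>a. a \<noteq> 0 \<and> A = {homog v | v. a \<bullet> v \<noteq> 0})"

definition properly_convex_domains :: "'a::euclidean_space proj_space set set" where
  "properly_convex_domains =
    {\<Omega>. proj_domain \<Omega> \<and> proj_convex \<Omega> \<and> (\<exists>A. affine_chart A \<and> closure \<Omega> \<subseteq> A)}"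


section \<open>The Hausdorff topology\<close>

text \<open>Outside nonempty bounded sets the suprema are not meaningful and the value is set to 0.\<close>
definition hausdorff_dist :: "'a::metric_space set \<Rightarrow> 'a set \<Rightarrow> real" where
  "hausdorff_dist A B =
    (if A \<noteq> {} \<and> bounded A \<and> B \<noteq> {} \<and> bounded B
     then max (SUP a\<in>A. infdist a B) (SUP b\<in>B. infdist b A) else 0)"

lemma bdd_above_infdist:
  assumes "bounded A" "B \<noteq> {}"
  shows "bdd_above ((\<lambda>a. infdist a B) ` A)"
proof -
  obtain b where b: "b \<in> B" using assms by blast
  obtain e where "\<And>a. a \<in> A \<Longrightarrow> dist b a \<le> e"
    using assms(1) unfolding bounded_any_center[of A b] by blast
  then have "infdist a B \<le> e" if "a \<in> A" for a
    using infdist_le[OF b, of a] that by (force simp: dist_commute)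
  then show ?thesis by (intro bdd_aboveI2)
qed

lemma hausdorff_dist_le_iff:
  assumes "A \<noteq> {}" "bounded A" "B \<noteq> {}" "bounded B"
  shows "hausdorff_dist A B \<le> e \<longleftrightarrow> (\<forall>a\<in>A. infdist a B \<le> e) \<and> (\<forall>b\<in>B. infdist b A \<le> e)"
  using assms by (simp add: hausdorff_dist_def cSUP_le_iff bdd_above_infdist)

lemma Metric_space_hausdorff_dist:
  "Metric_space {K :: 'a::metric_space set. closed K \<and> bounded K \<and> K \<noteq> {}} hausdorff_dist"
proof
  fix A B :: "'a set"
  show "0 \<le> hausdorff_dist A B"
  proof (cases "A \<noteq> {} \<and> bounded A \<and> B \<noteq> {} \<and> bounded B")
    case True
    then obtain a where "a \<in> A" by blast
    have "0 \<le> infdist a B" by (rule infdist_nonneg)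
    also have "\<dots> \<le> hausdorff_dist A B"
      using hausdorff_dist_le_iff[of A B "hausdorff_dist A B"] True \<open>a \<in> A\<close> by auto
    finally show ?thesis .
  next
    case False
    then show ?thesis
      unfolding hausdorff_dist_def by (subst if_not_P) simp_all
  qed
next
  fix A B :: "'a set"
  show "hausdorff_dist A B = hausdorff_dist B A"
    by (simp add: hausdorff_dist_def max.commute conj_ac)
next
  fix A B :: "'a set"
  assume A: "A \<in> {K. closed K \<and> bounded K \<and> K \<noteq> {}}" and B: "B \<in> {K. closed K \<and> bounded K \<and> K \<noteq> {}}"
  show "hausdorff_dist A B = 0 \<longleftrightarrow> A = B"
  proof
    assume "hausdorff_dist A B = 0"
    then have "hausdorff_dist A B \<le> 0" by simp
    then have le: "\<forall>a\<in>A. infdist a B \<le> 0" "\<forall>b\<in>B. infdist b A \<le> 0"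
      using hausdorff_dist_le_iff[of A B 0] A B by auto
    have "a \<in> B" if "a \<in> A" for a
      using in_closed_iff_infdist_zero[of B a] le(1) that B infdist_nonneg[of a B] by force
    moreover have "b \<in> A" if "b \<in> B" for b
      using in_closed_iff_infdist_zero[of A b] le(2) that A infdist_nonneg[of b A] by force
    ultimately show "A = B" by blast
  next
    assume "A = B"
    then show "hausdorff_dist A B = 0"
      using A by (simp add: hausdorff_dist_def)
  qed
next
  fix A B C :: "'a set"
  assume A: "A \<in> {K. closed K \<and> bounded K \<and> K \<noteq> {}}" and B: "B \<in> {K. closed K \<and> bounded K \<and> K \<noteq> {}}"
    and C: "C \<in> {K. closed K \<and> bounded K \<and> K \<noteq> {}}"
  have *: "infdist x T \<le> r + s"
    if ne: "S \<noteq> {}" and r: "infdist x S \<le> r" and s: "\<forall>y\<in>S. infdist y T \<le> s"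
    for x :: 'a and S T r s
  proof -
    have "infdist x T - s \<le> dist x y" if "y \<in> S" for y
      using infdist_triangle[of x T y] s that by force
    then have "infdist x T - s \<le> infdist x S"
      using ne by (simp add: infdist_notempty cINF_greatest)
    with r show ?thesis by simp
  qed
  have "\<forall>a\<in>A. infdist a B \<le> hausdorff_dist A B" "\<forall>b\<in>B. infdist b A \<le> hausdorff_dist A B"
    using hausdorff_dist_le_iff[of A B "hausdorff_dist A B"] A B by auto
  moreover have "\<forall>b\<in>B. infdist b C \<le> hausdorff_dist B C" "\<forall>c\<in>C. infdist c B \<le> hausdorff_dist B C"
    using hausdorff_dist_le_iff[of B C "hausdorff_dist B C"] B C by auto
  ultimately have "\<forall>a\<in>A. infdist a C \<le> hausdorff_dist A B + hausdorff_dist B C"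
    "\<forall>c\<in>C. infdist c A \<le> hausdorff_dist B C + hausdorff_dist A B"
    using *[of B _ "hausdorff_dist A B" C "hausdorff_dist B C"]
      *[of B _ "hausdorff_dist B C" A "hausdorff_dist A B"] B by simp_all
  then show "hausdorff_dist A C \<le> hausdorff_dist A B + hausdorff_dist B C"
    using A C by (subst hausdorff_dist_le_iff) (auto simp: add.commute)
qed

definition hausdorff_topology :: "'a::metric_space set topology" where
  "hausdorff_topology = Metric_space.mtopology {K. closed K \<and> bounded K \<and> K \<noteq> {}} hausdorff_dist"

lemma topspace_hausdorff_topology [simp]:
  "topspace hausdorff_topology = {K :: 'a::metric_space set. closed K \<and> bounded K \<and> K \<noteq> {}}"
  unfolding hausdorff_topology_def
  by (rule Metric_space.topspace_mtopology[OF Metric_space_hausdorff_dist])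

definition domain_topology :: "'a::euclidean_space proj_space set topology" where
  "domain_topology = pullback_topology properly_convex_domains closure hausdorff_topology"

lemma topspace_domain_topology [simp]: "topspace domain_topology = properly_convex_domains"
  unfolding domain_topology_def topspace_pullback_topology
  by (auto simp: bounded_proj_space properly_convex_domains_def proj_domain_def)


section \<open>The space of projective classes\<close>

definition quotient_topology :: "'a topology \<Rightarrow> ('a \<Rightarrow> 'b) \<Rightarrow> 'b topology" where
  "quotient_topology X f =
    topology (\<lambda>U. U \<subseteq> f ` topspace X \<and> openin X {x \<in> topspace X. f x \<in> U})"

lemma openin_quotient_topology:
  "openin (quotient_topology X f) U \<longleftrightarrow>
    U \<subseteq> f ` topspace X \<and> openin X {x \<in> topspace X. f x \<in> U}"
proof -
  have "istopology (\<lambda>U. U \<subseteq> f ` topspace X \<and> openin X {x \<in> topspace X. f x \<in> U})"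
    unfolding istopology_def
  proof (intro conjI allI impI)
    fix S T
    assume S: "S \<subseteq> f ` topspace X \<and> openin X {x \<in> topspace X. f x \<in> S}"
      and T: "T \<subseteq> f ` topspace X \<and> openin X {x \<in> topspace X. f x \<in> T}"
    then show "S \<inter> T \<subseteq> f ` topspace X" by blast
    have "{x \<in> topspace X. f x \<in> S \<inter> T} =
        {x \<in> topspace X. f x \<in> S} \<inter> {x \<in> topspace X. f x \<in> T}" by auto
    then show "openin X {x \<in> topspace X. f x \<in> S \<inter> T}"
      using openin_Int[OF conjunct2[OF S] conjunct2[OF T]] by (simp only:)
  next
    fix \<K>
    assume K: "\<forall>K\<in>\<K>. K \<subseteq> f ` topspace X \<and> openin X {x \<in> topspace X. f x \<in> K}"
    then show "\<Union>\<K> \<subseteq> f ` topspace X" by blast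
    have "{x \<in> topspace X. f x \<in> \<Union>\<K>} = (\<Union>K\<in>\<K>. {x \<in> topspace X. f x \<in> K})" by auto
    moreover have "openin X (\<Union>K\<in>\<K>. {x \<in> topspace X. f x \<in> K})" using K by blast
    ultimately show "openin X {x \<in> topspace X. f x \<in> \<Union>\<K>}" by (simp only:)
  qed
  then show ?thesis
    unfolding quotient_topology_def by simp
qed

lemma topspace_quotient_topology [simp]: "topspace (quotient_topology X f) = f ` topspace X"
proof
  show "topspace (quotient_topology X f) \<subseteq> f ` topspace X"
    using openin_topspace[of "quotient_topology X f"] unfolding openin_quotient_topology
    by (rule conjunct1)
  have "openin (quotient_topology X f) (f ` topspace X)"
    by (simp add: openin_quotient_topology cong: conj_cong)
  then show "f ` topspace X \<subseteq> topspace (quotient_topology X f)"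
    by (rule openin_subset)
qed

lemma quotient_map_quotient_topology: "quotient_map X (quotient_topology X f) f"
  unfolding quotient_map_def by (auto simp: openin_quotient_topology)

definition projective_class :: "'a::euclidean_space proj_space set \<Rightarrow> 'a proj_space set set" where
  "projective_class \<Omega> = {g ` \<Omega> | g. projective_transformation g}"

definition moduli_space :: "'a::euclidean_space proj_space set set topology" where
  "moduli_space = quotient_topology domain_topology projective_class"


section \<open>Minimal closed sets\<close>

definition minimal_closed :: "'a topology \<Rightarrow> 'a set \<Rightarrow> bool" where
  "minimal_closed X M \<longleftrightarrow>
    closedin X M \<and> M \<noteq> {} \<and> \<not> (\<exists>C. closedin X C \<and> C \<noteq> {} \<and> C \<subset> M)"

end

theory Submission
  imports Defs "HOL-Complex_Analysis.Great_Picard"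
begin

text \<open>
  The epigraph of a convex function \<open>f\<close> on the line is a domain in the plane with a marked boundary
  point at infinity, and it is changed by a projective map when \<open>f x\<close> is replaced by
  \<open>a * f (l * x + t) + b * x + c\<close>; up to such changes only the measure \<open>f''\<close> matters. Take for it the
  ternary cascade: every triadic interval gives \<open>7/9\<close> of its mass to its middle third and \<open>1/9\<close> to
  each outer third. This measure is doubling, so suitably normalized rescalings form a compact set,
  and linear maps between cones with a uniformly interior base point are bounded; hence every
  projective limit of the rescaled domains is of the same kind. Every such limit contains exact copies
  of the cascade at all scales, and zooming in at a copy leads back to the cascade. Therefore the
  closure of the class of the cascade is minimal.

  It is not a point. For the cascade itself the boundary has contact of order at most 3 with its
  tangent lines everywhere, while zooming in at the centre of a middle third leads to a
  function that grows so slowly that the boundary is flat to order 4 at the point at infinity.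

  In higher dimensions the cone over the epigraph is multiplied by an orthant, on whose interior
  the diagonal matrices act transitively.
\<close>

section \<open>Second differences of convex functions\<close>

text \<open>Closed sets of the quotient are governed by limits under arbitrary projective maps,
  which may diverge and need not respect the marked point. This obstacle is behind the doubling
  condition: it is invariant under all affine changes with positive factors, so any point of any
  cone of the family can be moved to one base point while the function lands in a single compact
  set. The remaining linear maps and their inverses are then bounded, and the limit is again such a
  cone.

  The weights 1, 7, 1 serve two ends. Their sum 9 = 3^2 makes the second integral exactly
  homogeneous, \<open>cascade (3 * x) = 27 * cascade x\<close>, and the outer share 1/9 bounds
  second differences below by a multiple of \<open>h ^ 3\<close>, hence the contact order 3. At the
  centre of nested middle thirds the function scales by 27/7 per factor 3, so the limit grows like
  |X|^p with p = log(27/7) / log 3. A graph of growth |X|^p meets its tangent at infinity to order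
  p/(p-1), which is at least 4 once p \<le> 4/3, that is (27/7)^3 \<le> 81.\<close>

definition sdiff :: "(real \<Rightarrow> real) \<Rightarrow> real \<Rightarrow> real \<Rightarrow> real" where
  "sdiff f x h = f (x + h) - 2 * f x + f (x - h)"

lemma convex_slope_mono:
  fixes f :: "real \<Rightarrow> real"
  assumes f: "convex_on UNIV f" and "a < b" "c < d" "a \<le> c" "b \<le> d"
  shows "(f b - f a) / (b - a) \<le> (f d - f c) / (d - c)"
proof -
  have 1: "(f b - f a) / (b - a) \<le> (f d - f a) / (d - a)"
  proof (cases "b = d")
    case False
    then have "(f a - f b) / (a - b) \<le> (f a - f d) / (a - d)"
      using assms convex_on_slope_le(1)[OF f, of a d b] by auto
    then show ?thesis
      by (metis minus_diff_eq minus_divide_divide)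
  qed simp
  have 2: "(f d - f a) / (d - a) \<le> (f d - f c) / (d - c)"
  proof (cases "a = c")
    case False
    then have "(f a - f d) / (a - d) \<le> (f c - f d) / (c - d)"
      using assms convex_on_slope_le(2)[OF f, of a d c] by auto
    then show ?thesis
      by (metis minus_diff_eq minus_divide_divide)
  qed simp
  show ?thesis using 1 2 by linarith
qed

lemma sdiff_nonneg:
  assumes f: "convex_on UNIV f"
  shows "0 \<le> sdiff f x h"
proof -
  have "f ((1 - 1/2) *\<^sub>R (x + h) + (1/2) *\<^sub>R (x - h)) \<le> (1 - 1/2) * f (x + h) + (1/2) * f (x - h)"
    by (rule convex_onD[OF f]) auto
  moreover have "(1 - 1/2) *\<^sub>R (x + h) + (1/2) *\<^sub>R (x - h) = x"
    by (simp add: field_simps)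
  ultimately show ?thesis by (simp add: sdiff_def)
qed

text \<open>For smooth \<open>f\<close>, \<open>sdiff f x h\<close> is the integral of
  \<open>f''\<close> against the tent of height \<open>h\<close> over \<open>[x - h, x + h]\<close>,
  and nested intervals have nested tents. The proof needs only monotone chord slopes, applied to
  intervals that share an end.\<close>

lemma sdiff_mono:
  assumes f: "convex_on UNIV f" and k: "0 \<le> k" and le: "\<bar>y - x\<bar> + k \<le> h"
  shows "sdiff f y k \<le> sdiff f x h"
proof -
  have half: "A \<le> 2 * B" if "A / (2 * d) \<le> B / d" "0 < d" for A B d :: real
    using that by (simp add: field_simps)
  have half': "2 * A \<le> B" if "A / d \<le> B / (2 * d)" "0 < d" for A B d :: real
    using that by (simp add: field_simps)
  have right: "sdiff f y k \<le> sdiff f x h" if "x + h = y + k" "k \<le> h" "0 \<le> k" for x y h k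
  proof (cases "k = h")
    case True with that show ?thesis by simp
  next
    case False
    have "(f (y - k) - f (x - h)) / ((y - k) - (x - h)) \<le> (f y - f x) / (y - x)"
      by (rule convex_slope_mono[OF f]) (use that False in auto)
    moreover have "(y - k) - (x - h) = 2 * (y - x)" "y - x > 0" using that False by auto
    ultimately have "(f (y - k) - f (x - h)) / (2 * (y - x)) \<le> (f y - f x) / (y - x)" by simp
    then have "f (y - k) - f (x - h) \<le> 2 * (f y - f x)"
      using \<open>y - x > 0\<close> by (rule half)
    then show ?thesis using that by (simp add: sdiff_def)
  qed
  have left: "sdiff f y k \<le> sdiff f x h" if "x - h = y - k" "k \<le> h" "0 \<le> k" for x y h k
  proof (cases "k = h")
    case True with that show ?thesis by simp
  next
    case False
    have "(f x - f y) / (x - y) \<le> (f (x + h) - f (y + k)) / ((x + h) - (y + k))"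
      by (rule convex_slope_mono[OF f]) (use that False in auto)
    moreover have "(x + h) - (y + k) = 2 * (x - y)" "x - y > 0" using that False by auto
    ultimately have "(f x - f y) / (x - y) \<le> (f (x + h) - f (y + k)) / (2 * (x - y))" by simp
    then have "2 * (f x - f y) \<le> f (x + h) - f (y + k)"
      using \<open>x - y > 0\<close> half'[of "f x - f y" "x - y" "f (x + h) - f (y + k)"] by blast
    then show ?thesis using that by (simp add: sdiff_def)
  qed
  \<comment> \<open>The interval \<open>[x - h, y + k]\<close> shares its right end with the inner
    interval and its left end with the outer one.\<close>
  define m where "m = (y + k + (x - h)) / 2"
  define l where "l = (y + k - (x - h)) / 2"
  have "sdiff f y k \<le> sdiff f m l"
    by (rule right) (use le k in \<open>auto simp: m_def l_def field_simps\<close>)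
  also have "\<dots> \<le> sdiff f x h"
    by (rule left) (use le k in \<open>auto simp: m_def l_def field_simps\<close>)
  finally show ?thesis .
qed

text \<open>The wide tent is the sum of the two shifted narrow tents and twice the central one; the
  doubling estimates rest on this splitting.\<close>

lemma sdiff_double: "sdiff f x (2 * h) = sdiff f (x + h) h + 2 * sdiff f x h + sdiff f (x - h) h"
  by (simp add: sdiff_def algebra_simps)

text \<open>Monotone slopes control the increment near \<open>x\<close> by three values of
  \<open>f\<close>, so convex functions that are bounded at each point are equicontinuous.\<close>

lemma convex_lipschitz_at:
  assumes f: "convex_on UNIV f" and u: "\<bar>u\<bar> \<le> 1"
  shows "\<bar>f (x + u) - f x\<bar> \<le> \<bar>u\<bar> * (\<bar>f (x + 1) - f x\<bar> + \<bar>f (x - 1) - f x\<bar>)"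
proof -
  have *: "\<bar>g (x + u) - g x\<bar> \<le> u * (\<bar>g (x + 1) - g x\<bar> + \<bar>g (x - 1) - g x\<bar>)"
    if g: "convex_on UNIV g" and u: "0 < u" "u \<le> 1" for g :: "real \<Rightarrow> real" and x u
  proof -
    have "(g (x + u) - g x) / (x + u - x) \<le> (g (x + 1) - g x) / (x + 1 - x)"
      by (rule convex_slope_mono[OF g]) (use u in auto)
    then have a: "g (x + u) - g x \<le> u * (g (x + 1) - g x)" using u by (simp add: field_simps)
    have "(g x - g (x - 1)) / (x - (x - 1)) \<le> (g (x + u) - g x) / (x + u - x)"
      by (rule convex_slope_mono[OF g]) (use u in auto)
    then have b: "u * (g x - g (x - 1)) \<le> g (x + u) - g x" using u by (simp add: field_simps)
    have "u * (g (x + 1) - g x) \<le> u * \<bar>g (x + 1) - g x\<bar>"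
      "u * (g (x - 1) - g x) \<le> u * \<bar>g (x - 1) - g x\<bar>"
      "0 \<le> u * \<bar>g (x + 1) - g x\<bar>" "0 \<le> u * \<bar>g (x - 1) - g x\<bar>"
      using u by (auto intro!: mult_left_mono)
    with a b show ?thesis by (simp add: algebra_simps abs_le_iff)
  qed
  have g: "convex_on UNIV (\<lambda>x. f (- x))"
  proof (rule convex_onI)
    fix t x y :: real assume "0 < t" "t < 1"
    then show "f (- ((1 - t) *\<^sub>R x + t *\<^sub>R y)) \<le> (1 - t) * f (- x) + t * f (- y)"
      using convex_onD[OF f, of t "- x" "- y"] by (simp add: algebra_simps)
  qed simp
  consider "u = 0" | "u > 0" | "u < 0" by linarith
  then show ?thesis
  proof cases
    case 2 with *[OF f, of u x] u show ?thesis by simp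
  next
    case 3 with *[OF g, of "- u" "- x"] u show ?thesis by (simp add: algebra_simps)
  qed simp
qed

text \<open>The slopes near \<open>l\<close> are controlled by the values at \<open>l\<close>,
  \<open>l + 1\<close> and \<open>l - 1\<close>, which converge; a moving argument therefore costs
  only a bounded multiple of its distance to \<open>l\<close>.\<close>

lemma convex_converge_at:
  fixes f :: "nat \<Rightarrow> real \<Rightarrow> real"
  assumes f: "\<And>k. convex_on UNIV (f k)" and lim: "\<And>x. (\<lambda>k. f k x) \<longlonglongrightarrow> g x"
    and x: "x \<longlonglongrightarrow> l"
  shows "(\<lambda>k. f k (x k)) \<longlonglongrightarrow> g l"
proof -
  have "(\<lambda>k. \<bar>x k - l\<bar> * (\<bar>f k (l + 1) - f k l\<bar> + \<bar>f k (l - 1) - f k l\<bar>)) \<longlonglongrightarrow>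
      \<bar>l - l\<bar> * (\<bar>g (l + 1) - g l\<bar> + \<bar>g (l - 1) - g l\<bar>)"
    by (intro tendsto_intros lim x)
  then have 0: "(\<lambda>k. \<bar>x k - l\<bar> * (\<bar>f k (l + 1) - f k l\<bar> + \<bar>f k (l - 1) - f k l\<bar>)) \<longlonglongrightarrow> 0"
    by simp
  have "eventually (\<lambda>k. dist (x k) l < 1) sequentially"
    using x by (rule tendstoD) simp
  then have "eventually (\<lambda>k. norm (f k (x k) - f k l) \<le>
      \<bar>x k - l\<bar> * (\<bar>f k (l + 1) - f k l\<bar> + \<bar>f k (l - 1) - f k l\<bar>)) sequentially"
  proof eventually_elim
    case (elim k)
    then show ?case using convex_lipschitz_at[OF f, of "x k - l" k l] by (simp add: dist_real_def)
  qed
  then have "(\<lambda>k. f k (x k) - f k l) \<longlonglongrightarrow> 0"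
    by (rule Lim_null_comparison) (rule 0)
  from tendsto_add[OF this lim[of l]] show ?thesis by simp
qed

lemma convex_on_limit:
  fixes f :: "nat \<Rightarrow> real \<Rightarrow> real"
  assumes f: "\<And>k. convex_on UNIV (f k)" and lim: "\<And>x. (\<lambda>k. f k x) \<longlonglongrightarrow> g x"
  shows "convex_on UNIV g"
proof (rule convex_onI)
  fix t x y :: real assume t: "0 < t" "t < 1"
  show "g ((1 - t) *\<^sub>R x + t *\<^sub>R y) \<le> (1 - t) * g x + t * g y"
  proof (rule LIMSEQ_le[OF lim])
    show "(\<lambda>k. (1 - t) * f k x + t * f k y) \<longlonglongrightarrow> (1 - t) * g x + t * g y"
      by (intro tendsto_intros lim)
    show "\<exists>N. \<forall>k\<ge>N. f k ((1 - t) *\<^sub>R x + t *\<^sub>R y) \<le> (1 - t) * f k x + t * f k y"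
      using convex_onD[OF f, of t x y] t by auto
  qed
qed simp

lemma convex_subgradient:
  fixes f :: "real \<Rightarrow> real"
  assumes "convex_on UNIV f"
  obtains b where "\<And>y. f x + b * (y - x) \<le> f y"
  using convex_le_Inf_differential[OF assms, of x] by (intro that) auto

text \<open>For convex \<open>f\<close> this is the doubling property of the measure \<open>f''\<close>.\<close>
definition balanced :: "real \<Rightarrow> (real \<Rightarrow> real) \<Rightarrow> bool" where
  "balanced C f \<longleftrightarrow> convex_on UNIV f \<and>
    (\<forall>x h. 0 < h \<longrightarrow> 0 < sdiff f x h \<and> sdiff f (x + h) h \<le> C * sdiff f x h \<and>
      sdiff f (x - h) h \<le> C * sdiff f x h)"

lemma balanced_convex: "balanced C f \<Longrightarrow> convex_on UNIV f"
  and balanced_pos: "balanced C f \<Longrightarrow> 0 < h \<Longrightarrow> 0 < sdiff f x h"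
  and balanced_right: "balanced C f \<Longrightarrow> 0 < h \<Longrightarrow> sdiff f (x + h) h \<le> C * sdiff f x h"
  and balanced_left: "balanced C f \<Longrightarrow> 0 < h \<Longrightarrow> sdiff f (x - h) h \<le> C * sdiff f x h"
  by (auto simp: balanced_def)

lemma balanced_const_pos: "balanced C f \<Longrightarrow> 0 < C"
  using balanced_right[of C f 1 0] balanced_pos[of C f 1 0] balanced_pos[of C f 1 1]
  by (smt (verit) mult_nonneg_nonneg mult_nonpos_nonneg)

definition affine_change :: "real \<Rightarrow> real \<Rightarrow> real \<Rightarrow> real \<Rightarrow> real \<Rightarrow> (real \<Rightarrow> real) \<Rightarrow> real \<Rightarrow> real" where
  "affine_change a l t b c f = (\<lambda>x. a * f (l * x + t) + b * x + c)"

lemma sdiff_affine_change: "sdiff (affine_change a l t b c f) x h = a * sdiff f (l * x + t) (l * h)"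
  by (simp add: sdiff_def affine_change_def algebra_simps)

lemma convex_affine_change:
  assumes f: "convex_on UNIV f" and a: "0 \<le> a"
  shows "convex_on UNIV (affine_change a l t b c f)"
proof (rule convex_onI)
  fix s x y :: real assume s: "0 < s" "s < 1"
  have "f ((1 - s) *\<^sub>R (l * x + t) + s *\<^sub>R (l * y + t)) \<le> (1 - s) * f (l * x + t) + s * f (l * y + t)"
    using convex_onD[OF f, of s] s by auto
  moreover have "(1 - s) *\<^sub>R (l * x + t) + s *\<^sub>R (l * y + t) = l * ((1 - s) *\<^sub>R x + s *\<^sub>R y) + t"
    by (simp add: algebra_simps)
  ultimately have "a * f (l * ((1 - s) *\<^sub>R x + s *\<^sub>R y) + t) \<le> a * ((1 - s) * f (l * x + t) + s * f (l * y + t))"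
    using a by (simp add: mult_left_mono)
  then show "affine_change a l t b c f ((1 - s) *\<^sub>R x + s *\<^sub>R y) \<le>
     (1 - s) * affine_change a l t b c f x + s * affine_change a l t b c f y"
    by (simp add: affine_change_def algebra_simps)
qed simp

lemma balanced_affine_change:
  assumes f: "balanced C f" and "0 < a" "0 < l"
  shows "balanced C (affine_change a l t b c f)"
  unfolding balanced_def sdiff_affine_change
proof (intro conjI allI impI)
  show "convex_on UNIV (affine_change a l t b c f)"
    by (rule convex_affine_change) (use assms balanced_convex in auto)
  fix x h :: real assume h: "0 < h"
  then have lh: "0 < l * h" using assms by simp
  show "0 < a * sdiff f (l * x + t) (l * h)"
    using balanced_pos[OF f lh] assms by simp
  show "a * sdiff f (l * (x + h) + t) (l * h) \<le> C * (a * sdiff f (l * x + t) (l * h))"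
    using balanced_right[OF f lh, of "l * x + t"] assms
    by (simp add: algebra_simps)
  show "a * sdiff f (l * (x - h) + t) (l * h) \<le> C * (a * sdiff f (l * x + t) (l * h))"
    using balanced_left[OF f lh, of "l * x + t"] assms
    by (simp add: algebra_simps)
qed

lemma sdiff_doubling:
  assumes D: "\<And>x h. 0 < h \<Longrightarrow> sdiff f (x + h) h \<le> C * sdiff f x h"
    "\<And>x h. 0 < h \<Longrightarrow> sdiff f (x - h) h \<le> C * sdiff f x h"
    and h: "0 < h" and C: "0 \<le> C"
  shows "sdiff f x (2 ^ n * h) \<le> (2 * C + 2) ^ n * sdiff f x h"
proof (induction n)
  case (Suc n)
  have "sdiff f x (2 ^ Suc n * h) = sdiff f x (2 * (2 ^ n * h))" by (simp add: mult.assoc)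
  also have "\<dots> \<le> (2 * C + 2) * sdiff f x (2 ^ n * h)"
    using D(1)[of "2 ^ n * h" x] D(2)[of "2 ^ n * h" x] h
    unfolding sdiff_double by (simp add: distrib_right)
  also have "\<dots> \<le> (2 * C + 2) * ((2 * C + 2) ^ n * sdiff f x h)"
    using Suc C by (intro mult_left_mono) auto
  finally show ?case by (simp add: mult.assoc)
qed simp

text \<open>The doubling inequalities pass to the limit, strict positivity does not. One nonzero
  second difference is enough: a zero elsewhere would spread by doubling to a window that covers
  \<open>[x0 - h0, x0 + h0]\<close>.\<close>

lemma balanced_limit:
  assumes f: "\<And>k. balanced C (f k)" and lim: "\<And>x. (\<lambda>k. f k x) \<longlonglongrightarrow> g x"
    and nz: "0 < sdiff g x0 h0" "0 < h0"
  shows "balanced C g"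
proof -
  have cg: "convex_on UNIV g"
    by (rule convex_on_limit[OF _ lim]) (use f balanced_convex in auto)
  have sl: "(\<lambda>k. sdiff (f k) x h) \<longlonglongrightarrow> sdiff g x h" for x h
    unfolding sdiff_def by (intro tendsto_intros lim)
  have R: "sdiff g (x + h) h \<le> C * sdiff g x h" if "0 < h" for x h
    by (rule LIMSEQ_le[OF sl tendsto_mult_left[OF sl]]) (use balanced_right[OF f that] in auto)
  have L: "sdiff g (x - h) h \<le> C * sdiff g x h" if "0 < h" for x h
    by (rule LIMSEQ_le[OF sl tendsto_mult_left[OF sl]]) (use balanced_left[OF f that] in auto)
  have C: "0 \<le> C" using balanced_const_pos[OF f[of 0]] by simp
  have "0 < sdiff g x h" if h: "0 < h" for x h
  proof (rule ccontr)
    assume "\<not> ?thesis"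
    then have 0: "sdiff g x h = 0" using sdiff_nonneg[OF cg, of x h] by simp
    obtain n where "(\<bar>x0 - x\<bar> + h0) / h < 2 ^ n"
      using real_arch_pow[of 2] by auto
    then have "\<bar>x0 - x\<bar> + h0 \<le> 2 ^ n * h" using h by (simp add: field_simps)
    then have "sdiff g x0 h0 \<le> sdiff g x (2 ^ n * h)"
      using sdiff_mono[OF cg, of h0 x0 x] nz by simp
    also have "\<dots> \<le> (2 * C + 2) ^ n * sdiff g x h"
      by (rule sdiff_doubling) (use R L C h in auto)
    finally show False using 0 nz by simp
  qed
  with R L cg show ?thesis by (simp add: balanced_def)
qed

section \<open>Normalized functions and uniform growth bounds\<close>

definition normalized :: "(real \<Rightarrow> real) \<Rightarrow> bool" where
  "normalized f \<longleftrightarrow> (\<forall>x. 0 \<le> f x) \<and> f 0 = 0 \<and> max (f 1) (f (- 1)) = 1"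

lemma normalized_sdiff: "normalized f \<Longrightarrow> 1 \<le> sdiff f 0 1 \<and> sdiff f 0 1 \<le> 2"
  unfolding normalized_def sdiff_def by (auto simp: max_def split: if_splits)

lemma normalized_upper:
  assumes f: "balanced C f" "normalized f" and x: "\<bar>x\<bar> \<le> 2 ^ n"
  shows "f x \<le> 2 * (2 * C + 2) ^ n"
proof -
  have C: "0 < C" using balanced_const_pos f by auto
  have "0 \<le> f (- x)" "f 0 = 0" using f by (auto simp: normalized_def)
  then have "f x \<le> sdiff f 0 x" by (simp add: sdiff_def)
  also have "sdiff f 0 x \<le> sdiff f 0 (2 ^ n * 1)"
  proof (cases "0 \<le> x")
    case True then show ?thesis using sdiff_mono[OF balanced_convex[OF f(1)], of x 0 0 "2^n"] x by simp
  next
    case False then show ?thesis using sdiff_mono[OF balanced_convex[OF f(1)], of "- x" 0 0 "2^n"] x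
      by (simp add: sdiff_def)
  qed
  also have "\<dots> \<le> (2 * C + 2) ^ n * sdiff f 0 1"
    by (rule sdiff_doubling) (use f C balanced_right balanced_left in auto)
  also have "\<dots> \<le> (2 * C + 2) ^ n * 2"
    using normalized_sdiff[OF f(2)] C by (intro mult_left_mono) auto
  finally show ?thesis by simp
qed

lemma convex_chord_above:
  fixes f :: "real \<Rightarrow> real"
  assumes f: "convex_on UNIV f" "0 < r"
  shows "r \<le> x \<Longrightarrow> f 0 + x * ((f r - f 0) / r) \<le> f x" "x \<le> - r \<Longrightarrow> f 0 - x * ((f (-r) - f 0) / r) \<le> f x"
proof -
  assume x: "r \<le> x"
  have "(f r - f 0) / (r - 0) \<le> (f x - f 0) / (x - 0)"
    by (rule convex_slope_mono[OF f(1)]) (use assms x in auto)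
  then show "f 0 + x * ((f r - f 0) / r) \<le> f x" using x assms by (simp add: field_simps)
next
  assume x: "x \<le> - r"
  have "(f 0 - f x) / (0 - x) \<le> (f 0 - f (-r)) / (0 - (-r))"
    by (rule convex_slope_mono[OF f(1)]) (use assms x in auto)
  then have "(f 0 - f x) / (- x) \<le> (f 0 - f (-r)) / r" by simp
  moreover have "0 < - x" using x assms by simp
  ultimately have "f 0 - f x \<le> (f 0 - f (-r)) / r * (- x)"
    using pos_divide_le_eq by blast
  then show "f 0 - x * ((f (-r) - f 0) / r) \<le> f x" by (simp add: field_simps)
qed

text \<open>The \<open>max\<close> in \<open>normalized\<close> guarantees growth on one side only.
  Doubling transfers the second difference at 0 to 1 and to -1, so the values at 2 and -2 are at
  least \<open>1 / C\<close>, and chord slopes continue from there. The bound depends on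
  \<open>C\<close> alone.\<close>

lemma normalized_lower:
  assumes f: "balanced C f" "normalized f"
  shows "(\<bar>x\<bar> - 2) / (2 * C) \<le> f x"
proof -
  have C: "0 < C" using balanced_const_pos f by auto
  have s: "1 \<le> C * sdiff f 1 1" "1 \<le> C * sdiff f (- 1) 1"
    using normalized_sdiff[OF f(2)] balanced_left[OF f(1), of 1 1] balanced_right[OF f(1), of 1 "- 1"] by auto
  have n: "f 0 = 0" "\<And>x. 0 \<le> f x" using f by (auto simp: normalized_def)
  have 2: "1 / C \<le> f 2" "1 / C \<le> f (- 2)"
    using s n(2)[of 1] n(2)[of "- 1"] C n(1)
    by (simp_all add: sdiff_def field_simps) (smt (verit) mult_nonneg_nonneg)+
  consider "\<bar>x\<bar> < 2" | "2 \<le> x" | "x \<le> - 2" by linarith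
  then show ?thesis
  proof cases
    case 1
    then have "(\<bar>x\<bar> - 2) / (2 * C) \<le> 0" using C by (simp add: divide_le_0_iff)
    with n(2)[of x] show ?thesis by linarith
  next
    case x: 2
    have "x / (2 * C) \<le> x * (f 2 / 2)" using 2 x C mult_left_mono[OF 2(1), of "x/2"] by simp
    also have "\<dots> \<le> f x" using convex_chord_above(1)[OF balanced_convex[OF f(1)], of 2 x] x n by simp
    finally show ?thesis using x C by (simp add: field_simps)
  next
    case x: 3
    have "(-x) / (2 * C) \<le> (-x) * (f (-2) / 2)" using 2 x C mult_left_mono[OF 2(2), of "-x/2"] by simp
    also have "\<dots> \<le> f x" using convex_chord_above(2)[OF balanced_convex[OF f(1)], of 2 x] x n by simp
    finally show ?thesis using x C by (simp add: field_simps)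
  qed
qed

text \<open>Under this growth the epigraph closes up at infinity in the vertical direction alone,
  which is the case \<open>v $ k = 0\<close> of \<open>ccone\<close>.\<close>

definition superlinear :: "(real \<Rightarrow> real) \<Rightarrow> bool" where
  "superlinear f \<longleftrightarrow> (\<forall>L. \<exists>r>0. \<forall>x. r \<le> \<bar>x\<bar> \<longrightarrow> L * \<bar>x\<bar> \<le> f x)"

text \<open>With the supporting line at 0 removed, doubling the argument multiplies the value by at
  least \<open>2 + 1 / C\<close>; the excess over 2 beats every linear function.\<close>

lemma balanced_superlinear:
  assumes f: "balanced C f"
  shows "superlinear f"
  unfolding superlinear_def
proof
  fix L
  obtain b where b: "\<And>y. f 0 + b * (y - 0) \<le> f y"
    using convex_subgradient[OF balanced_convex[OF f]] by metis
  define g where "g = affine_change 1 1 0 (- b) (- f 0) f"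
  have g: "balanced C g" unfolding g_def by (rule balanced_affine_change[OF f]) auto
  have g0: "g 0 = 0" and gn: "0 \<le> g x" for x
    using b[of x] by (auto simp: g_def affine_change_def)
  have C: "0 < C" using balanced_const_pos[OF f] .
  have pos: "0 < g 1" "0 < g (- 1)"
    using balanced_pos[OF g, of "1/2" "1/2"] balanced_pos[OF g, of "1/2" "-1/2"] g0 gn[of "1/2"] gn[of "-1/2"]
    by (auto simp: sdiff_def)
  have step: "(2 + 1 / C) * g h \<le> g (2 * h)" "(2 + 1 / C) * g (- h) \<le> g (- (2 * h))" if h: "0 < h" for h
    using balanced_left[OF g h, of h] balanced_right[OF g h, of "- h"] gn[of h] gn[of "- h"] C
    by (auto simp: sdiff_def g0 field_simps)
  have iter: "(2 + 1 / C) ^ n * g 1 \<le> g (2 ^ n) \<and> (2 + 1 / C) ^ n * g (- 1) \<le> g (- (2 ^ n))" for n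
  proof (induction n)
    case (Suc n)
    have "(2 + 1 / C) * ((2 + 1 / C) ^ n * g 1) \<le> (2 + 1 / C) * g (2 ^ n)"
      "(2 + 1 / C) * ((2 + 1 / C) ^ n * g (- 1)) \<le> (2 + 1 / C) * g (- (2 ^ n))"
      using Suc C by (auto intro!: mult_left_mono)
    with step[of "2 ^ n"] show ?case by (simp add: mult.assoc)
  qed simp
  define m where "m = min (g 1) (g (- 1))"
  have m: "0 < m" using pos by (simp add: m_def)
  \<comment> \<open>\<open>K\<close> leaves room for the requested slope and for the supporting line
    that was subtracted; its constant term is absorbed because \<open>x\<close> has absolute value
    at least 1.\<close>
  define K where "K = \<bar>L\<bar> + \<bar>b\<bar> + \<bar>f 0\<bar>"
  obtain n where "K / m < (1 + 1 / (2 * C)) ^ n"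
    using real_arch_pow[of "1 + 1 / (2 * C)"] C by auto
  then have n: "K < (1 + 1 / (2 * C)) ^ n * m" using m by (simp add: field_simps)
  have "K * 2 ^ n \<le> (2 ^ n * (1 + 1 / (2 * C)) ^ n) * m" using n by simp
  also have "2 ^ n * (1 + 1 / (2 * C)) ^ n = (2 + 1 / C) ^ n"
    using C by (simp flip: power_mult_distrib add: algebra_simps)
  finally have K: "K * 2 ^ n \<le> (2 + 1 / C) ^ n * m" .
  have "(2 + 1 / C) ^ n * m \<le> (2 + 1 / C) ^ n * g 1" "(2 + 1 / C) ^ n * m \<le> (2 + 1 / C) ^ n * g (- 1)"
    using C by (auto simp: m_def intro!: mult_left_mono)
  with iter[of n] K have K2: "K \<le> g (2 ^ n) / 2 ^ n" "K \<le> g (- (2 ^ n)) / 2 ^ n"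
    by (simp_all add: field_simps)
  have "L * \<bar>x\<bar> \<le> f x" if x: "2 ^ n \<le> \<bar>x\<bar>" for x
  proof -
    have x1: "1 \<le> \<bar>x\<bar>" using x one_le_power[of "2::real" n] by linarith
    have "K * \<bar>x\<bar> \<le> g x"
    proof (cases "0 \<le> x")
      case True
      then have "x * K \<le> x * (g (2 ^ n) / 2 ^ n)" using K2 by (intro mult_left_mono) auto
      also have "\<dots> \<le> g x" using convex_chord_above(1)[OF balanced_convex[OF g], of "2 ^ n" x] x True g0 by simp
      finally show ?thesis using True by (simp add: mult.commute)
    next
      case False
      then have "(- x) * K \<le> (- x) * (g (- (2 ^ n)) / 2 ^ n)" using K2 by (intro mult_left_mono) auto
      also have "\<dots> \<le> g x" using convex_chord_above(2)[OF balanced_convex[OF g], of "2 ^ n" x] x False g0 by simp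
      finally show ?thesis using False by (simp add: mult.commute)
    qed
    moreover have "\<bar>b * x\<bar> = \<bar>b\<bar> * \<bar>x\<bar>" by (simp add: abs_mult)
    moreover have "\<bar>f 0\<bar> * 1 \<le> \<bar>f 0\<bar> * \<bar>x\<bar>" using x1 by (intro mult_left_mono) auto
    moreover have "L * \<bar>x\<bar> \<le> \<bar>L\<bar> * \<bar>x\<bar>" by (intro mult_right_mono) auto
    moreover have "g x = f x - b * x - f 0" by (simp add: g_def affine_change_def)
    ultimately show ?thesis
      using abs_ge_minus_self[of "f 0"] abs_ge_minus_self[of "b * x"] unfolding K_def distrib_right by linarith
  qed
  then show "\<exists>r>0. \<forall>x. r \<le> \<bar>x\<bar> \<longrightarrow> L * \<bar>x\<bar> \<le> f x"
    by (intro exI[of _ "2 ^ n"]) auto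
qed

section \<open>The ternary cascade\<close>

text \<open>
  \<open>wt j\<close> is the mass of the interval from \<open>j\<close> to \<open>j + 1\<close>: a factor 7 for every ternary digit 1 of \<open>j\<close>.
  Division by 3 is stationary at 0 and at -1, and the value 7 at -1 makes 0 the division point
  between a middle third (on its left) and a last third.
\<close>
function wt :: "int \<Rightarrow> real" where
  "wt j = (if j = 0 then 1 else if j = - 1 then 7 else (if j mod 3 = 1 then 7 else 1) * wt (j div 3))"
  by auto
termination by (relation "Wellfounded.measure (\<lambda>j. nat \<bar>j\<bar>)") auto

declare wt.simps [simp del]

lemma wt_0 [simp]: "wt 0 = 1" and wt_m1 [simp]: "wt (- 1) = 7"
  by (simp_all add: wt.simps)

text \<open>The stationary values 0 and -1 end in the digits 0 and 2, which carry the factor 1, so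
  the recursion holds there as well.\<close>

lemma wt_rec: "wt j = (if j mod 3 = 1 then 7 else 1) * wt (j div 3)"
proof -
  consider "j = 0" | "j = - 1" | "j \<noteq> 0" "j \<noteq> - 1" by blast
  then show ?thesis
  proof cases
    case 3 then show ?thesis by (subst wt.simps) simp
  qed simp_all
qed

lemma wt_digit: "0 \<le> d \<Longrightarrow> d < 3 \<Longrightarrow> wt (3 * j + d) = (if d = 1 then 7 else 1) * wt j"
  by (subst wt_rec) (auto simp: mod_mult_self4 div_add1_eq)

lemma wt_ge_1: "1 \<le> wt j"
proof (induction j rule: wt.induct)
  case (1 j)
  consider "j = 0" | "j = - 1" | "j \<noteq> 0" "j \<noteq> - 1" by blast
  then show ?case
  proof cases
    case 3 with 1 show ?thesis by (subst wt.simps) auto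
  qed simp_all
qed

text \<open>Inside a triple the factor 7 is explicit. Across two triples the digits are 2 and 0,
  both of factor 1, and the comparison is inherited from the parents; hence the factor does not
  accumulate with depth. Equality of the two outer shares enters here.\<close>

lemma wt_neighbours: "wt (j + 1) \<le> 7 * wt j \<and> wt j \<le> 7 * wt (j + 1)"
proof (induction j rule: wt.induct)
  case (1 j)
  consider "j = 0" | "j = - 1" | "j \<noteq> 0" "j \<noteq> - 1" by blast
  then show ?case
  proof cases
    case 1 then show ?thesis using wt_digit[of 1 0] by simp
  next
    case 3
    define q where "q = j div 3"
    consider "j = 3 * q + 0" | "j = 3 * q + 1" | "j = 3 * q + 2" unfolding q_def by linarith
    then show ?thesis
    proof cases
      case 1 with wt_digit[of 0 q] wt_digit[of 1 q] wt_ge_1[of q] show ?thesis by simp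
    next
      case j: 2
      then have "j + 1 = 3 * q + 2" by simp
      then have "wt (j + 1) = wt q" by (simp only: wt_digit[of 2 q]) simp
      moreover have "wt j = 7 * wt q" using wt_digit[of 1 q] j by simp
      ultimately show ?thesis using wt_ge_1[of q] by simp
    next
      case j: 3
      then have "j + 1 = 3 * (q + 1) + 0" by simp
      then have "wt (j + 1) = wt (q + 1)" by (simp only: wt_digit[of 0 "q + 1"]) simp
      moreover have "wt j = wt q" using wt_digit[of 2 q] j by simp
      ultimately show ?thesis using "1"[OF 3] by (simp add: q_def)
    qed
  qed simp
qed

section \<open>Discrete first and second integrals of the weight\<close>

definition isum :: "(int \<Rightarrow> real) \<Rightarrow> int \<Rightarrow> real" where
  "isum g j = (\<Sum>i\<in>{0..<j}. g i) - (\<Sum>i\<in>{j..<0}. g i)"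

lemma isum_0 [simp]: "isum g 0 = 0"
  by (simp add: isum_def)

lemma isum_Suc: "isum g (j + 1) = isum g j + g j"
proof (cases "0 \<le> j")
  case True
  then have "{0..<j + 1} = insert j {0..<j}" by auto
  with True show ?thesis by (simp add: isum_def)
next
  case False
  then have "{j..<0} = insert j {j + 1..<0}" by auto
  with False show ?thesis by (simp add: isum_def)
qed

lemma int_fun_eqI:
  fixes f g :: "int \<Rightarrow> real"
  assumes "f 0 = g 0" and "\<And>j. f (j + 1) - f j = g (j + 1) - g j"
  shows "f j = g j"
proof (induction j rule: int_induct[where k = 0])
  case (step1 i) with assms(2)[of i] show ?case by simp
next
  case (step2 i) with assms(2)[of "i - 1"] show ?case by simp
qed (rule assms)

text \<open>First and second integrals of the weight; the trapezoidal rule is exact because the mass in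
  each unit interval is symmetric.\<close>
definition cum :: "int \<Rightarrow> real" where "cum = isum wt"
definition cum2 :: "int \<Rightarrow> real" where "cum2 = isum (\<lambda>j. (cum j + cum (j + 1)) / 2)"

lemma cum_0 [simp]: "cum 0 = 0" and cum2_0 [simp]: "cum2 0 = 0"
  by (simp_all add: cum_def cum2_def)

lemma cum_Suc: "cum (j + 1) = cum j + wt j"
  by (simp add: cum_def isum_Suc)

lemma cum2_Suc: "cum2 (j + 1) = cum2 j + cum j + wt j / 2"
  by (simp add: cum2_def isum_Suc) (simp add: cum_Suc)

lemma cum_digits: "cum (3 * j + 1) = cum (3 * j) + wt j" "cum (3 * j + 2) = cum (3 * j) + 8 * wt j"
  "cum (3 * j + 3) = cum (3 * j) + 9 * wt j"
  using cum_Suc[of "3 * j"] cum_Suc[of "3 * j + 1"] cum_Suc[of "3 * j + 2"]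
    wt_digit[of 0 j] wt_digit[of 1 j] wt_digit[of 2 j] by (simp_all add: add.assoc)

lemma cum_scale3: "cum (3 * j) = 9 * cum j"
  by (rule int_fun_eqI) (use cum_digits in \<open>simp_all add: algebra_simps cum_Suc\<close>)

text \<open>Over one triple the trapezoids add up to \<open>3 * cum (3 * j) + 27 / 2 * wt j\<close>,
  which is 27 times the coarse trapezoid. So the values on the finer grid extend those on the
  coarser one.\<close>

lemma cum2_scale3: "cum2 (3 * j) = 27 * cum2 j"
proof (rule int_fun_eqI)
  fix j
  have "cum2 (3 * j + 3) = cum2 (3 * j) + 27 * (cum j + wt j / 2)"
    using cum2_Suc[of "3 * j"] cum2_Suc[of "3 * j + 1"] cum2_Suc[of "3 * j + 2"] cum_digits[of j]
      wt_digit[of 0 j] wt_digit[of 1 j] wt_digit[of 2 j] cum_scale3[of j] by (simp add: add.assoc algebra_simps)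
  moreover have "3 * (j + 1) = 3 * j + 3" by simp
  ultimately show "cum2 (3 * (j + 1)) - cum2 (3 * j) = 27 * cum2 (j + 1) - 27 * cum2 j"
    by (simp add: cum2_Suc)
qed simp

lemma cum_scale: "cum (3 ^ k * j) = 9 ^ k * cum j"
  by (induction k) (simp_all add: mult.assoc cum_scale3)

lemma cum2_scale: "cum2 (3 ^ k * j) = 27 ^ k * cum2 j"
  by (induction k) (simp_all add: mult.assoc cum2_scale3)

lemma cum_mono: "i \<le> j \<Longrightarrow> cum i \<le> cum j"
proof (induction j rule: int_ge_induct)
  case (step j) then show ?case using cum_Suc[of j] wt_ge_1[of j] by simp
qed simp

lemma cum2_tangent: "cum2 i + cum i * of_int (l - i) \<le> cum2 l"
proof (induction l rule: int_induct[where k = i])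
  case (step1 l) then show ?case using cum2_Suc[of l] wt_ge_1[of l] cum_mono[of i l]
    by (simp add: algebra_simps)
next
  case (step2 l)
  then show ?case using cum2_Suc[of "l - 1"] wt_ge_1[of "l - 1"] cum_Suc[of "l - 1"] cum_mono[of l i]
    by (simp add: algebra_simps)
qed simp

text \<open>
  The cascade repeats itself to the right of every integer, but on both sides only of those with last
  digit 2, which are again division points between a middle and a last third.
\<close>
definition copy_range :: "nat \<Rightarrow> int \<Rightarrow> int \<Rightarrow> bool" where
  "copy_range k j i \<longleftrightarrow> i \<le> 3 ^ k \<and> (if j mod 3 = 2 then - (3 ^ k) \<le> i else 0 \<le> i)"

text \<open>For \<open>i \<ge> 0\<close> the digits of \<open>i\<close> are appended to those of
  \<open>j\<close> and the factors multiply. For \<open>i < 0\<close> the leading part is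
  \<open>j - 1\<close>; when \<open>j\<close> ends in 2 it ends in 1, and
  \<open>wt (j - 1) = 7 * wt j\<close> matches \<open>wt (- 1) = 7\<close>.\<close>

lemma wt_copy: "copy_range k j i \<Longrightarrow> i < 3 ^ k \<Longrightarrow> wt (3 ^ k * j + i) = wt j * wt i"
proof (induction k arbitrary: i)
  case 0
  show ?case
  proof (cases "i = 0")
    case False
    with 0 have i: "i = - 1" and j: "j mod 3 = 2" by (auto simp: copy_range_def split: if_splits)
    define q where "q = j div 3"
    have jq: "j = 3 * q + 2" using j unfolding q_def by presburger
    have "j - 1 = 3 * q + 1" using jq by simp
    then have "wt (j - 1) = 7 * wt q" by (simp only: wt_digit[of 1 q]) simp
    moreover have "wt j = wt q" using jq wt_digit[of 2 q] by simp
    ultimately show ?thesis using i by simp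
  qed simp
next
  case (Suc k)
  define q d where "q = i div 3" and "d = i mod 3"
  have i: "i = 3 * q + d" and d: "0 \<le> d" "d < 3" by (auto simp: q_def d_def)
  have "copy_range k j q" "q < 3 ^ k"
    using Suc.prems i d by (auto simp: copy_range_def split: if_splits)
  then have "wt (3 ^ k * j + q) = wt j * wt q" by (rule Suc.IH)
  then have "wt (3 * (3 ^ k * j + q) + d) = (if d = 1 then 7 else 1) * (wt j * wt q)"
    by (simp only: wt_digit[OF d])
  moreover have "3 * (3 ^ k * j + q) + d = 3 ^ Suc k * j + i" by (simp add: i)
  ultimately show ?case using wt_digit[OF d, of q] by (metis i mult.left_commute)
qed

text \<open>The step is an equality of truth values so that one premise serves both directions away
  from 0. It integrates \<open>wt_copy\<close> to \<open>cum\<close> and then to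
  \<open>cum2\<close>.\<close>

lemma copy_induct:
  assumes "copy_range k j i" "P 0"
    and "\<And>i. copy_range k j i \<Longrightarrow> copy_range k j (i + 1) \<Longrightarrow> wt (3 ^ k * j + i) = wt j * wt i \<Longrightarrow> P i = P (i + 1)"
  shows "P i"
proof (cases "0 \<le> i")
  case True
  then show ?thesis using assms(1)
  proof (induction i rule: int_ge_induct)
    case (step i)
    moreover have "copy_range k j i" using step by (auto simp: copy_range_def split: if_splits)
    ultimately show ?case using assms(3)[of i] wt_copy[of k j i] by (auto simp: copy_range_def)
  qed (rule assms)
next
  case False
  then have "i \<le> 0" by simp
  then show ?thesis using assms(1)
  proof (induction i rule: int_le_induct)
    case (step i)
    moreover have "copy_range k j i" using step by (auto simp: copy_range_def split: if_splits)
    ultimately show ?case using assms(3)[of "i - 1"] wt_copy[of k j "i - 1"] by (auto simp: copy_range_def)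
  qed (rule assms)
qed

lemma cum_copy: "copy_range k j i \<Longrightarrow> cum (3 ^ k * j + i) = 9 ^ k * cum j + wt j * cum i"
proof (rule copy_induct[of k j i], assumption)
  fix i assume "wt (3 ^ k * j + i) = wt j * wt i"
  then have "cum (3 ^ k * j + (i + 1)) = cum (3 ^ k * j + i) + wt j * wt i"
    using cum_Suc[of "3 ^ k * j + i"] by (simp add: add.assoc)
  then show "(cum (3 ^ k * j + i) = 9 ^ k * cum j + wt j * cum i) =
    (cum (3 ^ k * j + (i + 1)) = 9 ^ k * cum j + wt j * cum (i + 1))"
    using cum_Suc[of i] by (simp add: distrib_left)
qed (simp add: cum_scale)

lemma cum2_copy:
  "copy_range k j i \<Longrightarrow> cum2 (3 ^ k * j + i) = 27 ^ k * cum2 j + 9 ^ k * cum j * of_int i + wt j * cum2 i"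
proof (rule copy_induct[of k j i], assumption)
  fix i assume w: "wt (3 ^ k * j + i) = wt j * wt i" and r: "copy_range k j i"
  have "cum2 (3 ^ k * j + (i + 1)) = cum2 (3 ^ k * j + i) + 9 ^ k * cum j + wt j * cum i + wt j * wt i / 2"
    using cum2_Suc[of "3 ^ k * j + i"] w cum_copy[OF r] by (simp add: add.assoc)
  then show "(cum2 (3 ^ k * j + i) = 27 ^ k * cum2 j + 9 ^ k * cum j * of_int i + wt j * cum2 i) =
    (cum2 (3 ^ k * j + (i + 1)) = 27 ^ k * cum2 j + 9 ^ k * cum j * of_int (i + 1) + wt j * cum2 (i + 1))"
    using cum2_Suc[of i] by (auto simp: distrib_left)
qed (simp add: cum2_scale)

text \<open>The supporting line at \<open>j / 3 ^ k\<close>.\<close>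
definition tangent :: "nat \<Rightarrow> int \<Rightarrow> real \<Rightarrow> real" where
  "tangent k j x = (cum2 j + cum j * (3 ^ k * x - of_int j)) / 27 ^ k"

text \<open>As a supremum of lines at triadic points, the second integral is convex at once and
  needs no measure; at triadic points the supremum is attained by the tangent there.\<close>

definition cascade :: "real \<Rightarrow> real" where
  "cascade x = (SUP (k, j)\<in>UNIV. tangent k j x)"

lemma tangent_refine: "tangent (k + m) (3 ^ m * j) x = tangent k j x"
proof -
  have "cum2 (3 ^ m * j) + cum (3 ^ m * j) * (3 ^ (k + m) * x - of_int (3 ^ m * j)) =
     27 ^ m * (cum2 j + cum j * (3 ^ k * x - of_int j))"
    unfolding cum_scale cum2_scale using power_mult_distrib[of "9::real" 3 m] by (simp add: power_add algebra_simps)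
  then show ?thesis by (simp add: tangent_def power_add)
qed

text \<open>Both triadic points are written with the denominator \<open>3 ^ (k + m)\<close>, where
  the claim is the integer inequality \<open>cum2_tangent\<close>.\<close>

lemma tangent_le: "tangent k j (of_int i / 3 ^ m) \<le> cum2 i / 27 ^ m"
proof -
  have "tangent k j (of_int i / 3 ^ m) = tangent (k + m) (3 ^ m * j) (of_int i / 3 ^ m)"
    by (simp add: tangent_refine)
  also have "\<dots> = (cum2 (3 ^ m * j) + cum (3 ^ m * j) * of_int (3 ^ k * i - 3 ^ m * j)) / 27 ^ (k + m)"
    by (simp add: tangent_def power_add)
  also have "\<dots> \<le> cum2 (3 ^ k * i) / 27 ^ (k + m)"
    by (intro divide_right_mono cum2_tangent) simp
  also have "\<dots> = cum2 i / 27 ^ m"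
    by (simp add: cum2_scale power_add)
  finally show ?thesis .
qed

lemma tangent_convex: "tangent k j ((1 - t) * x + t * y) = (1 - t) * tangent k j x + t * tangent k j y"
  by (simp add: tangent_def field_simps)

text \<open>A tangent is affine, so between consecutive integers it is a mean of its values there,
  and these are at most the values of \<open>cum2\<close>.\<close>

lemma tangent_bdd: "bdd_above (range (\<lambda>(k, j). tangent k j x))"
proof -
  define t where "t = frac x"
  have t: "0 \<le> t" "t < 1" by (auto simp: t_def frac_lt_1)
  have x: "x = (1 - t) * of_int \<lfloor>x\<rfloor> + t * of_int (\<lfloor>x\<rfloor> + 1)"
    by (simp add: t_def frac_def algebra_simps)
  have "tangent k j x \<le> \<bar>cum2 \<lfloor>x\<rfloor>\<bar> + \<bar>cum2 (\<lfloor>x\<rfloor> + 1)\<bar>" for k j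
  proof -
    have "tangent k j x = (1 - t) * tangent k j (of_int \<lfloor>x\<rfloor>) + t * tangent k j (of_int (\<lfloor>x\<rfloor> + 1))"
      using tangent_convex[of k j t] x by metis
    also have "\<dots> \<le> (1 - t) * \<bar>cum2 \<lfloor>x\<rfloor>\<bar> + t * \<bar>cum2 (\<lfloor>x\<rfloor> + 1)\<bar>"
      using tangent_le[of k j "\<lfloor>x\<rfloor>" 0] tangent_le[of k j "\<lfloor>x\<rfloor> + 1" 0] t
      by (intro add_mono mult_left_mono) auto
    also have "\<dots> \<le> 1 * \<bar>cum2 \<lfloor>x\<rfloor>\<bar> + 1 * \<bar>cum2 (\<lfloor>x\<rfloor> + 1)\<bar>"
      using t by (intro add_mono mult_right_mono) auto
    finally show ?thesis by simp
  qed
  then show ?thesis by (auto intro!: bdd_aboveI)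
qed

lemma tangent_le_cascade: "tangent k j x \<le> cascade x"
  unfolding cascade_def using cSUP_upper[OF _ tangent_bdd, of "(k, j)" x] by simp

lemma cascade_triadic: "cascade (of_int i / 3 ^ m) = cum2 i / 27 ^ m"
proof (rule antisym)
  show "cascade (of_int i / 3 ^ m) \<le> cum2 i / 27 ^ m"
    unfolding cascade_def by (rule cSUP_least) (auto intro: tangent_le)
  show "cum2 i / 27 ^ m \<le> cascade (of_int i / 3 ^ m)"
    using tangent_le_cascade[of m i "of_int i / 3 ^ m"] by (simp add: tangent_def)
qed

lemma cascade_int: "cascade (of_int i) = cum2 i"
  using cascade_triadic[of i 0] by simp

lemma cascade_convex: "convex_on UNIV cascade"
proof (rule convex_onI)
  fix t x y :: real assume t: "0 < t" "t < 1"
  have "tangent k j ((1 - t) * x + t * y) \<le> (1 - t) * cascade x + t * cascade y" for k j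
    unfolding tangent_convex using t by (intro add_mono mult_left_mono tangent_le_cascade) auto
  then show "cascade ((1 - t) *\<^sub>R x + t *\<^sub>R y) \<le> (1 - t) * cascade x + t * cascade y"
    by (subst cascade_def) (auto intro!: cSUP_least)
qed simp

lemma convex_real_continuous: "convex_on UNIV f \<Longrightarrow> continuous_on UNIV (f :: real \<Rightarrow> real)"
  by (rule convex_on_continuous) auto

text \<open>The floors of \<open>3 ^ m * x\<close> give triadic approximations that stay in the
  interval because its ends are integers.\<close>

lemma triadic_eqI:
  fixes f g :: "real \<Rightarrow> real"
  assumes f: "continuous_on UNIV f" and g: "continuous_on UNIV g"
    and eq: "\<And>m i. a * 3 ^ m \<le> i \<Longrightarrow> i \<le> b * 3 ^ m \<Longrightarrow> f (of_int i / 3 ^ m) = g (of_int i / 3 ^ m)"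
    and x: "of_int a \<le> x" "x \<le> of_int b"
  shows "f x = g x"
proof -
  define q where "q m = of_int \<lfloor>3 ^ m * x\<rfloor> / (3 ^ m :: real)" for m
  have q: "q \<longlonglongrightarrow> x"
  proof (rule tendsto_sandwich[where f = "\<lambda>m. x - (1/3) ^ m" and h = "\<lambda>m. x"])
    show "\<forall>\<^sub>F m in sequentially. x - (1/3) ^ m \<le> q m"
    proof (intro always_eventually allI)
      fix m
      have "3 ^ m * x - 1 \<le> of_int \<lfloor>3 ^ m * x\<rfloor>" by linarith
      then have "(3 ^ m * x - 1) / 3 ^ m \<le> q m" unfolding q_def by (rule divide_right_mono) simp
      then show "x - (1/3) ^ m \<le> q m" by (simp add: diff_divide_distrib power_one_over)
    qed
    show "\<forall>\<^sub>F m in sequentially. q m \<le> x"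
      by (intro always_eventually allI) (simp add: q_def field_simps)
    have "(\<lambda>m. x - (1/3) ^ m) \<longlonglongrightarrow> x - 0" by (intro tendsto_intros LIMSEQ_realpow_zero) auto
    then show "(\<lambda>m. x - (1/3) ^ m) \<longlonglongrightarrow> x" by simp
  qed simp
  have "f (q m) = g (q m)" for m
    unfolding q_def
  proof (rule eq)
    have "of_int (a * 3 ^ m) \<le> 3 ^ m * x" using x by simp
    then show "a * 3 ^ m \<le> \<lfloor>3 ^ m * x\<rfloor>" by (simp add: le_floor_iff)
    have "of_int \<lfloor>3 ^ m * x\<rfloor> \<le> 3 ^ m * x" by simp
    also have "\<dots> \<le> of_int (b * 3 ^ m)" using x by simp
    finally show "\<lfloor>3 ^ m * x\<rfloor> \<le> b * 3 ^ m" by linarith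
  qed
  moreover have "(\<lambda>m. f (q m)) \<longlonglongrightarrow> f x" "(\<lambda>m. g (q m)) \<longlonglongrightarrow> g x"
    using f g q by (auto simp: continuous_on_eq_continuous_at isCont_tendsto_compose)
  ultimately show ?thesis using LIMSEQ_unique by simp
qed

lemma cascade_continuous: "continuous_on S cascade"
  using convex_real_continuous[OF cascade_convex] continuous_on_subset by blast

lemma cascade_scale3: "cascade (3 * x) = 27 * cascade x"
proof (rule triadic_eqI[where f = "\<lambda>x. cascade (3 * x)" and g = "\<lambda>x. 27 * cascade x" and a = "\<lfloor>x\<rfloor>" and b = "\<lceil>x\<rceil>"])
  show "continuous_on UNIV (\<lambda>x. cascade (3 * x))"
    by (rule continuous_on_compose2[OF cascade_continuous]) (auto intro!: continuous_intros)
  show "continuous_on UNIV (\<lambda>x. 27 * cascade x)" by (intro continuous_intros cascade_continuous)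
  fix m i
  show "cascade (3 * (of_int i / 3 ^ m)) = 27 * cascade (of_int i / 3 ^ m)"
    using cascade_triadic[of "3 * i" m] by (simp add: cascade_triadic cum2_scale3)
qed auto

lemma cascade_copy:
  assumes "(if j mod 3 = 2 then - 1 else 0) \<le> y" "y \<le> 1"
  shows "cascade (of_int j + y) = wt j * cascade y + cum j * y + cum2 j"
proof (rule triadic_eqI[where a = "if j mod 3 = 2 then - 1 else 0" and b = 1 and f = "\<lambda>y. cascade (of_int j + y)"
      and g = "\<lambda>y. wt j * cascade y + cum j * y + cum2 j"])
  show "continuous_on UNIV (\<lambda>y. cascade (of_int j + y))"
    by (rule continuous_on_compose2[OF cascade_continuous]) (auto intro!: continuous_intros)
  show "continuous_on UNIV (\<lambda>y. wt j * cascade y + cum j * y + cum2 j)"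
    by (intro continuous_intros cascade_continuous)
  fix m and i :: int
  assume "(if j mod 3 = 2 then - 1 else 0) * 3 ^ m \<le> i" "i \<le> 1 * 3 ^ m"
  then have r: "copy_range m j i" by (auto simp: copy_range_def split: if_splits)
  have "of_int j + of_int i / 3 ^ m = of_int (3 ^ m * j + i) / (3 ^ m :: real)"
    by (simp add: field_simps)
  then have "cascade (of_int j + of_int i / 3 ^ m) = cum2 (3 ^ m * j + i) / 27 ^ m"
    by (simp only: cascade_triadic)
  also have "\<dots> = wt j * cascade (of_int i / 3 ^ m) + cum j * (of_int i / 3 ^ m) + cum2 j"
    unfolding cum2_copy[OF r] cascade_triadic using power_mult_distrib[of "9::real" 3 m] by (simp add: field_simps)
  finally show "cascade (of_int j + of_int i / 3 ^ m) = wt j * cascade (of_int i / 3 ^ m) + cum j * (of_int i / 3 ^ m) + cum2 j" .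
qed (use assms in auto)

section \<open>Doubling and the cubic lower bound for the cascade\<close>

text \<open>Powers of 3 scale the cascade exactly, so every window can be brought to half-width
  between 3 and 9: wide enough to contain the unit cells on both sides of a nearby integer, narrow
  enough to meet boundedly many. The exponent may be negative.\<close>

lemma cascade_rescale:
  assumes h: "0 < h"
  obtains s where "0 < s" "3 \<le> s * h" "s * h \<le> 9" "\<And>x. cascade (s * x) = s ^ 3 * cascade x"
proof -
  have "\<exists>s>0. 3 \<le> s * h \<and> s * h \<le> 9 \<and> (\<forall>x. cascade (s * x) = s ^ 3 * cascade x)"
  proof -
    have up: "cascade (3 ^ m * x) = (3 ^ m) ^ 3 * cascade x" for m x
      by (induction m) (simp_all add: mult.assoc cascade_scale3 power_mult_distrib)
    have down: "cascade (x / 3 ^ m) = (1 / 3 ^ m) ^ 3 * cascade x" for m x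
      using up[of m "x / 3 ^ m"] by (simp add: power_divide field_simps)
    define n where "n = \<lfloor>log 3 (3 / h)\<rfloor> + 1"
    define s where "s = (3::real) powr (of_int n)"
    have "3 / h = 3 powr (log 3 (3 / h))" using h by simp
    also have "\<dots> \<le> s" unfolding s_def n_def by (intro powr_mono) linarith+
    finally have lo: "3 / h \<le> s" .
    have "s \<le> 3 powr (log 3 (3 / h) + 1)" unfolding s_def n_def by (intro powr_mono) linarith+
    then have hi: "s \<le> 3 * (3 / h)" using h by (simp add: powr_add)
    have "cascade (s * x) = s ^ 3 * cascade x" for x
    proof (cases "0 \<le> n")
      case True
      then have "s = 3 powr real (nat n)" by (simp add: s_def)
      then have "s = 3 ^ nat n" by (subst (asm) powr_realpow) simp_all
      then show ?thesis using up by simp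
    next
      case False
      have "s = inverse (3 powr - real_of_int n)" by (simp add: s_def powr_minus)
      also have "- real_of_int n = real (nat (- n))" using False by simp
      finally have "s = inverse (3 ^ nat (- n))" by (subst (asm) powr_realpow) simp_all
      then show ?thesis using down[of x "nat (- n)"] by (simp add: inverse_eq_divide)
    qed
    moreover have "0 < s" by (simp add: s_def)
    ultimately show ?thesis using lo hi h by (intro exI[of _ s]) (simp add: field_simps)
  qed
  then obtain s where "0 < s" "3 \<le> s * h" "s * h \<le> 9" "\<forall>x. cascade (s * x) = s ^ 3 * cascade x" by (elim exE conjE)
  then show ?thesis by (intro that[of s]) simp_all
qed

lemma sdiff_cascade_int: "sdiff cascade (of_int j) 1 = (wt j + wt (j - 1)) / 2"
proof -
  have "sdiff cascade (of_int j) 1 = cum2 (j + 1) - 2 * cum2 j + cum2 (j - 1)"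
    using cascade_int[of "j + 1"] cascade_int[of "j - 1"] by (simp add: sdiff_def cascade_int)
  then show ?thesis
    using cum2_Suc[of j] cum2_Suc[of "j - 1"] cum_Suc[of "j - 1"] by (simp add: field_simps)
qed

lemma sdiff_cascade_neighbour:
  "sdiff cascade (of_int (j + 1)) 1 \<le> 7 * sdiff cascade (of_int j) 1"
  "sdiff cascade (of_int (j - 1)) 1 \<le> 7 * sdiff cascade (of_int j) 1"
  unfolding sdiff_cascade_int using wt_neighbours[of j] wt_neighbours[of "j - 1"] wt_neighbours[of "j - 2"] by auto

lemma sdiff_cascade_shift:
  "sdiff cascade (of_int (j + int m)) 1 \<le> 7 ^ m * sdiff cascade (of_int j) 1 \<and>
   sdiff cascade (of_int (j - int m)) 1 \<le> 7 ^ m * sdiff cascade (of_int j) 1"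
proof (induction m)
  case (Suc m)
  have "j + int (Suc m) = (j + int m) + 1" "j - int (Suc m) = (j - int m) - 1" by auto
  then show ?case using Suc sdiff_cascade_neighbour(1)[of "j + int m"] sdiff_cascade_neighbour(2)[of "j - int m"]
    by (simp only: power_Suc mult.assoc) linarith
qed simp

text \<open>The constant depends on \<open>n\<close> but not on \<open>j\<close>: a shift by
  \<open>2 ^ n\<close> integers costs a fixed power of 7.\<close>

lemma sdiff_cascade_int_doubling:
  "\<exists>K\<ge>0. \<forall>j. sdiff cascade (of_int j) (2 ^ n) \<le> K * sdiff cascade (of_int j) 1"
proof (induction n)
  case (Suc n)
  then obtain K where K: "\<And>j. sdiff cascade (of_int j) (2 ^ n) \<le> K * sdiff cascade (of_int j) 1" "0 \<le> K" by blast
  define m :: nat where "m = 2 ^ n"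
  have "sdiff cascade (of_int j) (2 ^ Suc n) \<le> K * (2 * 7 ^ m + 2) * sdiff cascade (of_int j) 1" for j
  proof -
    have "sdiff cascade (of_int j) (2 ^ Suc n) = sdiff cascade (of_int (j + int m)) (2 ^ n)
        + 2 * sdiff cascade (of_int j) (2 ^ n) + sdiff cascade (of_int (j - int m)) (2 ^ n)"
      using sdiff_double[of cascade "of_int j" "2 ^ n"] by (simp add: m_def)
    also have "\<dots> \<le> K * sdiff cascade (of_int (j + int m)) 1 + 2 * (K * sdiff cascade (of_int j) 1)
        + K * sdiff cascade (of_int (j - int m)) 1"
      by (intro add_mono mult_left_mono K) auto
    also have "\<dots> \<le> K * (7 ^ m * sdiff cascade (of_int j) 1) + 2 * (K * sdiff cascade (of_int j) 1)
        + K * (7 ^ m * sdiff cascade (of_int j) 1)"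
      using sdiff_cascade_shift[of j m] K(2) by (intro add_mono mult_left_mono) auto
    finally show ?thesis by (simp add: algebra_simps)
  qed
  then show ?case using K(2) by (intro exI[of _ "K * (2 * 7 ^ m + 2)"]) simp
qed (intro exI[of _ 1], simp)

lemma sdiff_cascade_scale:
  assumes "\<And>x. cascade (s * x) = s ^ 3 * cascade x"
  shows "sdiff cascade (s * x) (s * h) = s ^ 3 * sdiff cascade x h"
  using assms[of "x + h"] assms[of "x - h"] assms[of x] by (simp add: sdiff_def algebra_simps)

text \<open>All weights are at least 1, so a rescaled window has second difference at least 1;
  undoing a scale of at most \<open>9 / h\<close> costs \<open>9 ^ 3 = 729\<close>. The exponent 3
  is what later limits the contact order.\<close>

lemma sdiff_cascade_lower:
  assumes h: "0 < h"
  shows "h ^ 3 / 729 \<le> sdiff cascade x h"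
proof -
  obtain s where s: "0 < s" "3 \<le> s * h" "s * h \<le> 9" "\<And>x. cascade (s * x) = s ^ 3 * cascade x"
    using cascade_rescale[OF h] by metis
  define j where "j = \<lfloor>s * x\<rfloor>"
  have j: "\<bar>of_int j - s * x\<bar> \<le> 1" unfolding j_def by linarith
  have "1 \<le> sdiff cascade (of_int j) 1"
    unfolding sdiff_cascade_int using wt_ge_1[of j] wt_ge_1[of "j - 1"] by simp
  also have "\<dots> \<le> sdiff cascade (s * x) (s * h)"
    by (rule sdiff_mono[OF cascade_convex]) (use s(2) j in linarith)+
  also have "\<dots> = s ^ 3 * sdiff cascade x h" by (rule sdiff_cascade_scale) (rule s)
  finally have 1: "1 \<le> s ^ 3 * sdiff cascade x h" .
  have "(s * h) ^ 3 \<le> 9 ^ 3" using s(1-3) h by (intro power_mono) auto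
  then have "s ^ 3 * (h ^ 3 / 729) \<le> s ^ 3 * sdiff cascade x h"
    using 1 by (simp add: power_mult_distrib)
  then show ?thesis using s(1) by simp
qed

lemma cascade_balanced: "\<exists>C. balanced C cascade"
proof -
  obtain K where K: "0 \<le> K" and K0: "\<forall>j. sdiff cascade (of_int j) (2 ^ 5) \<le> K * sdiff cascade (of_int j) 1"
    using sdiff_cascade_int_doubling[of 5] by (elim exE conjE) (rule that)
  have "sdiff cascade y h \<le> K * sdiff cascade x h" if h: "0 < h" and y: "\<bar>y - x\<bar> \<le> h" for x y h
  proof -
    obtain s where s: "0 < s" "3 \<le> s * h" "s * h \<le> 9" "\<And>x. cascade (s * x) = s ^ 3 * cascade x"
      using cascade_rescale[OF h] by metis
    define j where "j = \<lfloor>s * x\<rfloor>"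
    have j: "\<bar>of_int j - s * x\<bar> \<le> 1" unfolding j_def by linarith
    have "s * \<bar>y - x\<bar> \<le> s * h" using y s(1) by (intro mult_left_mono) auto
    then have yx: "\<bar>s * y - s * x\<bar> \<le> 9" using s(1,3) by (simp only: right_diff_distrib[symmetric] abs_mult abs_of_pos)
    \<comment> \<open>The distances 1 and 9 and the half-width 9 add up to 19, and
      \<open>2 ^ 5\<close> is the first power of 2 above it.\<close>
    have yj: "\<bar>s * y - of_int j\<bar> + s * h \<le> 32" "0 \<le> s * h" using j yx s(2,3) by linarith+
    have "s ^ 3 * sdiff cascade y h = sdiff cascade (s * y) (s * h)" by (rule sdiff_cascade_scale[symmetric]) (rule s)
    also have "\<dots> \<le> sdiff cascade (of_int j) (2 ^ 5)"
      by (rule sdiff_mono[OF cascade_convex]) (use yj in simp)+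
    also have "\<dots> \<le> K * sdiff cascade (of_int j) 1" by (rule K0[rule_format])
    also have "\<dots> \<le> K * sdiff cascade (s * x) (s * h)"
      by (rule mult_left_mono[OF sdiff_mono[OF cascade_convex] K]) (use s(2) j in linarith)+
    also have "\<dots> = K * (s ^ 3 * sdiff cascade x h)" by (simp only: sdiff_cascade_scale[OF s(4)])
    finally show ?thesis using s(1) by (simp add: mult.left_commute[of K])
  qed
  moreover have "0 < sdiff cascade x h" if "0 < h" for x h
    using sdiff_cascade_lower[OF that, of x] that by (smt (verit) zero_less_divide_iff zero_less_power)
  ultimately have "balanced K cascade"
    using cascade_convex by (auto simp: balanced_def)
  then show ?thesis by blast
qed

text \<open>The second difference is taken at the midpoint, where the value is at least that of the
  supporting line. Half the distance enters cubed, hence \<open>5832 = 8 * 729\<close>.\<close>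

lemma cascade_above_subgradient:
  assumes b: "\<And>y. cascade x + b * (y - x) \<le> cascade y"
  shows "cascade x + b * (y - x) + \<bar>y - x\<bar> ^ 3 / 5832 \<le> cascade y"
proof -
  define u where "u = (y - x) / 2"
  have "\<bar>u\<bar> ^ 3 / 729 \<le> sdiff cascade (x + u) \<bar>u\<bar>"
    using sdiff_cascade_lower[of "\<bar>u\<bar>"] sdiff_nonneg[OF cascade_convex] by (cases "u = 0") auto
  also have "\<dots> = sdiff cascade (x + u) u" by (simp add: sdiff_def abs_if)
  also have "\<dots> = cascade y - 2 * cascade (x + u) + cascade x"
  proof -
    have "x + u + u = y" by (simp add: u_def)
    then show ?thesis by (simp add: sdiff_def)
  qed
  also have "\<dots> \<le> cascade y - 2 * (cascade x + b * u) + cascade x" using b[of "x + u"] by simp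
  also have "\<dots> = cascade y - cascade x - b * (y - x)" by (simp add: u_def field_simps)
  finally show ?thesis by (simp add: u_def power_divide)
qed

section \<open>Exact copies of the cascade at every place and scale\<close>

definition is_copy :: "(real \<Rightarrow> real) \<Rightarrow> real \<Rightarrow> real \<Rightarrow> real \<Rightarrow> real \<Rightarrow> real \<Rightarrow> bool" where
  "is_copy f u v a b c \<longleftrightarrow> 0 \<le> a \<and> (\<forall>y. \<bar>y\<bar> \<le> 1 \<longrightarrow> f (u + v * y) = a * cascade y + b * y + c)"

text \<open>A form of uniform recurrence. The bound \<open>h / 9\<close> keeps the copies from
  shrinking to a point, which lets the property survive limits.\<close>

definition contains_copies :: "(real \<Rightarrow> real) \<Rightarrow> bool" where
  "contains_copies f \<longleftrightarrow> (\<forall>x h. 0 < h \<longrightarrow>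
    (\<exists>u v a b c. \<bar>u - x\<bar> \<le> h \<and> h / 9 \<le> v \<and> v \<le> h \<and> is_copy f u v a b c))"

lemma cascade_contains_copies: "contains_copies cascade"
  unfolding contains_copies_def
proof (intro allI impI)
  fix x h :: real assume h: "0 < h"
  obtain s where s: "0 < s" "3 \<le> s * h" "s * h \<le> 9" "\<And>x. cascade (s * x) = s ^ 3 * cascade x"
    using cascade_rescale[OF h] by metis
  \<comment> \<open>Only integers with last digit 2 carry two-sided copies, and one of them lies
    within 2 of \<open>\<lfloor>s * x\<rfloor>\<close>.\<close>
  define j where "j = 3 * (\<lfloor>s * x\<rfloor> div 3) + 2"
  have j3: "j mod 3 = 2" unfolding j_def by presburger
  have "\<bar>j - \<lfloor>s * x\<rfloor>\<bar> \<le> 2" "\<lfloor>s * x\<rfloor> \<le> j" unfolding j_def by presburger+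
  then have "of_int \<lfloor>s * x\<rfloor> \<le> (of_int j :: real)" "of_int j \<le> (of_int (\<lfloor>s * x\<rfloor> + 2) :: real)" by linarith+
  then have "\<bar>of_int j - s * x\<bar> \<le> 2" by linarith
  then have "\<bar>of_int j - s * x\<bar> \<le> s * h" using s(2) by linarith
  moreover have "of_int j - s * x = s * (of_int j / s - x)" using s(1) by (simp add: field_simps)
  ultimately have 1: "\<bar>of_int j / s - x\<bar> \<le> h" using s(1) by (simp add: abs_mult)
  have 2: "h / 9 \<le> 1 / s" "1 / s \<le> h" using s(1-3) by (simp_all add: field_simps)
  have 3: "cascade (of_int j / s + 1 / s * y) = wt j / s ^ 3 * cascade y + cum j / s ^ 3 * y + cum2 j / s ^ 3"
    if y: "\<bar>y\<bar> \<le> 1" for y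
  proof -
    have "s ^ 3 * cascade (of_int j / s + 1 / s * y) = cascade (of_int j + y)"
      using s(1) by (simp add: distrib_left flip: s(4))
    also have "\<dots> = wt j * cascade y + cum j * y + cum2 j"
      by (rule cascade_copy) (use j3 y in auto)
    finally show ?thesis using s(1) by (simp add: field_simps)
  qed
  have "0 \<le> wt j / s ^ 3" using wt_ge_1[of j] s(1) by simp
  with 3 have "is_copy cascade (of_int j / s) (1 / s) (wt j / s ^ 3) (cum j / s ^ 3) (cum2 j / s ^ 3)"
    unfolding is_copy_def by blast
  with 1 2 show "\<exists>u v a b c. \<bar>u - x\<bar> \<le> h \<and> h / 9 \<le> v \<and> v \<le> h \<and> is_copy cascade u v a b c"
    by blast
qed

lemma contains_copies_affine_change:
  assumes f: "contains_copies f" and al: "0 < a" "0 < l"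
  shows "contains_copies (affine_change a l t b c f)"
  unfolding contains_copies_def
proof (intro allI impI)
  fix x h :: real assume h: "0 < h"
  then have "0 < l * h" using al by simp
  with f obtain u v a' b' c' where *: "\<bar>u - (l * x + t)\<bar> \<le> l * h" "l * h / 9 \<le> v" "v \<le> l * h" "is_copy f u v a' b' c'"
    unfolding contains_copies_def by blast
  note copy = *(4)[unfolded is_copy_def]
  define u' v' where "u' = (u - t) / l" and "v' = v / l"
  have u: "u = l * u' + t" "v = l * v'" using al by (simp_all add: u'_def v'_def)
  have "u - (l * x + t) = l * (u' - x)" by (simp add: u algebra_simps)
  with *(1) have "\<bar>u' - x\<bar> \<le> h" using al by (simp add: abs_mult)
  moreover have "h / 9 \<le> v'" "v' \<le> h" using *(2,3) al u(2) by (simp_all add: field_simps)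
  moreover have "affine_change a l t b c f (u' + v' * y) = (a * a') * cascade y + (a * b' + b * v') * y + (a * c' + b * u' + c)"
    if "\<bar>y\<bar> \<le> 1" for y
  proof -
    have "l * (u' + v' * y) + t = u + v * y" by (simp add: u algebra_simps)
    moreover have "f (u + v * y) = a' * cascade y + b' * y + c'" using copy that by blast
    ultimately show ?thesis by (simp add: affine_change_def algebra_simps)
  qed
  moreover have "0 \<le> a * a'" using copy al by simp
  ultimately have "\<bar>u' - x\<bar> \<le> h" "h / 9 \<le> v'" "v' \<le> h"
    "is_copy (affine_change a l t b c f) u' v' (a * a') (a * b' + b * v') (a * c' + b * u' + c)"
    unfolding is_copy_def by blast+
  then show "\<exists>u v a' b' c'. \<bar>u - x\<bar> \<le> h \<and> h / 9 \<le> v \<and> v \<le> h \<and> is_copy (affine_change a l t b c f) u v a' b' c'"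
    by blast
qed

lemma cascade_at: "cascade 0 = 0" "cascade 1 = 1 / 2" "cascade (- 1) = 7 / 2"
  using cascade_int[of 0] cascade_int[of 1] cascade_int[of "- 1"] cum2_Suc[of 0] cum2_Suc[of "- 1"] cum_Suc[of "-1"] by simp_all

text \<open>Position and size of the copies converge along a subsequence by compactness. Their
  coefficients are determined by the values at -1, 0 and 1, hence converge too.\<close>

lemma contains_copies_limit:
  assumes f: "\<And>k. contains_copies (f k)" "\<And>k. convex_on UNIV (f k)"
    and lim: "\<And>x. (\<lambda>k. f k x) \<longlonglongrightarrow> g x"
  shows "contains_copies g"
  unfolding contains_copies_def
proof (intro allI impI)
  fix x h :: real assume h: "0 < h"
  have "\<exists>u v a b c. \<bar>u - x\<bar> \<le> h \<and> h / 9 \<le> v \<and> v \<le> h \<and> is_copy (f k) u v a b c" for k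
    using f(1)[of k] h unfolding contains_copies_def by blast
  then obtain u v a b c where *: "\<And>k. \<bar>u k - x\<bar> \<le> h" "\<And>k. h / 9 \<le> v k" "\<And>k. v k \<le> h"
    and copy: "\<And>k. is_copy (f k) (u k) (v k) (a k) (b k) (c k)"
    by metis
  have copy_eq: "f k (u k + v k * y) = a k * cascade y + b k * y + c k" if "\<bar>y\<bar> \<le> 1" for k y
    using copy[of k] that by (simp add: is_copy_def)
  have "u k \<in> {x - h..x + h}" "v k \<in> {h / 9..h}" for k using *(1-3)[of k] by (auto simp: abs_le_iff)
  then have "(u k, v k) \<in> {x - h..x + h} \<times> {h / 9..h}" for k by auto
  moreover have "seq_compact ({x - h..x + h} \<times> {h / 9..h})"
    by (intro compact_imp_seq_compact compact_Times compact_Icc)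
  ultimately obtain p r where p: "p \<in> {x - h..x + h} \<times> {h / 9..h}" and r: "strict_mono r"
    and pl: "((\<lambda>k. (u k, v k)) \<circ> r) \<longlonglongrightarrow> p"
    by (meson seq_compactE)
  obtain u0 v0 where uv: "p = (u0, v0)" by (cases p)
  have ul: "(\<lambda>k. u (r k)) \<longlonglongrightarrow> u0" and vl: "(\<lambda>k. v (r k)) \<longlonglongrightarrow> v0"
    using tendsto_fst[OF pl] tendsto_snd[OF pl] by (simp_all add: o_def uv)
  have lim': "(\<lambda>k. a (r k) * cascade y + b (r k) * y + c (r k)) \<longlonglongrightarrow> g (u0 + v0 * y)" if y: "\<bar>y\<bar> \<le> 1" for y
  proof -
    have "(\<lambda>k. f (r k) (u (r k) + v (r k) * y)) \<longlonglongrightarrow> g (u0 + v0 * y)"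
    proof (rule convex_converge_at[where f = "\<lambda>k. f (r k)" and g = g and l = "u0 + v0 * y"])
      show "(\<lambda>k. f (r k) x) \<longlonglongrightarrow> g x" for x
        using LIMSEQ_subseq_LIMSEQ[OF lim r] by (simp add: o_def)
    qed (intro f tendsto_intros ul vl)+
    then show ?thesis using copy_eq[OF y] by simp
  qed
  have cl: "(\<lambda>k. c (r k)) \<longlonglongrightarrow> g u0" using lim'[of 0] by (simp add: cascade_at)
  have l1: "(\<lambda>k. a (r k) / 2 + b (r k) + c (r k)) \<longlonglongrightarrow> g (u0 + v0)" using lim'[of 1] by (simp add: cascade_at)
  have l2: "(\<lambda>k. 7 / 2 * a (r k) - b (r k) + c (r k)) \<longlonglongrightarrow> g (u0 - v0)" using lim'[of "- 1"] by (simp add: cascade_at mult.commute)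
  \<comment> \<open>The divisor is
    \<open>cascade 1 + cascade (- 1) = 1 / 2 + 7 / 2 = 4\<close>.\<close>
  define a0 where "a0 = (g (u0 + v0) + g (u0 - v0) - 2 * g u0) / 4"
  have "(\<lambda>k. ((a (r k) / 2 + b (r k) + c (r k)) + (7 / 2 * a (r k) - b (r k) + c (r k)) - 2 * c (r k)) / 4) \<longlonglongrightarrow> a0"
    unfolding a0_def by (intro tendsto_intros l1 l2 cl) simp
  moreover have "((a (r k) / 2 + b (r k) + c (r k)) + (7 / 2 * a (r k) - b (r k) + c (r k)) - 2 * c (r k)) / 4 = a (r k)" for k
    by (simp add: field_simps)
  ultimately have al: "(\<lambda>k. a (r k)) \<longlonglongrightarrow> a0" by simp
  define b0 where "b0 = g (u0 + v0) - a0 / 2 - g u0"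
  have "(\<lambda>k. (a (r k) / 2 + b (r k) + c (r k)) - a (r k) / 2 - c (r k)) \<longlonglongrightarrow> b0"
    unfolding b0_def by (intro tendsto_intros l1 al cl) simp
  then have bl: "(\<lambda>k. b (r k)) \<longlonglongrightarrow> b0" by simp
  have "g (u0 + v0 * y) = a0 * cascade y + b0 * y + g u0" if y: "\<bar>y\<bar> \<le> 1" for y
    by (rule LIMSEQ_unique[OF lim'[OF y]]) (intro tendsto_intros al bl cl)
  moreover have "0 \<le> a0"
    by (rule LIMSEQ_le_const[OF al]) (use copy in \<open>auto simp: is_copy_def\<close>)
  ultimately have "is_copy g u0 v0 a0 b0 (g u0)" by (simp add: is_copy_def)
  moreover have "\<bar>u0 - x\<bar> \<le> h" "h / 9 \<le> v0" "v0 \<le> h" using p by (auto simp: uv abs_le_iff)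
  ultimately show "\<exists>u v a b c. \<bar>u - x\<bar> \<le> h \<and> h / 9 \<le> v \<and> v \<le> h \<and> is_copy g u v a b c"
    by blast
qed

section \<open>Admissible functions\<close>

definition admissible :: "real \<Rightarrow> (real \<Rightarrow> real) \<Rightarrow> bool" where
  "admissible C f \<longleftrightarrow> balanced C f \<and> contains_copies f"

lemma admissible_affine_change:
  "admissible C f \<Longrightarrow> 0 < a \<Longrightarrow> 0 < l \<Longrightarrow> admissible C (affine_change a l t b c f)"
  by (simp add: admissible_def balanced_affine_change contains_copies_affine_change)

lemma admissible_limit:
  assumes "\<And>k. admissible C (f k)" "\<And>x. (\<lambda>k. f k x) \<longlonglongrightarrow> g x" "0 < sdiff g x0 h0" "0 < h0"
  shows "admissible C g"
proof -
  have "balanced C g"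
    by (rule balanced_limit[OF _ assms(2-4)]) (use assms(1) in \<open>auto simp: admissible_def\<close>)
  moreover have "contains_copies g"
    by (rule contains_copies_limit[OF _ _ assms(2)]) (use assms(1) balanced_convex in \<open>auto simp: admissible_def\<close>)
  ultimately show ?thesis by (simp add: admissible_def)
qed

text \<open>A diagonal subsequence converges at the rationals; the Lipschitz bound of
  \<open>convex_lipschitz_at\<close>, uniform in the index, carries convergence to all
  reals.\<close>

lemma normalized_subsequence:
  assumes f: "\<And>k. balanced C (f k)" "\<And>k. normalized (f k)"
  obtains r g where "strict_mono (r :: nat \<Rightarrow> nat)" "\<And>x. (\<lambda>k. f (r k) x) \<longlonglongrightarrow> g x"
proof -
  \<comment> \<open>Division by this growth bound puts all values in \<open>[- 1, 1]\<close>, so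
    that a single bound serves the diagonal argument.\<close>
  define B where "B x = 2 * (2 * C + 2) ^ nat \<lceil>\<bar>x\<bar>\<rceil>" for x :: real
  have C: "0 < C" using balanced_const_pos[OF f(1)[of 0]] .
  have Bpos: "0 < B x" for x using C by (simp add: B_def)
  have fB: "f k x \<le> B x" for k x
    unfolding B_def
  proof (rule normalized_upper[OF f])
    have "\<bar>x\<bar> \<le> real (nat \<lceil>\<bar>x\<bar>\<rceil>)" by linarith
    also have "\<dots> \<le> 2 ^ nat \<lceil>\<bar>x\<bar>\<rceil>" by (intro less_imp_le of_nat_less_two_power)
    finally show "\<bar>x\<bar> \<le> 2 ^ nat \<lceil>\<bar>x\<bar>\<rceil>" .
  qed
  have f0: "0 \<le> f k x" for k x using f(2)[of k] by (simp add: normalized_def)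
  have "norm (f n x / B x) \<le> 1" for n x using fB[of n x] f0[of n x] Bpos[of x] by simp
  then obtain r where r: "strict_mono (r :: nat \<Rightarrow> nat)"
    and rl: "\<And>x. x \<in> \<rat> \<Longrightarrow> \<exists>l. (\<lambda>n. f (r n) x / B x) \<longlonglongrightarrow> l"
    using function_convergent_subsequence[OF countable_rat, of "\<lambda>n x. f n x / B x" 1] by metis
  have conv: "convergent (\<lambda>n. f (r n) x)" for x
  proof -
    define K where "K = B (x + 1) + B (x - 1) + 2 * B x + 1"
    have K: "0 < K" using Bpos[of "x + 1"] Bpos[of "x - 1"] Bpos[of x] by (simp add: K_def)
    have lip: "\<bar>f n q - f n x\<bar> \<le> \<bar>q - x\<bar> * K" if "\<bar>q - x\<bar> \<le> 1" for n q
    proof -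
      have "\<bar>f n (x + (q - x)) - f n x\<bar> \<le> \<bar>q - x\<bar> * (\<bar>f n (x + 1) - f n x\<bar> + \<bar>f n (x - 1) - f n x\<bar>)"
        by (rule convex_lipschitz_at[OF balanced_convex[OF f(1)] that])
      also have "\<dots> \<le> \<bar>q - x\<bar> * K"
        unfolding K_def
        using fB[of n "x + 1"] fB[of n "x - 1"] fB[of n x] f0[of n "x + 1"] f0[of n "x - 1"] f0[of n x]
        by (intro mult_left_mono) auto
      finally show ?thesis by simp
    qed
    have "Cauchy (\<lambda>n. f (r n) x)"
    proof (rule CauchyI)
      fix e :: real assume e: "0 < e"
      define d where "d = min 1 (e / (4 * K))"
      have d: "0 < d" using e K by (simp add: d_def)
      obtain q where q: "q \<in> \<rat>" "x < q" "q < x + d" using Rats_dense_in_real[of x "x + d"] d by auto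
      then have q1: "\<bar>q - x\<bar> \<le> 1" by (simp add: d_def)
      have "\<bar>q - x\<bar> * K \<le> e / (4 * K) * K" using q K by (intro mult_right_mono) (auto simp: d_def)
      then have qe: "\<bar>f n q - f n x\<bar> \<le> e / 4" for n using lip[OF q1, of n] K by simp
      obtain l where "(\<lambda>n. f (r n) q / B q) \<longlonglongrightarrow> l" using rl[OF q(1)] by blast
      then have "(\<lambda>n. f (r n) q / B q * B q) \<longlonglongrightarrow> l * B q" by (intro tendsto_intros)
      then have "(\<lambda>n. f (r n) q) \<longlonglongrightarrow> l * B q" using Bpos[of q] by simp
      then have "Cauchy (\<lambda>n. f (r n) q)" by (rule LIMSEQ_imp_Cauchy)
      then obtain N where N: "\<And>m n. m \<ge> N \<Longrightarrow> n \<ge> N \<Longrightarrow> norm (f (r m) q - f (r n) q) < e / 4"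
        using CauchyD[of _ "e / 4"] e by (metis zero_less_divide_iff zero_less_numeral)
      show "\<exists>M. \<forall>m\<ge>M. \<forall>n\<ge>M. norm (f (r m) x - f (r n) x) < e"
      proof (intro exI[of _ N] allI impI)
        fix m n assume "m \<ge> N" "n \<ge> N"
        from N[OF this] qe[of "r m"] qe[of "r n"] e
        show "norm (f (r m) x - f (r n) x) < e" unfolding real_norm_def by linarith
      qed
    qed
    then show ?thesis by (simp add: Cauchy_convergent_iff)
  qed
  show ?thesis
  proof (rule that[OF r])
    show "(\<lambda>k. f (r k) x) \<longlonglongrightarrow> lim (\<lambda>k. f (r k) x)" for x
      using conv by (simp add: convergent_LIMSEQ_iff)
  qed
qed

lemma normalized_limit:
  assumes f: "\<And>k. normalized (f k)" and lim: "\<And>x. (\<lambda>k. f k x) \<longlonglongrightarrow> g x"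
  shows "normalized g"
  unfolding normalized_def
proof (intro conjI allI)
  show "0 \<le> g x" for x
    by (rule LIMSEQ_le_const[OF lim]) (use f in \<open>auto simp: normalized_def\<close>)
  show "g 0 = 0"
    by (rule LIMSEQ_unique[OF lim]) (use f in \<open>simp add: normalized_def\<close>)
  have "(\<lambda>k. max (f k 1) (f k (- 1))) \<longlonglongrightarrow> max (g 1) (g (- 1))"
    by (intro tendsto_intros lim)
  moreover have "(\<lambda>k. max (f k 1) (f k (- 1))) = (\<lambda>k. 1)"
    using f by (simp add: normalized_def fun_eq_iff)
  ultimately show "max (g 1) (g (- 1)) = 1"
    by (simp add: LIMSEQ_const_iff)
qed

lemma admissible_compact:
  assumes f: "\<And>k. admissible C (f k)" "\<And>k. normalized (f k)"
  obtains r g where "strict_mono (r :: nat \<Rightarrow> nat)" "\<And>x. (\<lambda>k. f (r k) x) \<longlonglongrightarrow> g x" "admissible C g"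
proof -
  have bal: "balanced C (f k)" for k using f(1) by (simp add: admissible_def)
  obtain r g where r: "strict_mono (r :: nat \<Rightarrow> nat)" "\<And>x. (\<lambda>k. f (r k) x) \<longlonglongrightarrow> g x"
    by (rule normalized_subsequence[OF bal f(2)]) (rule that)
  have "normalized g"
    by (rule normalized_limit[OF f(2) r(2)])
  \<comment> \<open>Normalization survives the limit and supplies the nonzero second difference that
    excludes degeneration.\<close>
  then have "1 \<le> sdiff g 0 1" using normalized_sdiff by blast
  then have "admissible C g"
    by (intro admissible_limit[OF f(1) r(2), where ?x0.0 = 0 and ?h0.0 = 1]) auto
  with r show ?thesis by (rule that)
qed

text \<open>A point \<open>(x, y)\<close> above the graph determines the change: the supporting line
  at \<open>x\<close> is removed, the height \<open>y - f x\<close> becomes 1, and the horizontal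
  scale comes from the intermediate value theorem for the larger of the values at \<open>l\<close>
  and \<open>- l\<close>.\<close>

lemma normalize:
  assumes f: "balanced C f" and y: "f x < y"
  obtains l b where "0 < l" "normalized (affine_change (1 / (y - f x)) l x b (- f x / (y - f x)) f)"
proof -
  obtain b where b: "\<And>z. f x + b * (z - x) \<le> f z"
    using convex_subgradient[OF balanced_convex[OF f]] by metis
  define g where "g u = f (x + u) - f x - b * u" for u
  have g0: "g 0 = 0" "0 \<le> g u" for u using b[of "x + u"] by (auto simp: g_def)
  have cf: "continuous_on UNIV f" by (rule convex_real_continuous[OF balanced_convex[OF f]])
  have cg: "continuous_on S (\<lambda>l. max (g l) (g (- l)))" for S
    unfolding g_def by (intro continuous_intros continuous_on_compose2[OF cf]) auto
  obtain r where r: "0 < r" "\<And>z. r \<le> \<bar>z\<bar> \<Longrightarrow> (\<bar>b\<bar> + 1) * \<bar>z\<bar> \<le> f z"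
    using balanced_superlinear[OF f] unfolding superlinear_def by blast
  \<comment> \<open>At this distance the growth of slope \<open>\<bar>b\<bar> + 1\<close> exceeds
    the supporting line by at least \<open>y - f x\<close>.\<close>
  define l1 where "l1 = r + \<bar>x\<bar> + (\<bar>b\<bar> + 1) * \<bar>x\<bar> + \<bar>f x\<bar> + (y - f x)"
  have "0 \<le> (\<bar>b\<bar> + 1) * \<bar>x\<bar>" by simp
  then have l1: "0 < l1" "r \<le> \<bar>x + l1\<bar>" using r(1) y unfolding l1_def by linarith+
  have "y - f x \<le> g l1"
  proof -
    have "(\<bar>b\<bar> + 1) * (l1 - \<bar>x\<bar>) \<le> (\<bar>b\<bar> + 1) * \<bar>x + l1\<bar>" by (intro mult_left_mono) auto
    also have "\<dots> \<le> f (x + l1)" by (rule r) (rule l1)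
    finally have "\<bar>b\<bar> * l1 + l1 - (\<bar>b\<bar> + 1) * \<bar>x\<bar> \<le> f (x + l1)" by (simp add: algebra_simps)
    moreover have "b * l1 \<le> \<bar>b\<bar> * l1" using l1 by (intro mult_right_mono) auto
    moreover have "l1 - (\<bar>b\<bar> + 1) * \<bar>x\<bar> \<ge> y" using r(1) by (simp add: l1_def)
    ultimately show ?thesis unfolding g_def by linarith
  qed
  then have "y - f x \<le> max (g l1) (g (- l1))" by simp
  moreover have "max (g 0) (g (- 0)) \<le> y - f x" using g0 y by simp
  ultimately obtain l where l: "0 \<le> l" "max (g l) (g (- l)) = y - f x"
    using IVT'[of "\<lambda>l. max (g l) (g (- l))" 0 "y - f x" l1] l1 cg by auto
  have "l \<noteq> 0" using l(2) g0 y by auto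
  with l have "0 < l" by simp
  moreover have eq: "affine_change (1 / (y - f x)) l x (- b * l / (y - f x)) (- f x / (y - f x)) f u = g (l * u) / (y - f x)" for u
    using y arg_cong[OF add.commute[of "l * u" x], of f]
    by (simp add: affine_change_def g_def diff_divide_distrib mult.assoc)
  have "normalized (affine_change (1 / (y - f x)) l x (- b * l / (y - f x)) (- f x / (y - f x)) f)"
    unfolding normalized_def eq using g0 y l(2) by (auto simp: max_def split: if_splits)
  ultimately show ?thesis by (rule that)
qed

text \<open>Enlarging a copy about its centre by \<open>3 ^ k\<close> reproduces the cascade exactly
  on \<open>[- (3 ^ k), 3 ^ k]\<close> by homogeneity, so at each point the sequence is eventually
  constant.\<close>

lemma admissible_limit_cascade:
  assumes f: "admissible C f"
  obtains a l t b c where "\<And>k. 0 < a k" "\<And>k. 0 < l k"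
    "\<And>x. (\<lambda>k::nat. affine_change (a k) (l k) (t k) (b k) (c k) f x) \<longlonglongrightarrow> cascade x"
proof -
  obtain u v a b c where v: "1 / 9 \<le> v" and copy: "is_copy f u v a b c"
    using f unfolding admissible_def contains_copies_def by (metis zero_less_one)
  have eq: "f (u + v * y) = a * cascade y + b * y + c" if "\<bar>y\<bar> \<le> 1" for y
    using copy that by (simp add: is_copy_def)
  \<comment> \<open>A copy may have \<open>a = 0\<close>; balance excludes this, because the second
    difference of the cascade at 0 with step 1 is 4.\<close>
  have "sdiff f u v = 4 * a"
    using eq[of 0] eq[of 1] eq[of "- 1"] by (simp add: sdiff_def cascade_at)
  moreover have "0 < sdiff f u v" using f v by (intro balanced_pos) (auto simp: admissible_def)
  ultimately have a: "0 < a" by simp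
  show ?thesis
  proof (rule that[of "\<lambda>k. 27 ^ k / a" "\<lambda>k. v / 3 ^ k" "\<lambda>k. u" "\<lambda>k. - (27 ^ k / a) * b / 3 ^ k" "\<lambda>k. - (27 ^ k / a) * c"])
    fix x :: real
    obtain N where N: "\<bar>x\<bar> < 3 ^ N" using real_arch_pow[of 3 "\<bar>x\<bar>"] by auto
    have "affine_change (27 ^ k / a) (v / 3 ^ k) u (- (27 ^ k / a) * b / 3 ^ k) (- (27 ^ k / a) * c) f x = cascade x"
      if "N \<le> k" for k
    proof -
      have "(3::real) ^ N \<le> 3 ^ k" using that by (intro power_increasing) auto
      then have "\<bar>x\<bar> \<le> 3 ^ k" using N by linarith
      then have "\<bar>x / 3 ^ k\<bar> \<le> 1" by simp
      then have "f (u + v * (x / 3 ^ k)) = a * cascade (x / 3 ^ k) + b * (x / 3 ^ k) + c" by (rule eq)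
      moreover have "cascade (3 ^ k * z) = 27 ^ k * cascade z" for z
        by (induction k) (simp_all add: mult.assoc cascade_scale3)
      from this[of "x / 3 ^ k"] have "cascade x = 27 ^ k * cascade (x / 3 ^ k)" by simp
      moreover have "f (v / 3 ^ k * x + u) = f (u + v * (x / 3 ^ k))" by (simp add: add.commute)
      ultimately show ?thesis using a by (simp add: affine_change_def distrib_left add_divide_distrib)
    qed
    then show "(\<lambda>k. affine_change (27 ^ k / a) (v / 3 ^ k) u (- (27 ^ k / a) * b / 3 ^ k) (- (27 ^ k / a) * c) f x) \<longlonglongrightarrow> cascade x"
      by (intro tendsto_eventually eventually_sequentiallyI[of N]) auto
  qed (use a v in auto)
qed

lemma cascade_admissible: "\<exists>C. admissible C cascade"
  using cascade_balanced cascade_contains_copies by (auto simp: admissible_def)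

text \<open>The point 1/2 is the centre of nested middle thirds; 1/2 and 1/20 are the slope and the value of the
  cascade there.\<close>
definition centred_cascade :: "real \<Rightarrow> real" where "centred_cascade x = cascade (1/2 + x) - x / 2 - 1 / 20"

text \<open>On the middle third the cascade is the copy at \<open>j = 1\<close> of weight 7, seen at
  a scale that costs 27. The slope 1/2 and the value 1/20 are the ones for which the affine terms
  cancel.\<close>

lemma centred_cascade_scale:
  assumes x: "\<bar>x\<bar> \<le> 1 / 2"
  shows "centred_cascade (x / 3) = 7 / 27 * centred_cascade x"
proof -
  have w1: "wt 1 = 7" "cum 1 = 1" "cum2 1 = 1 / 2"
    using wt_digit[of 1 0] cum_Suc[of 0] cum2_Suc[of 0] by simp_all
  have "27 * cascade (1/2 + x / 3) = cascade (3 * (1/2 + x / 3))" by (rule cascade_scale3[symmetric])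
  also have "3 * (1/2 + x / 3) = of_int 1 + (1/2 + x)" by simp
  also have "cascade \<dots> = 7 * cascade (1/2 + x) + (1/2 + x) + 1/2"
    using cascade_copy[of 1 "1/2 + x"] x w1 by simp
  finally show ?thesis by (simp add: centred_cascade_def field_simps)
qed

text \<open>The chord from \<open>(0, 0)\<close> to \<open>(1, 1 / 2)\<close> bounds the cascade on
  the unit interval; at the centre it leaves \<open>1 / 4 - 1 / 20\<close>.\<close>

lemma centred_cascade_le:
  assumes x: "\<bar>x\<bar> \<le> 1 / 2"
  shows "centred_cascade x \<le> 1 / 5"
proof -
  define t where "t = x + 1/2"
  have "cascade ((1 - t) *\<^sub>R 0 + t *\<^sub>R 1) \<le> (1 - t) * cascade 0 + t * cascade 1"
    by (rule convex_onD[OF cascade_convex]) (use x in \<open>auto simp: t_def abs_le_iff\<close>)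
  then show ?thesis by (simp add: centred_cascade_def cascade_at t_def add.commute)
qed

text \<open>Enlarging about the centre 1/2 by 3 with vertical factor 27/7 changes nothing on an
  interval that grows by 3 each time. The limit grows with an exponent below 4/3.\<close>

lemma flat_limit_of_cascade:
  obtains a l t b c g where "\<And>k. 0 < a k" "\<And>k. 0 < l k"
    "\<And>x. (\<lambda>k::nat. affine_change (a k) (l k) (t k) (b k) (c k) cascade x) \<longlonglongrightarrow> g x"
    "0 < sdiff g 0 1"
    "\<And>X. 1 \<le> \<bar>X\<bar> \<Longrightarrow> \<exists>q\<ge>0. g X \<le> q \<and> q ^ 3 \<le> 16 * X ^ 4"
proof -
  define G where "G k x = (27 / 7) ^ k * centred_cascade (x / 3 ^ k)" for k :: nat and x
  have G_Suc: "G (Suc k) x = G k x" if "2 * \<bar>x\<bar> \<le> 3 ^ k" for k x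
    using centred_cascade_scale[of "x / 3 ^ k"] that by (simp add: G_def mult.commute field_simps)
  have G_eq: "G n x = G k x" if "2 * \<bar>x\<bar> \<le> 3 ^ k" "k \<le> n" for k n x
    using that(2)
  proof (induction n rule: dec_induct)
    case (step n)
    have "(3::real) ^ k \<le> 3 ^ n" using step by (intro power_increasing) auto
    with that(1) have "2 * \<bar>x\<bar> \<le> 3 ^ n" by linarith
    with step G_Suc show ?case by simp
  qed simp
  \<comment> \<open>The level from which the rescalings are constant at \<open>x\<close>. Its
    minimality yields the lower bound \<open>3 ^ k / 6\<close> for the absolute value of
    \<open>X\<close> below.\<close>
  define N where "N x = (LEAST k. 2 * \<bar>x\<bar> \<le> 3 ^ k)" for x :: real
  have ex: "\<exists>k. 2 * \<bar>x\<bar> \<le> 3 ^ k" for x :: real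
    using real_arch_pow[of 3 "2 * \<bar>x\<bar>"] by (auto intro: less_imp_le)
  have N: "2 * \<bar>x\<bar> \<le> 3 ^ N x" for x unfolding N_def by (rule LeastI_ex[OF ex])
  define g where "g x = G (N x) x" for x
  have gG: "g x = G k x" if "2 * \<bar>x\<bar> \<le> 3 ^ k" for k x
    unfolding g_def by (rule G_eq[symmetric, OF N]) (use that in \<open>simp add: N_def Least_le\<close>)
  have G: "G k = affine_change ((27 / 7) ^ k) (1 / 3 ^ k) (1 / 2) (- ((27 / 7) ^ k / 3 ^ k / 2)) (- ((27 / 7) ^ k / 20)) cascade" for k
  proof (rule ext)
    show "G k x = affine_change ((27 / 7) ^ k) (1 / 3 ^ k) (1 / 2) (- ((27 / 7) ^ k / 3 ^ k / 2)) (- ((27 / 7) ^ k / 20)) cascade x" for x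
      using arg_cong[OF add.commute[of "x / 3 ^ k" "1 / 2"], of cascade] by (simp add: G_def centred_cascade_def affine_change_def right_diff_distrib)
  qed
  show ?thesis
  proof (rule that[of "\<lambda>k. (27 / 7) ^ k" "\<lambda>k. 1 / 3 ^ k" "\<lambda>k. 1 / 2" "\<lambda>k. - ((27 / 7) ^ k / 3 ^ k / 2)" "\<lambda>k. - ((27 / 7) ^ k / 20)" g])
    fix x
    have "(\<lambda>k. G k x) \<longlonglongrightarrow> g x"
      by (intro tendsto_eventually eventually_sequentiallyI[of "N x"]) (unfold g_def, rule G_eq[OF N])
    then show "(\<lambda>k. affine_change ((27 / 7) ^ k) (1 / 3 ^ k) (1 / 2) (- ((27 / 7) ^ k / 3 ^ k / 2)) (- ((27 / 7) ^ k / 20)) cascade x) \<longlonglongrightarrow> g x"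
      by (simp add: G)
  next
    obtain C where "admissible C cascade" using cascade_admissible by blast
    then have "admissible C (G 1)" unfolding G by (rule admissible_affine_change) auto
    then have "0 < sdiff (G 1) 0 1" by (intro balanced_pos) (auto simp: admissible_def)
    then show "0 < sdiff g 0 1" by (simp add: sdiff_def gG[of _ 1])
  next
    fix X :: real assume X: "1 \<le> \<bar>X\<bar>"
    define k where "k = N X"
    have k0: "k \<noteq> 0" using N[of X] X by (auto simp: k_def intro: ccontr)
    have "\<not> 2 * \<bar>X\<bar> \<le> 3 ^ (k - 1)"
      using not_less_Least[of "k - 1" "\<lambda>k. 2 * \<bar>X\<bar> \<le> 3 ^ k"] k0 by (simp add: k_def N_def)
    moreover have "3 ^ k = (3::real) * 3 ^ (k - 1)" using k0 by (cases k) auto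
    ultimately have lo: "3 ^ k / 6 \<le> \<bar>X\<bar>" by simp
    define q where "q = (27 / 7) ^ k * (1 / 5 :: real)"
    have "g X \<le> q" unfolding q_def g_def G_def k_def
      using N[of X] by (intro mult_left_mono centred_cascade_le) (auto simp: field_simps)
    moreover have "q ^ 3 \<le> 16 * X ^ 4"
    proof -
      have 81: "(3 ^ k) ^ 4 = (81::real) ^ k"
        by (subst power_mult[symmetric], subst mult.commute, subst power_mult) simp
      have "q ^ 3 = ((27 / 7) ^ 3) ^ k / 125"
        unfolding q_def power_mult_distrib
        by (subst power_mult[symmetric], subst mult.commute, subst power_mult) (simp add: power_divide)
      \<comment> \<open>The inequality \<open>(27 / 7) ^ 3 \<le> 81 = 3 ^ 4\<close> is the numerical
        reason for order 4.\<close>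
      also have "\<dots> \<le> 81 ^ k / 125" by (intro divide_right_mono power_mono) (auto simp: power_divide)
      also have "\<dots> \<le> 16 * (81 ^ k / 1296)" by simp
      also have "81 ^ k / 1296 = (3 ^ k / 6 :: real) ^ 4"
        by (simp add: power_divide 81)
      also have "16 * (3 ^ k / 6) ^ 4 \<le> 16 * \<bar>X\<bar> ^ 4" by (intro mult_left_mono power_mono lo) auto
      finally show ?thesis by simp
    qed
    moreover have "0 \<le> q" by (simp add: q_def)
    ultimately show "\<exists>q\<ge>0. g X \<le> q \<and> q ^ 3 \<le> 16 * X ^ 4" by blast
  qed auto
qed

section \<open>Projective classes and Hausdorff limits\<close>

lemma rep_proj_nonzero: "rep_proj p \<noteq> 0" and homog_rep_proj [simp]: "homog (rep_proj p) = p"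
proof -
  have "proportional (rep_proj p) (rep_proj p)"
    using Quotient_rep_reflp[OF Quotient_proj_space] .
  then show "rep_proj p \<noteq> 0" by (simp add: proportional_def)
  show "homog (rep_proj p) = p" using Quotient_abs_rep[OF Quotient_proj_space] .
qed

lemma linear_bij_nonzero: "linear f \<Longrightarrow> bij f \<Longrightarrow> v \<noteq> 0 \<Longrightarrow> f v \<noteq> 0"
  by (metis bij_is_inj linear_injective_0)

definition proj_map :: "('a::euclidean_space \<Rightarrow> 'a) \<Rightarrow> 'a proj_space \<Rightarrow> 'a proj_space" where
  "proj_map f p = homog (f (rep_proj p))"

lemma proj_map_homog:
  assumes f: "linear f" "bij f" and v: "v \<noteq> 0"
  shows "proj_map f (homog v) = homog (f v)"
proof -
  have "homog v = homog (rep_proj (homog v))" by simp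
  then obtain c where c: "c \<noteq> 0" "rep_proj (homog v) = c *\<^sub>R v"
    using homog_eq_iff[OF v rep_proj_nonzero] by blast
  have "f (c *\<^sub>R v) = c *\<^sub>R f v" using f by (simp add: linear_scale)
  then show ?thesis
    using homog_scaleR[OF linear_bij_nonzero[OF f v] c(1)] by (simp add: proj_map_def c)
qed

lemma proj_map_projective: "linear f \<Longrightarrow> bij f \<Longrightarrow> projective_transformation (proj_map f)"
  unfolding projective_transformation_def using proj_map_homog by blast

lemma mem_projective_class_homog:
  assumes D: "0 \<notin> D"
  shows "\<Omega> \<in> projective_class (homog ` D) \<longleftrightarrow> (\<exists>f. linear f \<and> bij f \<and> \<Omega> = homog ` f ` D)"
proof
  assume "\<Omega> \<in> projective_class (homog ` D)"
  then obtain g f where f: "linear f" "bij f" "\<And>v. v \<noteq> 0 \<Longrightarrow> g (homog v) = homog (f v)" and "\<Omega> = g ` homog ` D"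
    unfolding projective_class_def projective_transformation_def by blast
  then have "\<Omega> = (\<lambda>v. g (homog v)) ` D" by (simp add: image_image)
  also have "\<dots> = (\<lambda>v. homog (f v)) ` D" by (intro image_cong refl f(3)) (use D in auto)
  finally have "\<Omega> = homog ` f ` D" by (simp add: image_image)
  with f show "\<exists>f. linear f \<and> bij f \<and> \<Omega> = homog ` f ` D" by blast
next
  assume "\<exists>f. linear f \<and> bij f \<and> \<Omega> = homog ` f ` D"
  then obtain f where f: "linear f" "bij f" "\<Omega> = homog ` f ` D" by blast
  have "\<Omega> = proj_map f ` homog ` D"
    unfolding f(3) image_image by (intro image_cong refl proj_map_homog[OF f(1,2), symmetric]) (use D in auto)
  then show "\<Omega> \<in> projective_class (homog ` D)"
    unfolding projective_class_def using proj_map_projective[OF f(1,2)] by blast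
qed

lemma projective_transformation_id: "projective_transformation (\<lambda>p. p)"
  unfolding projective_transformation_def by (rule exI[of _ id]) (auto simp: linear_id)

lemma projective_transformation_comp:
  assumes "projective_transformation g" "projective_transformation h"
  shows "projective_transformation (\<lambda>p. g (h p))"
proof -
  obtain f where f: "linear f" "bij f" "\<And>v. v \<noteq> 0 \<Longrightarrow> g (homog v) = homog (f v)"
    using assms(1) unfolding projective_transformation_def by blast
  obtain e where e: "linear e" "bij e" "\<And>v. v \<noteq> 0 \<Longrightarrow> h (homog v) = homog (e v)"
    using assms(2) unfolding projective_transformation_def by blast
  have "linear (f \<circ> e)" "bij (f \<circ> e)" using f e by (auto intro: linear_compose bij_comp)
  moreover have "g (h (homog v)) = homog ((f \<circ> e) v)" if "v \<noteq> 0" for v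
    using that f(3)[OF linear_bij_nonzero[OF e(1,2) that]] e(3) by simp
  ultimately show ?thesis unfolding projective_transformation_def by blast
qed

lemma projective_transformation_inverse:
  assumes "projective_transformation g"
  obtains h where "projective_transformation h" "\<And>p. h (g p) = p" "\<And>p. g (h p) = p"
proof -
  obtain f where f: "linear f" "bij f" "\<And>v. v \<noteq> 0 \<Longrightarrow> g (homog v) = homog (f v)"
    using assms unfolding projective_transformation_def by blast
  define e where "e = inv f"
  have e: "linear e" "bij e" "\<And>v. e (f v) = v" "\<And>v. f (e v) = v"
    using f by (auto simp: e_def bij_imp_bij_inv bij_is_inj bij_is_surj surj_f_inv_f intro: linear_inverse_left)
      (metis bij_is_inj bij_is_surj inj_linear_imp_inv_linear)
  show ?thesis
  proof (rule that)
    show "projective_transformation (proj_map e)" by (rule proj_map_projective) (rule e)+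
    show "proj_map e (g p) = p" for p
      using homog_cases[of p] f(3) proj_map_homog[OF e(1,2) linear_bij_nonzero[OF f(1,2)]] e(3) by metis
    show "g (proj_map e p) = p" for p
      using homog_cases[of p] f(3)[OF linear_bij_nonzero[OF e(1,2)]] proj_map_homog[OF e(1,2)] e(4) by metis
  qed
qed

lemma self_in_projective_class: "\<Omega> \<in> projective_class \<Omega>"
  unfolding projective_class_def using projective_transformation_id by force

lemma projective_class_eqI:
  assumes "\<Omega>' \<in> projective_class \<Omega>"
  shows "projective_class \<Omega>' = projective_class \<Omega>"
proof -
  obtain g where g: "projective_transformation g" "\<Omega>' = g ` \<Omega>"
    using assms unfolding projective_class_def by blast
  obtain h where h: "projective_transformation h" "\<And>p. h (g p) = p" "\<And>p. g (h p) = p"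
    using projective_transformation_inverse[OF g(1)] by metis
  have "k ` \<Omega>' \<in> projective_class \<Omega>" if "projective_transformation k" for k
    unfolding projective_class_def g(2) image_image
    using projective_transformation_comp[OF that g(1)] by blast
  moreover have "k ` \<Omega> \<in> projective_class \<Omega>'" if "projective_transformation k" for k
  proof -
    have "k ` \<Omega> = (\<lambda>p. k (h p)) ` \<Omega>'" unfolding g(2) image_image h(2) ..
    then show ?thesis
      unfolding projective_class_def using projective_transformation_comp[OF that h(1)] by blast
  qed
  ultimately show ?thesis unfolding projective_class_def[of \<Omega>] projective_class_def[of \<Omega>']
    by (auto simp: projective_class_def)
qed

lemma projective_class_eq_iff: "projective_class \<Omega>' = projective_class \<Omega> \<longleftrightarrow> \<Omega>' \<in> projective_class \<Omega>"
  using projective_class_eqI self_in_projective_class by blast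

lemma continuous_on_homog: "continuous_on (- {0}) (homog :: 'a::euclidean_space \<Rightarrow> 'a proj_space)"
  using quotient_imp_continuous_map[OF quotient_map_homog] by simp

lemma homog_tendsto:
  assumes "v \<longlonglongrightarrow> w" "w \<noteq> 0"
  shows "(\<lambda>k. homog (v k)) \<longlonglongrightarrow> homog w"
proof -
  have "isCont homog w"
    using continuous_on_homog assms(2) by (auto simp: continuous_on_eq_continuous_at open_Compl)
  then show ?thesis using assms(1) by (rule isCont_tendsto_compose)
qed

lemma homog_unit: "v \<noteq> 0 \<Longrightarrow> homog (sgn v) = homog v"
  using homog_scaleR[of v "inverse (norm v)"] by (simp add: sgn_div_norm)

lemma homog_minus: "v \<noteq> 0 \<Longrightarrow> homog (- v) = homog v"
  using homog_scaleR[of v "- 1"] by simp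

lemma unit_convergent_subsequence:
  fixes v :: "nat \<Rightarrow> 'a::euclidean_space"
  assumes "\<And>k. norm (v k) = 1"
  obtains w r where "norm w = 1" "strict_mono r" "(\<lambda>k. v (r k)) \<longlonglongrightarrow> w"
proof -
  have "seq_compact (sphere (0::'a) 1)" by (simp add: compact_imp_seq_compact)
  moreover have "\<forall>k. v k \<in> sphere 0 1" using assms by simp
  ultimately obtain w r where "w \<in> sphere 0 1" "strict_mono r" "(v \<circ> r) \<longlonglongrightarrow> w"
    by (rule seq_compactE)
  then show ?thesis by (intro that) (auto simp: o_def)
qed

lemma compact_proj_space: "compact (UNIV :: 'a::euclidean_space proj_space set)"
proof -
  have "compact (homog ` sphere (0::'a) 1)"
    by (rule compact_continuous_image) (auto intro: continuous_on_subset[OF continuous_on_homog])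
  moreover have "homog ` sphere (0::'a) 1 = UNIV"
  proof -
    have "p \<in> homog ` sphere (0::'a) 1" for p by (rule homog_cases[of p]) auto
    then show ?thesis by blast
  qed
  ultimately show ?thesis by simp
qed

lemma dist_homog_unit:
  assumes "norm u = 1" "norm v = 1"
  shows "dist (homog u) (homog v) = min (norm (u - v)) (norm (u + v))"
proof -
  have "u \<noteq> 0" "v \<noteq> 0" using assms by auto
  then show ?thesis using assms by (simp add: dist_homog sgn_div_norm)
qed

section \<open>Hausdorff limits through sequences of points\<close>

lemma infdist_le_hausdorff_dist:
  assumes "bounded A" "B \<noteq> {}" "bounded B" "a \<in> A"
  shows "infdist a B \<le> hausdorff_dist A B" "infdist a B \<le> hausdorff_dist B A"
  using hausdorff_dist_le_iff[of A B "hausdorff_dist A B"] hausdorff_dist_le_iff[of B A "hausdorff_dist B A"] assms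
  by blast+

lemma hausdorff_dist_nonneg: "0 \<le> hausdorff_dist A B"
  using Metric_space.nonneg[OF Metric_space_hausdorff_dist] .

lemma hausdorff_dist_self: "hausdorff_dist A A = 0"
proof (cases "A \<noteq> {} \<and> bounded A")
  case True
  then have "hausdorff_dist A A \<le> 0" by (subst hausdorff_dist_le_iff) auto
  then show ?thesis using hausdorff_dist_nonneg[of A A] by simp
qed (auto simp: hausdorff_dist_def)

lemma hausdorff_dist_commute: "hausdorff_dist A B = hausdorff_dist B A"
  using Metric_space.commute[OF Metric_space_hausdorff_dist] .

lemma infdist_lessD:
  assumes "infdist x A < e" "A \<noteq> {}"
  obtains a where "a \<in> A" "dist x a < e"
proof -
  have "(INF a\<in>A. dist x a) < e" using assms by (simp add: infdist_notempty)
  then show ?thesis using assms that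
    by (subst (asm) cINF_less_iff) auto
qed

lemma hausdorff_near:
  fixes A B :: "'a::euclidean_space proj_space set"
  assumes "hausdorff_dist (closure A) (closure B) < e" "A \<noteq> {}" "B \<noteq> {}" "a \<in> closure A"
  obtains b where "b \<in> B" "dist a b < e"
proof -
  have "infdist a (closure B) < e"
    using infdist_le_hausdorff_dist(1)[of "closure A" "closure B" a] assms bounded_proj_space by fastforce
  then obtain c where c: "c \<in> closure B" "dist a c < e"
    using assms(3) by (elim infdist_lessD) auto
  then obtain b where b: "b \<in> B" "dist b c < e - dist a c"
    using closure_approachable[of c B] by (metis diff_gt_0_iff_gt)
  then show ?thesis using dist_triangle[of a b c] by (intro that[of b]) (auto simp: dist_commute)
qed

lemma hausdorff_tendsto_limit:
  fixes A :: "nat \<Rightarrow> 'a::euclidean_space proj_space set"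
  assumes lim: "(\<lambda>k. hausdorff_dist (closure (A k)) (closure B)) \<longlonglongrightarrow> 0" and ne: "B \<noteq> {}"
    and p: "\<forall>\<^sub>F k in sequentially. p k \<in> closure (A k)" "p \<longlonglongrightarrow> q"
  shows "q \<in> closure B"
proof -
  have "(\<lambda>k. infdist (p k) (closure B)) \<longlonglongrightarrow> 0"
  proof (rule tendsto_sandwich[OF _ _ tendsto_const lim])
    show "\<forall>\<^sub>F k in sequentially. infdist (p k) (closure B) \<le> hausdorff_dist (closure (A k)) (closure B)"
      using p(1) by eventually_elim (use ne in \<open>auto intro!: infdist_le_hausdorff_dist bounded_proj_space\<close>)
  qed (simp add: infdist_nonneg)
  moreover have "(\<lambda>k. infdist (p k) (closure B)) \<longlonglongrightarrow> infdist q (closure B)"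
    by (intro tendsto_infdist p)
  ultimately have "infdist q (closure B) = 0" using LIMSEQ_unique by blast
  then show ?thesis using ne in_closed_iff_infdist_zero[of "closure B" q] by simp
qed

text \<open>Compactness of projective space makes both pointwise hypotheses uniform: a finite net of
  \<open>B\<close> for the points that must be reached, and a convergent subsequence of far points
  to contradict \<open>U\<close>.\<close>

lemma hausdorff_tendstoI:
  fixes A :: "nat \<Rightarrow> 'a::euclidean_space proj_space set"
  assumes ne: "\<And>k. A k \<noteq> {}" "B \<noteq> {}"
    and L: "\<And>p. p \<in> B \<Longrightarrow> \<forall>\<^sub>F k in sequentially. p \<in> A k"
    and U: "\<And>r p q. strict_mono r \<Longrightarrow> (\<And>k. p k \<in> A (r k)) \<Longrightarrow> p \<longlonglongrightarrow> q \<Longrightarrow> q \<in> closure B"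
  shows "(\<lambda>k. hausdorff_dist (closure (A k)) (closure B)) \<longlonglongrightarrow> 0"
proof (rule order_tendstoI)
  show "\<forall>\<^sub>F k in sequentially. e < hausdorff_dist (closure (A k)) (closure B)" if "e < 0" for e
    using that hausdorff_dist_nonneg by (intro always_eventually allI) (rule less_le_trans)
next
  fix e :: real assume e: "0 < e"
  define d where "d = e / 3"
  have d: "0 < d" using e by (simp add: d_def)
  have cB: "compact (closure B)" using compact_Int_closed[OF compact_proj_space, of "closure B"] by simp
  have sB: "closure B \<subseteq> (\<Union>b\<in>B. ball b d)"
    using d by (force simp: closure_approachable dist_commute)
  obtain F where F: "F \<subseteq> B" "finite F" "closure B \<subseteq> (\<Union>b\<in>F. ball b d)"
    by (rule compactE_image[OF cB _ sB]) auto
  have "\<forall>\<^sub>F k in sequentially. \<forall>b\<in>F. b \<in> A k"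
    using F L by (intro eventually_ball_finite) auto
  moreover have "\<forall>\<^sub>F k in sequentially. \<forall>a\<in>A k. infdist a B \<le> d"
  proof (rule ccontr)
    assume "\<not> ?thesis"
    then have "\<exists>\<^sub>F k in sequentially. \<exists>a\<in>A k. d < infdist a B" by (simp add: not_eventually not_le)
    then have "infinite {k. \<exists>a\<in>A k. d < infdist a B}"
      by (simp add: frequently_cofinite flip: cofinite_eq_sequentially)
    then obtain r :: "nat \<Rightarrow> nat" where r: "strict_mono r" "\<And>k. \<exists>a\<in>A (r k). d < infdist a B"
      using infinite_enumerate by blast
    then obtain p where p: "\<And>k. p k \<in> A (r k)" "\<And>k. d < infdist (p k) B" by metis
    have "seq_compact (UNIV :: 'a proj_space set)" using compact_proj_space by (rule compact_imp_seq_compact)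
    then obtain q s where s: "strict_mono s" "(p \<circ> s) \<longlonglongrightarrow> q"
      by (rule seq_compactE[where f = p]) auto
    have "q \<in> closure B"
      by (rule U[OF strict_mono_o[OF r(1) s(1)] _ s(2)]) (simp add: p)
    then have "infdist q B = 0" using ne(2) by (simp add: in_closure_iff_infdist_zero)
    moreover have "(\<lambda>k. infdist ((p \<circ> s) k) B) \<longlonglongrightarrow> infdist q B" by (intro tendsto_infdist s)
    then have "d \<le> infdist q B"
      by (rule LIMSEQ_le_const) (use p in \<open>auto intro: less_imp_le\<close>)
    ultimately show False using d by simp
  qed
  ultimately show "\<forall>\<^sub>F k in sequentially. hausdorff_dist (closure (A k)) (closure B) < e"
  proof eventually_elim
    case (elim k)
    have "infdist a (closure B) \<le> 2 * d" if a: "a \<in> closure (A k)" for a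
    proof -
      obtain a' where a': "a' \<in> A k" "dist a' a < d"
        using a d unfolding closure_approachable by meson
      have "infdist a B \<le> infdist a' B + dist a a'" by (rule infdist_triangle)
      moreover have "infdist a' B \<le> d" using elim a'(1) by blast
      ultimately show ?thesis
        using a'(2) infdist_mono[OF closure_subset ne(2), of a] by (simp add: dist_commute)
    qed
    moreover have "infdist b (closure (A k)) \<le> 2 * d" if b: "b \<in> closure B" for b
    proof -
      obtain c where c: "c \<in> F" "dist c b < d" using F(3) b by auto
      then have "c \<in> A k" using elim by blast
      then have "infdist b (A k) \<le> dist b c" by (rule infdist_le)
      then show ?thesis
        using c d infdist_mono[OF closure_subset ne(1)[of k], of b] by (simp add: dist_commute)
    qed
    ultimately have "hausdorff_dist (closure (A k)) (closure B) \<le> 2 * d"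
      using ne by (subst hausdorff_dist_le_iff) (auto intro: bounded_proj_space)
    then show ?case using e by (simp add: d_def)
  qed
qed

lemma openin_domain_topology_iff:
  "openin domain_topology X \<longleftrightarrow> X \<subseteq> properly_convex_domains \<and>
    (\<forall>\<Omega>\<in>X. \<exists>e>0. \<forall>\<Omega>'\<in>properly_convex_domains. hausdorff_dist (closure \<Omega>) (closure \<Omega>') < e \<longrightarrow> \<Omega>' \<in> X)"
    (is "?L \<longleftrightarrow> ?R") for X :: "'a::euclidean_space proj_space set set"
proof -
  let ?M = "{K :: 'a proj_space set. closed K \<and> bounded K \<and> K \<noteq> {}}"
  interpret H: Metric_space ?M hausdorff_dist by (rule Metric_space_hausdorff_dist)
  have cl: "closure \<Omega> \<in> ?M" if "\<Omega> \<in> properly_convex_domains" for \<Omega>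
    using that by (auto simp: bounded_proj_space properly_convex_domains_def proj_domain_def)
  show ?thesis
  proof
    assume ?L
    then obtain U where U: "openin H.mtopology U" "X = closure -` U \<inter> properly_convex_domains"
      unfolding domain_topology_def openin_pullback_topology hausdorff_topology_def by blast
    show ?R
    proof (intro conjI ballI)
      show "X \<subseteq> properly_convex_domains" using U by blast
      fix \<Omega> assume O: "\<Omega> \<in> X"
      then obtain e where e: "0 < e" "H.mball (closure \<Omega>) e \<subseteq> U"
        using U unfolding H.openin_mtopology by blast
      have "\<Omega>' \<in> X" if "\<Omega>' \<in> properly_convex_domains" "hausdorff_dist (closure \<Omega>) (closure \<Omega>') < e" for \<Omega>'
        using that e(2) cl[of \<Omega>'] cl[of \<Omega>] O U(2) by (auto simp: subset_iff)
      with e(1) show "\<exists>e>0. \<forall>\<Omega>'\<in>properly_convex_domains. hausdorff_dist (closure \<Omega>) (closure \<Omega>') < e \<longrightarrow> \<Omega>' \<in> X"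
        by blast
    qed
  next
    assume R: ?R
    then have "\<forall>\<Omega>\<in>X. \<exists>e. 0 < e \<and> (\<forall>\<Omega>'\<in>properly_convex_domains. hausdorff_dist (closure \<Omega>) (closure \<Omega>') < e \<longrightarrow> \<Omega>' \<in> X)"
      by blast
    then obtain e where e0: "\<forall>\<Omega>\<in>X. 0 < e \<Omega> \<and> (\<forall>\<Omega>'\<in>properly_convex_domains. hausdorff_dist (closure \<Omega>) (closure \<Omega>') < e \<Omega> \<longrightarrow> \<Omega>' \<in> X)"
      by (rule bchoice[THEN exE])
    then have e: "\<And>\<Omega>. \<Omega> \<in> X \<Longrightarrow> 0 < e \<Omega>"
      "\<And>\<Omega> \<Omega>'. \<Omega> \<in> X \<Longrightarrow> \<Omega>' \<in> properly_convex_domains \<Longrightarrow> hausdorff_dist (closure \<Omega>) (closure \<Omega>') < e \<Omega> \<Longrightarrow> \<Omega>' \<in> X"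
      by simp_all
    define U where "U = (\<Union>\<Omega>\<in>X. H.mball (closure \<Omega>) (e \<Omega>))"
    have "openin H.mtopology U" unfolding U_def by auto
    moreover have "X = closure -` U \<inter> properly_convex_domains"
    proof
      show "X \<subseteq> closure -` U \<inter> properly_convex_domains"
      proof
        fix \<Omega> assume O: "\<Omega> \<in> X"
        then have "\<Omega> \<in> properly_convex_domains" using R by blast
        with cl[OF this] O e(1)[OF O] show "\<Omega> \<in> closure -` U \<inter> properly_convex_domains"
          unfolding U_def by (auto intro!: bexI[of _ \<Omega>] simp: hausdorff_dist_self)
      qed
      show "closure -` U \<inter> properly_convex_domains \<subseteq> X"
        using e(2) by (auto simp: U_def)
    qed
    ultimately show ?L
      unfolding domain_topology_def openin_pullback_topology hausdorff_topology_def by blast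
  qed
qed

text \<open>The topology is pulled back along \<open>closure\<close> from a metric, so sequences
  detect closed sets.\<close>

lemma closedin_domain_topology_iff:
  "closedin domain_topology X \<longleftrightarrow> X \<subseteq> properly_convex_domains \<and>
    (\<forall>A \<Omega>. (\<forall>k::nat. A k \<in> X) \<and> \<Omega> \<in> properly_convex_domains \<and>
      (\<lambda>k. hausdorff_dist (closure (A k)) (closure \<Omega>)) \<longlonglongrightarrow> 0 \<longrightarrow> \<Omega> \<in> X)"
  (is "?L \<longleftrightarrow> ?R") for X :: "'a::euclidean_space proj_space set set"
proof
  assume L: ?L
  then have sub: "X \<subseteq> properly_convex_domains" using closedin_subset by fastforce
  have op: "openin domain_topology (properly_convex_domains - X)"
    using L by (simp add: closedin_def)
  have "\<Omega> \<in> X" if A: "\<And>k. A k \<in> X" and O: "\<Omega> \<in> properly_convex_domains"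
    and lim: "(\<lambda>k. hausdorff_dist (closure (A k)) (closure \<Omega>)) \<longlonglongrightarrow> 0" for A \<Omega>
  proof (rule ccontr)
    assume "\<Omega> \<notin> X"
    with O op obtain e where e: "0 < e"
      "\<And>\<Omega>'. \<Omega>' \<in> properly_convex_domains \<Longrightarrow> hausdorff_dist (closure \<Omega>) (closure \<Omega>') < e \<Longrightarrow> \<Omega>' \<notin> X"
      unfolding openin_domain_topology_iff by blast
    obtain k where "hausdorff_dist (closure (A k)) (closure \<Omega>) < e"
      using order_tendstoD(2)[OF lim e(1)] eventually_sequentially by auto
    with e(2)[of "A k"] A[of k] sub show False by (auto simp: hausdorff_dist_commute)
  qed
  with sub show ?R by blast
next
  assume R: ?R
  have "openin domain_topology (properly_convex_domains - X)"
    unfolding openin_domain_topology_iff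
  proof (intro conjI ballI)
    fix \<Omega> assume O: "\<Omega> \<in> properly_convex_domains - X"
    show "\<exists>e>0. \<forall>\<Omega>'\<in>properly_convex_domains. hausdorff_dist (closure \<Omega>) (closure \<Omega>') < e \<longrightarrow> \<Omega>' \<in> properly_convex_domains - X"
    proof (rule ccontr)
      assume no: "\<not> ?thesis"
      have "\<exists>\<Omega>'\<in>X. hausdorff_dist (closure \<Omega>) (closure \<Omega>') < 1 / real (Suc k)" for k
      proof -
        have "0 < 1 / real (Suc k)" by simp
        with no show ?thesis by blast
      qed
      then have "\<forall>k. \<exists>\<Omega>'. \<Omega>' \<in> X \<and> hausdorff_dist (closure \<Omega>) (closure \<Omega>') < 1 / real (Suc k)" by blast
      then obtain A where A: "\<And>k. A k \<in> X" "\<And>k. hausdorff_dist (closure \<Omega>) (closure (A k)) < 1 / real (Suc k)"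
        by (elim choice[THEN exE]) auto
      have "(\<lambda>k. hausdorff_dist (closure (A k)) (closure \<Omega>)) \<longlonglongrightarrow> 0"
        by (rule tendsto_sandwich[OF _ _ tendsto_const LIMSEQ_Suc[OF lim_1_over_n]])
          (use A(2) in \<open>auto simp: hausdorff_dist_nonneg hausdorff_dist_commute intro!: always_eventually less_imp_le\<close>)
      with R A(1) O show False by blast
    qed
  qed auto
  with R show ?L by (simp add: closedin_def)
qed

section \<open>Cones over epigraphs\<close>

lemma sum_three:
  fixes g :: "'n::finite \<Rightarrow> real"
  assumes "i \<noteq> j" "i \<noteq> k" "j \<noteq> k"
  shows "sum g UNIV = g i + g j + g k + sum g (- {i, j, k})"
proof -
  have "sum g UNIV = sum g {i, j, k} + sum g (- {i, j, k})"
    by (subst sum.union_disjoint[symmetric]) (auto simp: Compl_partition)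
  then show ?thesis using assms by simp
qed

text \<open>The perspective \<open>z * f (x / z)\<close> is convex and homogeneous of degree 1,
  hence subadditive; this makes the cone closed under addition.\<close>

lemma convex_perspective:
  fixes f :: "real \<Rightarrow> real"
  assumes f: "convex_on UNIV f" and z: "0 < z" "0 < z'"
  shows "(z + z') * f ((x + x') / (z + z')) \<le> z * f (x / z) + z' * f (x' / z')"
proof -
  define t where "t = z' / (z + z')"
  have t: "0 \<le> t" "t \<le> 1" "(z + z') * t = z'" "(z + z') * (1 - t) = z" using z by (auto simp: t_def field_simps)
  have "(x + x') / (z + z') = (1 - t) * (x / z) + t * (x' / z')"
  proof -
    have "1 - t = z / (z + z')" using z by (simp add: t_def field_simps)
    then have "(1 - t) * (x / z) = x / (z + z')" "t * (x' / z') = x' / (z + z')" using z by (simp_all add: t_def)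
    then show ?thesis by (simp add: add_divide_distrib)
  qed
  then have "f ((x + x') / (z + z')) \<le> (1 - t) * f (x / z) + t * f (x' / z')"
    using convex_onD[OF f, of t "x / z" "x' / z'"] t by simp
  then have "(z + z') * f ((x + x') / (z + z')) \<le> (z + z') * ((1 - t) * f (x / z) + t * f (x' / z'))"
    using z by (intro mult_left_mono) auto
  also have "\<dots> = ((z + z') * (1 - t)) * f (x / z) + ((z + z') * t) * f (x' / z')" by (simp add: algebra_simps)
  finally show ?thesis using t by simp
qed

text \<open>The subtracted constant involves only the values at 0, \<open>s\<close> and
  \<open>- s\<close>, so the bound is uniform along a pointwise convergent sequence.\<close>

lemma convex_linear_lower_bound:
  fixes f :: "real \<Rightarrow> real"
  assumes f: "convex_on UNIV f" and s: "0 < s" and L: "0 \<le> L" "L * s \<le> f s - f 0" "L * s \<le> f (- s) - f 0"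
  shows "L * \<bar>x\<bar> - (L * s + \<bar>f 0\<bar> + \<bar>f s - f 0\<bar> + \<bar>f (- s) - f 0\<bar>) \<le> f x"
proof -
  have Ls: "L \<le> (f s - f 0) / s" "L \<le> (f (- s) - f 0) / s" using L s by (simp_all add: pos_le_divide_eq)
  have 0: "0 \<le> L * s" using L s by simp
  consider "s \<le> x" | "x \<le> - s" | "x = 0" | "0 < x" "x < s" | "x < 0" "- s < x" by linarith
  then show ?thesis
  proof cases
    case 1
    have "x * L \<le> x * ((f s - f 0) / s)" using 1 s Ls by (intro mult_left_mono) auto
    with convex_chord_above(1)[OF f s 1] 1 s 0 show ?thesis by (simp add: mult.commute)
  next
    case 2
    have "(- x) * L \<le> (- x) * ((f (- s) - f 0) / s)" using 2 s Ls by (intro mult_left_mono) auto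
    with convex_chord_above(2)[OF f s 2] 2 s 0 show ?thesis by (simp add: mult.commute)
  next
    case 3
    then show ?thesis using 0 by simp
  next
    case 4
    have "(f 0 - f (- s)) / (0 - (- s)) \<le> (f x - f 0) / (x - 0)"
      by (rule convex_slope_mono[OF f]) (use 4 s in auto)
    then have "f 0 - x * ((f (- s) - f 0) / s) \<le> f x" using 4 s by (simp add: field_simps)
    moreover have "x * ((f (- s) - f 0) / s) \<le> s * ((f (- s) - f 0) / s)"
      by (rule mult_right_mono) (use 4 Ls L(1) in linarith)+
    moreover have "L * x \<le> L * s" using 4 L by (intro mult_left_mono) auto
    ultimately show ?thesis using 4 s by simp
  next
    case 5
    have "(f 0 - f x) / (0 - x) \<le> (f s - f 0) / (s - 0)"
      by (rule convex_slope_mono[OF f]) (use 5 s in auto)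
    then have "f 0 - f x \<le> (f s - f 0) / s * (- x)"
      unfolding diff_0 diff_0_right by (subst (asm) pos_divide_le_eq) (use 5 in auto)
    moreover have "(f s - f 0) / s * (- x) \<le> (f s - f 0) / s * s"
      by (rule mult_left_mono) (use 5 Ls L(1) in linarith)+
    moreover have "L * (- x) \<le> L * s" using 5 L by (intro mult_left_mono) auto
    ultimately show ?thesis using 5 s by simp
  qed
qed

locale three_coordinates =
  fixes i j k :: "'n::finite"
  assumes distinct: "i \<noteq> j" "i \<noteq> k" "j \<noteq> k"
begin

text \<open>
  The cone over the epigraph of \<open>f\<close> in the coordinates \<open>i\<close>, \<open>j\<close>, \<open>k\<close> (abscissa, ordinate, homogenizing
  coordinate) times the positive orthant in the other coordinates, and its closure for superlinear \<open>f\<close>.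
\<close>
definition ocone :: "(real \<Rightarrow> real) \<Rightarrow> (real ^ 'n) set" where
  "ocone f = {v. 0 < v $ k \<and> v $ k * f (v $ i / v $ k) < v $ j \<and> (\<forall>m. m \<notin> {i, j, k} \<longrightarrow> 0 < v $ m)}"

definition ccone :: "(real \<Rightarrow> real) \<Rightarrow> (real ^ 'n) set" where
  "ccone f = {v. (0 < v $ k \<and> v $ k * f (v $ i / v $ k) \<le> v $ j \<or> v $ k = 0 \<and> v $ i = 0 \<and> 0 \<le> v $ j) \<and>
     (\<forall>m. m \<notin> {i, j, k} \<longrightarrow> 0 \<le> v $ m)}"

text \<open>In the chart \<open>v $ k = 1\<close> this is the point at height 1 above the minimum of
  a normalized function.\<close>

definition base :: "real ^ 'n" where
  "base = (\<chi> m. if m = i then 0 else 1)"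

lemma base_nth [simp]: "base $ i = 0" "base $ j = 1" "base $ k = 1" "m \<noteq> i \<Longrightarrow> base $ m = 1"
  using distinct by (auto simp: base_def)

lemma ocone_subset_ccone: "ocone f \<subseteq> ccone f"
  by (auto simp: ocone_def ccone_def less_imp_le)

lemma zero_notin_ocone: "0 \<notin> ocone f"
  by (simp add: ocone_def)

lemma ocone_scale: "v \<in> ocone f \<Longrightarrow> 0 < c \<Longrightarrow> c *\<^sub>R v \<in> ocone f"
  by (auto simp: ocone_def mult.assoc)

text \<open>Subadditivity of the perspective keeps the strict inequality of \<open>p\<close>. Both
  convexity and density of the open cone in \<open>ccone\<close> follow from it.\<close>

lemma ccone_add_ocone:
  assumes f: "convex_on UNIV f" and v: "v \<in> ccone f" and p: "p \<in> ocone f"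
  shows "v + p \<in> ocone f"
proof -
  have pos: "0 < p $ k" "p $ k * f (p $ i / p $ k) < p $ j" "\<And>m. m \<notin> {i, j, k} \<Longrightarrow> 0 < p $ m"
    using p by (auto simp: ocone_def)
  have m: "0 < (v + p) $ m" if "m \<notin> {i, j, k}" for m
    using v pos(3)[OF that] that by (auto simp: ccone_def intro: add_nonneg_pos)
  show ?thesis
  proof (cases "v $ k = 0")
    case True
    then have "v $ i = 0" "0 \<le> v $ j" using v by (auto simp: ccone_def)
    with True pos m show ?thesis by (simp add: ocone_def)
  next
    case False
    then have "0 < v $ k" "v $ k * f (v $ i / v $ k) \<le> v $ j" using v by (auto simp: ccone_def)
    with pos m convex_perspective[OF f, of "v $ k" "p $ k" "v $ i" "p $ i"] show ?thesis
      by (simp add: ocone_def)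
  qed
qed

lemma convex_ocone:
  assumes f: "convex_on UNIV f"
  shows "convex (ocone f)"
proof (rule convexI)
  fix x y :: "real ^ 'n" and u v :: real
  assume xy: "x \<in> ocone f" "y \<in> ocone f" and uv: "0 \<le> u" "0 \<le> v" "u + v = 1"
  consider "u = 0" | "v = 0" | "0 < u" "0 < v" using uv by linarith
  then show "u *\<^sub>R x + v *\<^sub>R y \<in> ocone f"
  proof cases
    case 3
    then have "u *\<^sub>R x \<in> ccone f" "v *\<^sub>R y \<in> ocone f"
      using xy ocone_scale ocone_subset_ccone by blast+
    then show ?thesis by (rule ccone_add_ocone[OF f])
  qed (use xy uv in auto)
qed

lemma open_ocone:
  assumes f: "convex_on UNIV f"
  shows "open (ocone f)"
proof -
  have cf: "continuous_on UNIV f" by (rule convex_real_continuous[OF f])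
  let ?P = "{v :: real ^ 'n. 0 < v $ k}"
  have P: "open ?P" by (intro open_Collect_less continuous_intros)
  have "continuous_on ?P (\<lambda>v. f (v $ i / v $ k))"
    by (rule continuous_on_compose2[OF cf]) (auto intro!: continuous_intros)
  then have "continuous_on ?P (\<lambda>v. v $ j - v $ k * f (v $ i / v $ k))"
    by (intro continuous_intros)
  then have "open (?P \<inter> (\<lambda>v. v $ j - v $ k * f (v $ i / v $ k)) -` {0<..})"
    by (rule continuous_open_preimage[OF _ P]) simp
  moreover have "open (\<Inter>m\<in>- {i, j, k}. {v :: real ^ 'n. 0 < v $ m})"
    by (intro open_INT ballI open_Collect_less continuous_intros) auto
  ultimately have "open ((?P \<inter> (\<lambda>v. v $ j - v $ k * f (v $ i / v $ k)) -` {0<..}) \<inter> (\<Inter>m\<in>- {i, j, k}. {v. 0 < v $ m}))"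
    by (rule open_Int)
  also have "(?P \<inter> (\<lambda>v. v $ j - v $ k * f (v $ i / v $ k)) -` {0<..}) \<inter> (\<Inter>m\<in>- {i, j, k}. {v. 0 < v $ m}) = ocone f"
    by (auto simp: ocone_def)
  finally show ?thesis .
qed

lemma ocone_nonempty: "ocone f \<noteq> {}"
proof -
  have "(\<chi> m. if m = i then 0 else if m = j then f 0 + 1 else 1) \<in> ocone f"
    using distinct by (simp add: ocone_def)
  then show ?thesis by blast
qed

lemma closure_ocone_supset:
  assumes f: "convex_on UNIV f"
  shows "ccone f \<subseteq> closure (ocone f)"
proof
  fix v assume v: "v \<in> ccone f"
  obtain p where p: "p \<in> ocone f" using ocone_nonempty by blast
  have "v + (1 / real (Suc m)) *\<^sub>R p \<in> ocone f" for m
    by (rule ccone_add_ocone[OF f v ocone_scale[OF p]]) simp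
  moreover have "(\<lambda>m. v + (1 / real (Suc m)) *\<^sub>R p) \<longlonglongrightarrow> v + 0 *\<^sub>R p"
    by (intro tendsto_intros LIMSEQ_Suc[OF lim_1_over_n])
  ultimately show "v \<in> closure (ocone f)"
    unfolding closure_sequential by (intro exI[of _ "\<lambda>m. v + (1 / real (Suc m)) *\<^sub>R p"]) simp
qed

text \<open>Constant sequences give closures, general ones Hausdorff limits. If
  \<open>w $ k = 0\<close>, abscissas may escape to infinity; superlinearity of the limit alone
  yields bounds of every slope for the late \<open>f m\<close>, and these force
  \<open>w $ i = 0\<close>.\<close>

lemma ocone_limit:
  assumes f: "\<And>m. convex_on UNIV (f m)" and lim: "\<And>x. (\<lambda>m. f m x) \<longlonglongrightarrow> g x" and g: "superlinear g"
    and v: "\<And>m. v m \<in> ocone (f m)" "v \<longlonglongrightarrow> w"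
  shows "w \<in> ccone g"
proof -
  have vm: "(\<lambda>m. v m $ l) \<longlonglongrightarrow> w $ l" for l by (intro tendsto_vec_nth v)
  have pos: "0 < v m $ k" "v m $ k * f m (v m $ i / v m $ k) < v m $ j" for m
    using v(1)[of m] by (auto simp: ocone_def)
  have rest: "0 \<le> w $ l" if "l \<notin> {i, j, k}" for l
    by (rule LIMSEQ_le_const[OF vm]) (use v(1) that in \<open>auto simp: ocone_def less_imp_le\<close>)
  have wk: "0 \<le> w $ k"
    by (rule LIMSEQ_le_const[OF vm]) (use pos in \<open>auto simp: less_imp_le\<close>)
  show ?thesis
  proof (cases "w $ k = 0")
    case False
    then have "(\<lambda>m. v m $ i / v m $ k) \<longlonglongrightarrow> w $ i / w $ k" by (intro tendsto_intros vm)
    then have "(\<lambda>m. f m (v m $ i / v m $ k)) \<longlonglongrightarrow> g (w $ i / w $ k)" by (rule convex_converge_at[OF f lim])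
    then have "(\<lambda>m. v m $ k * f m (v m $ i / v m $ k)) \<longlonglongrightarrow> w $ k * g (w $ i / w $ k)" by (intro tendsto_intros vm)
    then have "w $ k * g (w $ i / w $ k) \<le> w $ j"
      by (rule LIMSEQ_le[OF _ vm]) (use pos in \<open>auto simp: less_imp_le\<close>)
    with False wk rest show ?thesis by (simp add: ccone_def)
  next
    case True
    have slope: "L * \<bar>w $ i\<bar> \<le> w $ j" if L: "0 < L" for L
    proof -
      \<comment> \<open>The surplus \<open>1 + \<bar>g 0\<bar>\<close> makes the inequalities at
        \<open>s\<close> and \<open>- s\<close> strict, so they persist for \<open>f m\<close> with
        \<open>m\<close> large.\<close>
      obtain r where r: "0 < r" "\<And>x. r \<le> \<bar>x\<bar> \<Longrightarrow> (L + 1 + \<bar>g 0\<bar>) * \<bar>x\<bar> \<le> g x"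
        using g unfolding superlinear_def by blast
      define s where "s = max r 1"
      have s: "1 \<le> s" "(L + 1 + \<bar>g 0\<bar>) * s \<le> g s" "(L + 1 + \<bar>g 0\<bar>) * s \<le> g (- s)"
        using r(1) r(2)[of s] r(2)[of "- s"] by (auto simp: s_def)
      have "\<bar>g 0\<bar> * 1 \<le> \<bar>g 0\<bar> * s" using s by (intro mult_left_mono) auto
      then have gs: "L * s + g 0 < g s" "L * s + g 0 < g (- s)"
        using s by (auto simp: algebra_simps)
      define B where "B h = L * s + \<bar>h 0\<bar> + \<bar>h s - h 0\<bar> + \<bar>h (- s) - h 0\<bar>" for h :: "real \<Rightarrow> real"
      have "(\<lambda>m. f m s - f m 0) \<longlonglongrightarrow> g s - g 0" "(\<lambda>m. f m (- s) - f m 0) \<longlonglongrightarrow> g (- s) - g 0"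
        by (intro tendsto_intros lim)+
      then have "\<forall>\<^sub>F m in sequentially. L * s < f m s - f m 0 \<and> L * s < f m (- s) - f m 0"
        using gs by (intro eventually_conj order_tendstoD(1)) auto
      then have ev: "\<forall>\<^sub>F m in sequentially. L * \<bar>v m $ i\<bar> - B (f m) * v m $ k \<le> v m $ j"
      proof eventually_elim
        case (elim m)
        have "L * \<bar>v m $ i / v m $ k\<bar> - B (f m) \<le> f m (v m $ i / v m $ k)"
          unfolding B_def by (rule convex_linear_lower_bound[OF f]) (use elim s L in auto)
        then have "v m $ k * (L * \<bar>v m $ i / v m $ k\<bar> - B (f m)) \<le> v m $ k * f m (v m $ i / v m $ k)"
          using pos(1)[of m] by (intro mult_left_mono) auto
        also have "\<dots> \<le> v m $ j" using pos(2)[of m] by simp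
        finally show ?case using pos(1)[of m] by (simp add: abs_divide right_diff_distrib mult.commute)
      qed
      have "(\<lambda>m. B (f m)) \<longlonglongrightarrow> B g" unfolding B_def by (intro tendsto_intros lim)
      then have "(\<lambda>m. L * \<bar>v m $ i\<bar> - B (f m) * v m $ k) \<longlonglongrightarrow> L * \<bar>w $ i\<bar> - B g * w $ k"
        by (intro tendsto_intros vm)
      from tendsto_le[OF _ vm this ev] show ?thesis using True by simp
    qed
    have "w $ i = 0"
    proof (rule ccontr)
      assume "w $ i \<noteq> 0"
      then have "(\<bar>w $ j\<bar> + 1) / \<bar>w $ i\<bar> * \<bar>w $ i\<bar> \<le> w $ j" by (intro slope) auto
      then show False using \<open>w $ i \<noteq> 0\<close> by simp
    qed
    moreover from this slope[of 1] have "0 \<le> w $ j" by simp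
    ultimately show ?thesis using True rest by (simp add: ccone_def)
  qed
qed

lemma closure_ocone:
  assumes f: "convex_on UNIV f" "superlinear f"
  shows "closure (ocone f) = ccone f"
proof
  show "closure (ocone f) \<subseteq> ccone f"
  proof
    fix w assume "w \<in> closure (ocone f)"
    then obtain v where "\<And>m. v m \<in> ocone f" "v \<longlonglongrightarrow> w" unfolding closure_sequential by blast
    then show "w \<in> ccone f" by (intro ocone_limit[of "\<lambda>m. f" f v w] f) auto
  qed
qed (rule closure_ocone_supset[OF f(1)])

text \<open>An open convex set is the interior of its closure, so limits known only in the closed
  cone can be brought back to the open one.\<close>

lemma open_subset_ccone:
  assumes f: "convex_on UNIV f" "superlinear f" and S: "open S" "S \<subseteq> ccone f"
  shows "S \<subseteq> ocone f"
proof -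
  have "S \<subseteq> interior (closure (ocone f))"
    unfolding closure_ocone[OF f] using S by (simp add: interior_maximal)
  then show ?thesis
    using convex_interior_closure[OF convex_ocone[OF f(1)]] interior_open[OF open_ocone[OF f(1)]] by simp
qed

section \<open>Uniform bounds for cones and the normalizing linear maps\<close>

text \<open>The coefficients dominate the sum of the absolute values of the coordinates. The
  ordinate may be negative but is at least \<open>- (B / A) * v $ k\<close>, which explains the term
  \<open>2 * B / A\<close>.\<close>

definition height :: "real \<Rightarrow> real \<Rightarrow> real ^ 'n" where
  "height A B = (\<chi> m. if m = i then 0 else if m = j then A + 1 else if m = k then B + 2 * B / A + 1 else 1)"

lemma norm_le_height:
  assumes AB: "0 < A" "0 \<le> B" "\<And>x. \<bar>x\<bar> \<le> A * f x + B" and v: "v \<in> ocone f"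
  shows "norm v \<le> height A B \<bullet> v"
proof -
  have z: "0 < v $ k" and y: "v $ k * f (v $ i / v $ k) < v $ j" and rest: "\<And>m. m \<in> - {i, j, k} \<Longrightarrow> 0 < v $ m"
    using v by (auto simp: ocone_def)
  have "\<bar>v $ i\<bar> = v $ k * \<bar>v $ i / v $ k\<bar>" using z by (simp add: abs_divide)
  also have "\<dots> \<le> v $ k * (A * f (v $ i / v $ k) + B)" by (rule mult_left_mono[OF AB(3)]) (use z in simp)
  also have "\<dots> = A * (v $ k * f (v $ i / v $ k)) + B * v $ k" by (simp add: algebra_simps)
  also have "\<dots> \<le> A * v $ j + B * v $ k" using y AB(1) by simp
  finally have x: "\<bar>v $ i\<bar> \<le> A * v $ j + B * v $ k" .
  then have "0 \<le> A * (v $ j + B / A * v $ k)" using AB(1) by (simp add: distrib_left)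
  then have "0 \<le> v $ j + B / A * v $ k" using AB(1) by (simp add: zero_le_mult_iff)
  moreover have "0 \<le> B / A * v $ k" using AB z by simp
  ultimately have yy: "\<bar>v $ j\<bar> \<le> v $ j + 2 * (B / A * v $ k)" by linarith
  have "norm v \<le> (\<Sum>m\<in>UNIV. \<bar>v $ m\<bar>)" by (rule norm_le_l1_cart)
  also have "\<dots> = \<bar>v $ i\<bar> + \<bar>v $ j\<bar> + \<bar>v $ k\<bar> + (\<Sum>m\<in>- {i, j, k}. \<bar>v $ m\<bar>)"
    by (rule sum_three[OF distinct])
  also have "(\<Sum>m\<in>- {i, j, k}. \<bar>v $ m\<bar>) = (\<Sum>m\<in>- {i, j, k}. v $ m)"
    using rest by (intro sum.cong refl) (simp add: less_imp_le)
  also have "\<bar>v $ i\<bar> + \<bar>v $ j\<bar> + \<bar>v $ k\<bar> + (\<Sum>m\<in>- {i, j, k}. v $ m) \<le>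
      (A + 1) * v $ j + (B + 2 * B / A + 1) * v $ k + (\<Sum>m\<in>- {i, j, k}. v $ m)"
    using x yy z by (simp add: algebra_simps)
  also have "\<dots> = height A B \<bullet> v"
  proof -
    have "height A B \<bullet> v = (\<Sum>m\<in>UNIV. height A B $ m * v $ m)" by (simp add: inner_vec_def)
    also have "\<dots> = height A B $ i * v $ i + height A B $ j * v $ j + height A B $ k * v $ k
        + (\<Sum>m\<in>- {i, j, k}. height A B $ m * v $ m)"
      by (rule sum_three[OF distinct])
    also have "(\<Sum>m\<in>- {i, j, k}. height A B $ m * v $ m) = (\<Sum>m\<in>- {i, j, k}. v $ m)"
      by (intro sum.cong refl) (auto simp: height_def)
    finally show ?thesis using distinct by (simp add: height_def)
  qed
  finally show ?thesis .
qed

lemma superlinear_linear_bound: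
  assumes f: "convex_on UNIV f" "superlinear f"
  obtains B where "0 \<le> B" "\<And>x. \<bar>x\<bar> \<le> 1 * f x + B"
proof -
  obtain r where r: "0 < r" "\<And>x. r \<le> \<bar>x\<bar> \<Longrightarrow> (1 + \<bar>f 0\<bar>) * \<bar>x\<bar> \<le> f x"
    using f(2) unfolding superlinear_def by blast
  define s where "s = max r 1"
  have s: "1 \<le> s" "(1 + \<bar>f 0\<bar>) * s \<le> f s" "(1 + \<bar>f 0\<bar>) * s \<le> f (- s)"
    using r(1) r(2)[of s] r(2)[of "- s"] by (auto simp: s_def)
  have "\<bar>f 0\<bar> * 1 \<le> \<bar>f 0\<bar> * s" using s by (intro mult_left_mono) auto
  then have "1 * s \<le> f s - f 0" "1 * s \<le> f (- s) - f 0" using s by (auto simp: algebra_simps)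
  then have "\<bar>x\<bar> - (s + \<bar>f 0\<bar> + \<bar>f s - f 0\<bar> + \<bar>f (- s) - f 0\<bar>) \<le> f x" for x
    using convex_linear_lower_bound[OF f(1), of s 1 x] s by simp
  then have "\<bar>x\<bar> \<le> 1 * f x + (s + \<bar>f 0\<bar> + \<bar>f s - f 0\<bar> + \<bar>f (- s) - f 0\<bar>)" for x by (smt (verit))
  then show ?thesis using s by (intro that[of "s + \<bar>f 0\<bar> + \<bar>f s - f 0\<bar> + \<bar>f (- s) - f 0\<bar>"]) auto
qed

text \<open>A normalized convex function is at most the absolute value on \<open>[- 1, 1]\<close>.
  The radius does not depend on \<open>f\<close>, which is the source of all uniform bounds.\<close>

lemma base_ball:
  assumes f: "convex_on UNIV f" "normalized f" and v: "norm v \<le> 1 / 4"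
  shows "base + v \<in> ocone f"
proof -
  have vm: "\<bar>v $ m\<bar> \<le> 1 / 4" for m using component_le_norm_cart[of v m] v by linarith
  have f1: "f x \<le> \<bar>x\<bar>" if "\<bar>x\<bar> \<le> 1" for x
  proof -
    have n: "f 0 = 0" "f 1 \<le> 1" "f (- 1) \<le> 1" using f(2) by (auto simp: normalized_def max_def split: if_splits)
    have "f ((1 - \<bar>x\<bar>) *\<^sub>R 0 + \<bar>x\<bar> *\<^sub>R sgn x) \<le> (1 - \<bar>x\<bar>) * f 0 + \<bar>x\<bar> * f (sgn x)"
      by (rule convex_onD[OF f(1)]) (use that in auto)
    also have "\<dots> \<le> \<bar>x\<bar> * 1" using n by (auto simp: sgn_if)
    finally show ?thesis by (simp add: abs_mult_sgn)
  qed
  let ?z = "1 + v $ k"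
  have z: "3 / 4 \<le> ?z" using vm[of k] by linarith
  have "\<bar>v $ i / ?z\<bar> \<le> 1" using vm[of i] z by (simp add: abs_divide)
  then have "f (v $ i / ?z) \<le> \<bar>v $ i\<bar> / ?z" using f1[of "v $ i / ?z"] z by (simp add: abs_divide)
  then have "?z * f (v $ i / ?z) \<le> ?z * (\<bar>v $ i\<bar> / ?z)" using z by (intro mult_left_mono) auto
  also have "\<dots> = \<bar>v $ i\<bar>" using z by simp
  also have "\<dots> < 1 + v $ j" using vm[of i] vm[of j] by linarith
  finally have "?z * f (v $ i / ?z) < 1 + v $ j" .
  moreover have "0 < 1 + v $ m" for m using vm[of m] by linarith
  ultimately show ?thesis using z by (simp add: ocone_def)
qed

text \<open>In the chart it is \<open>x -> l * x + t\<close>,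
  \<open>y -> (y - b * x - c) / a\<close>, which carries the epigraph of
  \<open>affine_change a l t b c f\<close> to that of \<open>f\<close>; \<open>s\<close> rescales
  the three coordinates together and \<open>\<rho>\<close> acts on the orthant.\<close>

definition cmap :: "real \<Rightarrow> real \<Rightarrow> real \<Rightarrow> real \<Rightarrow> real \<Rightarrow> real \<Rightarrow> ('n \<Rightarrow> real) \<Rightarrow> real ^ 'n \<Rightarrow> real ^ 'n" where
  "cmap s a l t b c \<rho> v = (\<chi> m. if m = i then s * (l * v $ i + t * v $ k)
     else if m = j then s * ((v $ j - b * v $ i - c * v $ k) / a)
     else if m = k then s * v $ k else \<rho> m * v $ m)"

lemma cmap_linear: "linear (cmap s a l t b c \<rho>)"
  by (rule linearI) (simp_all add: cmap_def vec_eq_iff algebra_simps add_divide_distrib diff_divide_distrib)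

lemma cmap_bij:
  assumes "0 < s" "0 < a" "0 < l" "\<And>m. 0 < \<rho> m"
  shows "bij (cmap s a l t b c \<rho>)"
proof -
  have "v = 0" if "cmap s a l t b c \<rho> v = 0" for v
  proof -
    have eq: "cmap s a l t b c \<rho> v $ m = 0" for m using that by simp
    have "v $ k = 0" using eq[of k] distinct assms by (simp add: cmap_def)
    moreover from this have "v $ i = 0" using eq[of i] assms by (simp add: cmap_def)
    moreover from calculation have "v $ j = 0" using eq[of j] distinct assms by (simp add: cmap_def)
    moreover have "v $ m = 0" if "m \<notin> {i, j, k}" for m
      using eq[of m] that assms(4)[of m] by (simp add: cmap_def)
    ultimately show "v = 0" unfolding vec_eq_iff by (metis empty_iff insert_iff zero_index)
  qed
  then have "inj (cmap s a l t b c \<rho>)" using linear_injective_0[OF cmap_linear] by blast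
  then show ?thesis using linear_injective_imp_surjective[OF cmap_linear] by (simp add: bij_def)
qed

lemma cmap_ocone:
  assumes p: "0 < s" "0 < a" "0 < l" "\<And>m. 0 < \<rho> m"
  shows "cmap s a l t b c \<rho> v \<in> ocone f \<longleftrightarrow> v \<in> ocone (affine_change a l t b c f)"
proof (cases "0 < v $ k")
  case True
  have pos: "0 < r * x \<longleftrightarrow> 0 < x" if "0 < r" for r x :: real
    using that by (simp add: zero_less_mult_iff)
  have "(s * (l * v $ i + t * v $ k)) / (s * v $ k) = l * (v $ i / v $ k) + t"
    using p True by (simp add: add_divide_distrib)
  moreover have "s * v $ k * F < s * ((v $ j - b * v $ i - c * v $ k) / a) \<longleftrightarrow>
      v $ k * (a * F + b * (v $ i / v $ k) + c) < v $ j" for F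
  proof -
    have "s * v $ k * F < s * ((v $ j - b * v $ i - c * v $ k) / a) \<longleftrightarrow> v $ k * F < (v $ j - b * v $ i - c * v $ k) / a"
      using p(1) by (simp only: mult.assoc mult_less_cancel_left_pos)
    also have "\<dots> \<longleftrightarrow> v $ k * F * a < v $ j - b * v $ i - c * v $ k" using p(2) by (rule pos_less_divide_eq)
    also have "\<dots> \<longleftrightarrow> v $ k * (a * F + b * (v $ i / v $ k) + c) < v $ j"
      using True by (simp add: distrib_left) (simp add: algebra_simps)
    finally show ?thesis .
  qed
  ultimately show ?thesis
    using distinct p True pos(1)[OF p(1)] pos(1)[OF p(4)] by (auto simp: ocone_def cmap_def affine_change_def)
next
  case False
  then show ?thesis using distinct p by (simp add: ocone_def cmap_def zero_less_mult_iff)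
qed

lemma ocone_affine_change:
  assumes "0 < a" "0 < l"
  obtains T where "linear T" "bij T" "T ` ocone (affine_change a l t b c f) = ocone f"
proof -
  let ?T = "cmap 1 a l t b c (\<lambda>m. 1)"
  have b: "bij ?T" by (rule cmap_bij) (use assms in auto)
  have "?T ` ocone (affine_change a l t b c f) = ocone f"
  proof
    show "?T ` ocone (affine_change a l t b c f) \<subseteq> ocone f" using cmap_ocone[of 1 a l "\<lambda>m. 1"] assms by auto
    show "ocone f \<subseteq> ?T ` ocone (affine_change a l t b c f)"
    proof
      fix w assume w: "w \<in> ocone f"
      obtain v where "w = ?T v" using b by (metis bij_pointE)
      with w cmap_ocone[of 1 a l "\<lambda>m. 1" t b c v f] assms show "w \<in> ?T ` ocone (affine_change a l t b c f)" by auto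
    qed
  qed
  then show ?thesis using that[OF cmap_linear b] by blast
qed

text \<open>The epigraph coordinates are handled by \<open>normalize\<close> at the chart point of
  \<open>u\<close>, the orthant by a diagonal factor. Thus every point of the cone can serve as base
  point.\<close>

lemma ocone_normalize:
  assumes f: "balanced C f" and u: "u \<in> ocone f"
  obtains T a l t b c where "linear T" "bij T" "T base = u" "0 < a" "0 < l"
    "normalized (affine_change a l t b c f)" "\<And>v. T v \<in> ocone f \<longleftrightarrow> v \<in> ocone (affine_change a l t b c f)"
proof -
  have z: "0 < u $ k" and y: "u $ k * f (u $ i / u $ k) < u $ j" and rest: "\<And>m. m \<notin> {i, j, k} \<Longrightarrow> 0 < u $ m"
    using u by (auto simp: ocone_def)
  define x0 y0 where "x0 = u $ i / u $ k" and "y0 = u $ j / u $ k"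
  have xy: "f x0 < y0" using y z by (simp add: x0_def y0_def pos_less_divide_eq mult.commute)
  define e where "e = y0 - f x0"
  have e: "0 < e" using xy by (simp add: e_def)
  obtain l b where l: "0 < l" "normalized (affine_change (1 / e) l x0 b (- f x0 / e) f)"
    by (rule normalize[OF f xy, folded e_def]) (rule that)
  define \<rho> where "\<rho> m = (if m \<in> {i, j, k} then 1 else u $ m)" for m
  have \<rho>: "0 < \<rho> m" for m using rest[of m] by (auto simp: \<rho>_def)
  let ?T = "cmap (u $ k) (1 / e) l x0 b (- f x0 / e) \<rho>"
  have "?T base $ m = u $ m" for m
  proof -
    have "u $ k * ((1 - - f x0 / e) / (1 / e)) = u $ j" using e z by (simp add: field_simps) (simp add: e_def y0_def field_simps)
    then show ?thesis using z distinct by (auto simp: cmap_def \<rho>_def x0_def)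
  qed
  then have "?T base = u" by (simp add: vec_eq_iff)
  then show ?thesis
    using e l z \<rho> by (intro that[of ?T "1 / e" l x0 b "- f x0 / e"] cmap_linear cmap_bij cmap_ocone) auto
qed

definition epi_domain :: "(real \<Rightarrow> real) \<Rightarrow> (real ^ 'n) proj_space set" where
  "epi_domain f = homog ` ocone f"

lemma epi_domain_affine_change:
  assumes "0 < a" "0 < l"
  shows "projective_class (epi_domain (affine_change a l t b c f)) = projective_class (epi_domain f)"
proof -
  obtain T where T: "linear T" "bij T" "T ` ocone (affine_change a l t b c f) = ocone f"
    using ocone_affine_change[OF assms] by metis
  have "epi_domain f \<in> projective_class (epi_domain (affine_change a l t b c f))"
    unfolding epi_domain_def mem_projective_class_homog[OF zero_notin_ocone] using T by metis
  then show ?thesis by (rule projective_class_eqI[symmetric])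
qed

end

lemma open_homog_image:
  assumes S: "open S" "0 \<notin> S"
  shows "open (homog ` S)"
proof -
  have "{v. v \<noteq> 0 \<and> homog v \<in> homog ` S} = (\<Union>c\<in>- {0}. (\<lambda>v. c *\<^sub>R v) ` S)"
  proof safe
    fix v w :: 'a assume v: "v \<noteq> 0" and w: "w \<in> S" "homog v = homog w"
    then have "w \<noteq> 0" using S by blast
    then obtain c where "c \<noteq> 0" "v = c *\<^sub>R w" using homog_eq_iff[of w v] v w by auto
    with w show "v \<in> (\<Union>c\<in>- {0}. (\<lambda>v. c *\<^sub>R v) ` S)" by auto
  next
    fix c :: real and v assume "v \<in> S" "c \<noteq> 0"
    with S show "homog (c *\<^sub>R v) \<in> homog ` S" by (metis homog_scaleR imageI)
  qed (use S in auto)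
  moreover have "open (\<Union>c\<in>- {0}. (\<lambda>v. c *\<^sub>R v) ` S)"
    by (intro open_UN ballI open_scaling S) auto
  ultimately show ?thesis by (simp add: open_proj_space_def)
qed

text \<open>For unit lifts the last hypothesis reads \<open>1 \<le> a \<bullet> v\<close>, a closed
  condition, so limit points stay off the hyperplane of \<open>a\<close>.\<close>

lemma homog_cone_pcd:
  assumes S: "open S" "S \<noteq> {}" "convex S" and a: "a \<noteq> 0" "\<And>v. v \<in> S \<Longrightarrow> v \<noteq> 0" "\<And>v. v \<in> S \<Longrightarrow> norm v \<le> a \<bullet> v"
  shows "homog ` S \<in> properly_convex_domains"
proof -
  have 0: "0 \<notin> S" using a(2) by blast
  have "connected (homog ` S)"
    by (rule connected_continuous_image[OF _ convex_connected[OF S(3)]])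
      (use 0 in \<open>auto intro: continuous_on_subset[OF continuous_on_homog]\<close>)
  then have 1: "proj_domain (homog ` S)" using S open_homog_image[OF S(1) 0] by (simp add: proj_domain_def)
  have 2: "proj_convex (homog ` S)"
    unfolding proj_convex_def
  proof (intro ballI)
    fix p q assume "p \<in> homog ` S" "q \<in> homog ` S"
    then obtain u v where uv: "u \<in> S" "v \<in> S" "p = homog u" "q = homog v" by blast
    have seg: "closed_segment u v \<subseteq> S" by (rule closed_segment_subset[OF uv(1,2) S(3)])
    have "proj_segment (homog ` closed_segment u v) p q"
      unfolding proj_segment_def using uv seg 0 by (intro exI[of _ u] exI[of _ v]) auto
    then show "\<exists>T. proj_segment T p q \<and> T \<subseteq> homog ` S" using seg by blast
  qed
  have "q \<in> {homog v | v. a \<bullet> v \<noteq> 0}" if q: "q \<in> closure (homog ` S)" for q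
  proof -
    obtain p where p: "\<And>n. p n \<in> homog ` S" "p \<longlonglongrightarrow> q" using q unfolding closure_sequential by blast
    then have "\<forall>n. \<exists>v. v \<in> S \<and> p n = homog v" by blast
    then obtain v where v: "\<And>n. v n \<in> S" "\<And>n. p n = homog (v n)" by metis
    define u where "u n = sgn (v n)" for n
    have u: "norm (u n) = 1" "p n = homog (u n)" for n
      using a(2)[OF v(1)[of n]] v(2)[of n] by (simp_all add: u_def norm_sgn homog_unit)
    have u1: "1 \<le> a \<bullet> u n" for n
      using a(2)[OF v(1)[of n]] a(3)[OF v(1)[of n]] by (simp add: u_def sgn_div_norm field_simps)
    obtain w r where w: "norm w = 1" "strict_mono r" "(\<lambda>n. u (r n)) \<longlonglongrightarrow> w"
      by (rule unit_convergent_subsequence[OF u(1)]) (rule that)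
    have "w \<noteq> 0" using w(1) by auto
    then have "(\<lambda>n. homog (u (r n))) \<longlonglongrightarrow> homog w" by (rule homog_tendsto[OF w(3)])
    moreover have "(\<lambda>n. homog (u (r n))) \<longlonglongrightarrow> q" using LIMSEQ_subseq_LIMSEQ[OF p(2) w(2)] by (simp add: o_def u(2))
    ultimately have "q = homog w" by (rule LIMSEQ_unique[symmetric])
    moreover have "1 \<le> a \<bullet> w" by (rule LIMSEQ_le_const[OF tendsto_inner[OF tendsto_const w(3)]]) (use u1 in auto)
    ultimately show ?thesis by force
  qed
  then have "closure (homog ` S) \<subseteq> {homog v | v. a \<bullet> v \<noteq> 0}" by blast
  then show ?thesis unfolding properly_convex_domains_def affine_chart_def using 1 2 a(1) by blast
qed

context three_coordinates
begin

lemma epi_domain_pcd: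
  assumes f: "convex_on UNIV f" "superlinear f"
  shows "epi_domain f \<in> properly_convex_domains"
proof -
  obtain B where B: "0 \<le> B" "\<And>x. \<bar>x\<bar> \<le> 1 * f x + B" using superlinear_linear_bound[OF f] by metis
  have "height 1 B $ j = 2" using distinct by (simp add: height_def)
  then have "height 1 B \<noteq> 0" by auto
  then show ?thesis
    unfolding epi_domain_def
    by (rule homog_cone_pcd[OF open_ocone[OF f(1)] ocone_nonempty convex_ocone[OF f(1)]])
      (use zero_notin_ocone norm_le_height[OF _ B] in auto)
qed

text \<open>A point of the limit cone is reached because its condition involves a single value of
  the function; limit points are caught by \<open>ocone_limit\<close> after scaling the lifts to
  unit length.\<close>

lemma epi_domain_converges:
  assumes f: "\<And>m. convex_on UNIV (f m)" and lim: "\<And>x. (\<lambda>m. f m x) \<longlonglongrightarrow> g x"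
    and g: "superlinear g"
  shows "(\<lambda>m. hausdorff_dist (closure (epi_domain (f m))) (closure (epi_domain g))) \<longlonglongrightarrow> 0"
proof (rule hausdorff_tendstoI)
  show "epi_domain (f m) \<noteq> {}" "epi_domain g \<noteq> {}" for m using ocone_nonempty by (auto simp: epi_domain_def)
  fix p assume "p \<in> epi_domain g"
  then obtain v where v: "v \<in> ocone g" "p = homog v" by (auto simp: epi_domain_def)
  have "(\<lambda>m. v $ k * f m (v $ i / v $ k)) \<longlonglongrightarrow> v $ k * g (v $ i / v $ k)" by (intro tendsto_intros lim)
  then have "\<forall>\<^sub>F m in sequentially. v $ k * f m (v $ i / v $ k) < v $ j"
    by (rule order_tendstoD) (use v in \<open>simp add: ocone_def\<close>)
  then show "\<forall>\<^sub>F m in sequentially. p \<in> epi_domain (f m)"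
    by eventually_elim (use v in \<open>auto simp: ocone_def epi_domain_def\<close>)
next
  fix r :: "nat \<Rightarrow> nat" and p q
  assume r: "strict_mono r" and p: "\<And>m. p m \<in> epi_domain (f (r m))" "p \<longlonglongrightarrow> q"
  have cg: "convex_on UNIV g" by (rule convex_on_limit[OF f lim])
  have "\<forall>m. \<exists>v. v \<in> ocone (f (r m)) \<and> p m = homog v" using p(1) by (auto simp: epi_domain_def)
  then obtain v where v: "\<And>m. v m \<in> ocone (f (r m))" "\<And>m. p m = homog (v m)" by metis
  have v0: "v m \<noteq> 0" for m using v(1)[of m] zero_notin_ocone by metis
  define u where "u m = sgn (v m)" for m
  have u: "norm (u m) = 1" "p m = homog (u m)" for m
    using v0[of m] v(2)[of m] by (auto simp: u_def norm_sgn homog_unit)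
  have uo: "u m \<in> ocone (f (r m))" for m
    unfolding u_def sgn_div_norm by (rule ocone_scale[OF v(1)]) (use v0 in simp)
  obtain w s where w: "norm w = 1" "strict_mono s" "(\<lambda>m. u (s m)) \<longlonglongrightarrow> w"
    by (rule unit_convergent_subsequence[OF u(1)]) (rule that)
  have w0: "w \<noteq> 0" using w(1) by auto
  then have "(\<lambda>m. homog (u (s m))) \<longlonglongrightarrow> homog w" by (rule homog_tendsto[OF w(3)])
  moreover have "(\<lambda>m. homog (u (s m))) \<longlonglongrightarrow> q" using LIMSEQ_subseq_LIMSEQ[OF p(2) w(2)] by (simp add: o_def u(2))
  ultimately have q: "q = homog w" by (rule LIMSEQ_unique[symmetric])
  have lim': "(\<lambda>m. f (r (s m)) x) \<longlonglongrightarrow> g x" for x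
    using LIMSEQ_subseq_LIMSEQ[OF lim strict_mono_o[OF r w(2)]] by (simp add: o_def)
  have "w \<in> ccone g" by (rule ocone_limit[OF _ lim' g _ w(3)]) (use f uo in auto)
  then have "w \<in> closure (ocone g)" using closure_ocone[OF cg g] by simp
  then obtain x where x: "\<And>m. x m \<in> ocone g" "x \<longlonglongrightarrow> w" unfolding closure_sequential by blast
  have "(\<lambda>m. homog (x m)) \<longlonglongrightarrow> homog w" by (rule homog_tendsto[OF x(2) w0])
  then show "q \<in> closure (epi_domain g)"
    unfolding q closure_sequential by (intro exI[of _ "\<lambda>m. homog (x m)"]) (simp add: epi_domain_def x)
qed

end

section \<open>Limits of projective images of cones\<close>

text \<open>Unit lifts of the closure form a compact set on which \<open>a\<close> does not vanish.
  The resulting \<open>c\<close> is stable under small Hausdorff perturbations.\<close>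

lemma chart_lower_bound:
  fixes a :: "'a::euclidean_space"
  assumes sub: "closure \<Omega> \<subseteq> {homog v | v. a \<bullet> v \<noteq> 0}" and ne: "\<Omega> \<noteq> {}"
  obtains c where "0 < c" "\<And>v. v \<noteq> 0 \<Longrightarrow> homog v \<in> closure \<Omega> \<Longrightarrow> c * norm v \<le> \<bar>a \<bullet> v\<bar>"
proof -
  have nz: "a \<bullet> v \<noteq> 0" if hv: "v \<noteq> 0" "homog v \<in> closure \<Omega>" for v
  proof -
    obtain w where w: "homog v = homog w" "a \<bullet> w \<noteq> 0" using sub hv by blast
    then have "w \<noteq> 0" by auto
    then obtain d where "w = d *\<^sub>R v" using homog_eq_iff[of v w] w hv by auto
    with w show ?thesis by auto
  qed
  let ?S = "sphere 0 1 \<inter> homog -` closure \<Omega>"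
  have "continuous_on (sphere 0 1) (homog :: 'a \<Rightarrow> _)"
    by (rule continuous_on_subset[OF continuous_on_homog]) auto
  then have "closed ?S" by (rule continuous_closed_preimage) auto
  then have "compact (sphere 0 1 \<inter> ?S)" by (rule compact_Int_closed[OF compact_sphere])
  then have "compact ?S" by (simp add: Int_assoc[symmetric])
  moreover have "?S \<noteq> {}"
  proof -
    obtain p where p: "p \<in> \<Omega>" using ne by blast
    obtain v where "norm v = 1" "p = homog v" by (rule homog_cases)
    then have "v \<in> ?S" using p closure_subset by auto
    then show ?thesis by blast
  qed
  moreover have "continuous_on ?S (\<lambda>v. \<bar>a \<bullet> v\<bar>)" by (intro continuous_intros)
  ultimately have "\<exists>v0\<in>?S. \<forall>v\<in>?S. \<bar>a \<bullet> v0\<bar> \<le> \<bar>a \<bullet> v\<bar>"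
    by (rule continuous_attains_inf)
  then obtain v0 where v0: "v0 \<in> ?S" "\<forall>v\<in>?S. \<bar>a \<bullet> v0\<bar> \<le> \<bar>a \<bullet> v\<bar>" by (rule bexE)
  show ?thesis
  proof (rule that[of "\<bar>a \<bullet> v0\<bar>"])
    show "0 < \<bar>a \<bullet> v0\<bar>"
    proof -
      have "v0 \<noteq> 0" using v0(1) by auto
      then show ?thesis using v0(1) nz[of v0] by simp
    qed
    fix v :: 'a assume v: "v \<noteq> 0" "homog v \<in> closure \<Omega>"
    then have "sgn v \<in> ?S" by (simp add: norm_sgn homog_unit)
    then have "\<bar>a \<bullet> v0\<bar> \<le> \<bar>a \<bullet> sgn v\<bar>" by (rule v0(2)[rule_format])
    also have "\<dots> = \<bar>a \<bullet> v\<bar> / norm v" by (simp add: sgn_div_norm abs_mult divide_inverse mult.commute)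
    finally show "\<bar>a \<bullet> v0\<bar> * norm v \<le> \<bar>a \<bullet> v\<bar>" using v by (simp add: pos_le_divide_eq)
  qed
qed

text \<open>A unit lift of a point of \<open>closure A\<close> is within \<open>d\<close> of a unit
  lift for \<open>\<Omega>\<close> up to sign, so at most \<open>norm a * d\<close> is lost.\<close>

lemma chart_lower_bound_near:
  fixes a :: "'a::euclidean_space"
  assumes c: "\<And>v. v \<noteq> 0 \<Longrightarrow> homog v \<in> closure \<Omega> \<Longrightarrow> c * norm v \<le> \<bar>a \<bullet> v\<bar>"
    and ne: "A \<noteq> {}" "\<Omega> \<noteq> {}" and d: "hausdorff_dist (closure A) (closure \<Omega>) < d" "norm a * d \<le> c / 2"
    and v: "v \<noteq> 0" "homog v \<in> closure A"
  shows "c / 2 * norm v \<le> \<bar>a \<bullet> v\<bar>"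
proof -
  let ?u = "sgn v"
  have u: "norm ?u = 1" "homog ?u = homog v" using v by (auto simp: norm_sgn homog_unit)
  obtain b where b: "b \<in> \<Omega>" "dist (homog v) b < d" by (rule hausdorff_near[OF d(1) ne v(2)])
  obtain w where w: "w \<noteq> 0" "norm w = 1" "b = homog w" by (rule homog_cases)
  have cw: "c \<le> \<bar>a \<bullet> w\<bar>" using c[OF w(1)] b(1) w(2,3) closure_subset by fastforce
  have "norm (?u - w) < d \<or> norm (?u + w) < d"
    using b(2) unfolding w(3) u(2)[symmetric] dist_homog_unit[OF u(1) w(2)] by (simp add: min_less_iff_disj)
  then have "\<bar>a \<bullet> (?u - w)\<bar> \<le> c / 2 \<or> \<bar>a \<bullet> (?u + w)\<bar> \<le> c / 2"
  proof (elim disj_forward)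
    have *: "\<bar>a \<bullet> z\<bar> \<le> c / 2" if "norm z < d" for z
    proof -
      have "\<bar>a \<bullet> z\<bar> \<le> norm a * norm z" by (rule Cauchy_Schwarz_ineq2)
      also have "\<dots> \<le> norm a * d" using that by (intro mult_left_mono) auto
      finally show ?thesis using d(2) by simp
    qed
    show "\<bar>a \<bullet> (?u - w)\<bar> \<le> c / 2" if "norm (?u - w) < d" by (rule *[OF that])
    show "\<bar>a \<bullet> (?u + w)\<bar> \<le> c / 2" if "norm (?u + w) < d" by (rule *[OF that])
  qed
  then have "c / 2 \<le> \<bar>a \<bullet> ?u\<bar>" using cw unfolding inner_diff_right inner_add_right by linarith
  also have "\<dots> = \<bar>a \<bullet> v\<bar> / norm v" by (simp add: sgn_div_norm abs_mult divide_inverse mult.commute)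
  finally show ?thesis using v by (simp add: pos_le_divide_eq)
qed

lemma convex_inner_sign:
  fixes a :: "'a::euclidean_space"
  assumes S: "convex S" and nz: "\<And>v. v \<in> S \<Longrightarrow> a \<bullet> v \<noteq> 0"
  shows "(\<forall>v\<in>S. 0 < a \<bullet> v) \<or> (\<forall>v\<in>S. a \<bullet> v < 0)"
proof (rule ccontr)
  assume "\<not> ?thesis"
  then obtain u v where uv: "u \<in> S" "v \<in> S" "\<not> 0 < a \<bullet> u" "\<not> a \<bullet> v < 0" by blast
  define p q where "p = - (a \<bullet> u)" and "q = a \<bullet> v"
  have pq: "0 < p" "0 < q" using uv nz[OF uv(1)] nz[OF uv(2)] by (auto simp: p_def q_def)
  have "(q / (p + q)) *\<^sub>R u + (p / (p + q)) *\<^sub>R v \<in> S"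
    using pq by (intro convexD[OF S uv(1,2)]) (auto simp: add_divide_distrib[symmetric] add.commute)
  moreover have "a \<bullet> ((q / (p + q)) *\<^sub>R u + (p / (p + q)) *\<^sub>R v) = 0"
    by (simp add: inner_add_right inner_diff_right p_def q_def)
  ultimately show False using nz by blast
qed

text \<open>
  If the ball were not contained in the cone, a hyperplane would separate one of its points from the
  cone, and moving away from the hyperplane would leave the neighbourhood of the cone.
\<close>
lemma ball_in_cone:
  fixes S :: "'a::euclidean_space set"
  assumes S: "convex S" "S \<noteq> {}" "\<And>v t. v \<in> S \<Longrightarrow> 0 < t \<Longrightarrow> t *\<^sub>R v \<in> S"
    and c: "0 < c" "\<And>v. v \<in> S \<Longrightarrow> v \<noteq> 0" "\<And>v. v \<in> S \<Longrightarrow> c * norm v \<le> a \<bullet> v"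
    and z: "\<And>z. z \<in> ball v0 (2 * e) \<Longrightarrow> z \<noteq> 0 \<and> homog z \<in> \<Omega> \<and> c * norm z \<le> a \<bullet> z"
    and e: "0 < e"
    and d: "hausdorff_dist (closure (homog ` S)) (closure \<Omega>) < d" "norm a * d \<le> c" "d * (norm v0 + 2 * e) \<le> e"
  shows "ball v0 e \<subseteq> S"
proof
  fix y assume y: "y \<in> ball v0 e"
  show "y \<in> S"
  proof (rule ccontr)
    assume "y \<notin> S"
    then have "\<exists>f b. f \<noteq> 0 \<and> (\<forall>x\<in>{y}. f \<bullet> x \<le> b) \<and> (\<forall>x\<in>S. b \<le> f \<bullet> x)"
      using S(1,2) by (intro separating_hyperplane_sets) auto
    then obtain f b where f: "f \<noteq> 0" "f \<bullet> y \<le> b" "\<And>x. x \<in> S \<Longrightarrow> b \<le> f \<bullet> x"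
      by auto
    \<comment> \<open>Since \<open>S\<close> is invariant under positive scaling, the separating
      level can be taken to be 0: long multiples exclude negative values on \<open>S\<close>, short
      ones a positive value at \<open>y\<close>.\<close>
    have fS: "0 \<le> f \<bullet> x" if x: "x \<in> S" for x
    proof (rule ccontr)
      assume n: "\<not> 0 \<le> f \<bullet> x"
      have "b \<le> f \<bullet> (((\<bar>b\<bar> + 1) / - (f \<bullet> x)) *\<^sub>R x)"
        by (rule f(3)[OF S(3)[OF x]]) (use n in \<open>simp add: divide_pos_neg divide_less_0_iff\<close>)
      also have "\<dots> = - (\<bar>b\<bar> + 1)" using n by simp
      finally show False by linarith
    qed
    have fy: "f \<bullet> y \<le> 0"
    proof (rule ccontr)
      assume n: "\<not> f \<bullet> y \<le> 0"
      obtain x where x: "x \<in> S" using S by blast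
      have fx: "0 < f \<bullet> x" using f(2) f(3)[OF x] n by simp
      have "b \<le> f \<bullet> ((f \<bullet> y / (2 * (f \<bullet> x))) *\<^sub>R x)"
        by (rule f(3)[OF S(3)[OF x]]) (use n fx in simp)
      also have "\<dots> = f \<bullet> y / 2" using fx by simp
      finally show False using f(2) n by simp
    qed
    define g where "g = sgn f"
    have g: "norm g = 1" "g \<bullet> y \<le> 0" "\<And>x. x \<in> S \<Longrightarrow> 0 \<le> g \<bullet> x"
      using f(1) fy fS by (auto simp: g_def norm_sgn sgn_div_norm mult_nonneg_nonpos)
    \<comment> \<open>Pushed by \<open>e\<close> away from the half-space of the cone, the point is
      still in the larger ball and so still represents a point of \<open>\<Omega>\<close>.\<close>
    define w where "w = y - e *\<^sub>R g"
    have gg: "g \<bullet> g = 1" using g(1) by (simp add: dot_square_norm)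
    have gw: "g \<bullet> w \<le> - e" using g(2) gg by (simp add: w_def inner_diff_right)
    have "dist v0 w \<le> dist v0 y + norm (e *\<^sub>R g)"
      using norm_triangle_ineq[of "v0 - y" "e *\<^sub>R g"] by (simp add: w_def dist_norm algebra_simps)
    then have wb: "w \<in> ball v0 (2 * e)" using y g(1) e by simp
    note zw = z[OF wb]
    have nw: "norm w \<le> norm v0 + 2 * e"
      using wb norm_triangle_ineq2[of w v0] by (simp add: dist_norm norm_minus_commute)
    have w0: "0 < norm w" using zw by simp
    obtain q where q: "q \<in> homog ` S" "dist (homog w) q < d"
      by (rule hausdorff_near[of \<Omega> "homog ` S" d "homog w"])
        (use d(1) zw S(2) closure_subset in \<open>auto simp: hausdorff_dist_commute\<close>)
    then obtain x where x: "x \<in> S" "q = homog x" by blast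
    define u p where "u = sgn w" and "p = sgn x"
    have np: "norm u = 1" "norm p = 1" "homog u = homog w" "homog p = q"
      using zw c(2)[OF x(1)] x(2) by (auto simp: u_def p_def norm_sgn homog_unit)
    have au: "c \<le> a \<bullet> u" using zw w0 by (simp add: u_def sgn_div_norm field_simps)
    have ap: "c \<le> a \<bullet> p" using c(3)[OF x(1)] c(2)[OF x(1)] by (simp add: p_def sgn_div_norm field_simps)
    have gp: "0 \<le> g \<bullet> p" using g(3)[OF x(1)] by (simp add: p_def sgn_div_norm)
    have "g \<bullet> u = (g \<bullet> w) / norm w" by (simp add: u_def sgn_div_norm divide_inverse mult.commute)
    moreover have "e / norm w \<le> - (g \<bullet> w) / norm w" using gw w0 by (intro divide_right_mono) auto
    ultimately have "e / norm w \<le> - (g \<bullet> u)" by simp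
    moreover have "d \<le> e / norm w"
    proof -
      have "0 \<le> d" using d(1) hausdorff_dist_nonneg[of "closure (homog ` S)" "closure \<Omega>"] by linarith
      then have "d * norm w \<le> d * (norm v0 + 2 * e)" using nw by (intro mult_left_mono)
      then show ?thesis using d(3) w0 by (simp add: pos_le_divide_eq)
    qed
    ultimately have gu: "g \<bullet> u \<le> - d" by simp
    have "norm (u - p) < d \<or> norm (u + p) < d"
      using q(2) np dist_homog_unit[OF np(1,2)] by (simp add: min_less_iff_disj)
    then show False
    proof
      assume "norm (u - p) < d"
      moreover have "\<bar>g \<bullet> (u - p)\<bar> \<le> norm g * norm (u - p)" by (rule Cauchy_Schwarz_ineq2)
      ultimately show False using gu gp g(1) by (simp add: inner_diff_right)
    next
      \<comment> \<open>Nearly antipodal lifts are impossible because both lie on the positive side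
        of \<open>a\<close> with margin \<open>c\<close>.\<close>
      assume l: "norm (u + p) < d"
      have "2 * c \<le> \<bar>a \<bullet> (u + p)\<bar>" using au ap by (simp add: inner_add_right)
      also have "\<dots> \<le> norm a * norm (u + p)" by (rule Cauchy_Schwarz_ineq2)
      also have "\<dots> \<le> norm a * d" using l by (intro mult_left_mono) auto
      finally show False using d(2) c(1) by simp
    qed
  qed
qed

text \<open>The lift is cut out by the sign of \<open>a\<close>. Projective convexity offers one of
  two segments between the points, and the sign of \<open>a\<close> shows that it is the affine
  one.\<close>

lemma properly_convex_lift:
  fixes \<Omega> :: "'a::euclidean_space proj_space set"
  assumes O: "\<Omega> \<in> properly_convex_domains"
  obtains a c S where "0 < c" "open S" "convex S" "S \<noteq> {}" "\<Omega> = homog ` S"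
    "\<And>v. v \<in> S \<longleftrightarrow> 0 < a \<bullet> v \<and> homog v \<in> \<Omega>"
    "\<And>v. v \<noteq> 0 \<Longrightarrow> homog v \<in> closure \<Omega> \<Longrightarrow> c * norm v \<le> \<bar>a \<bullet> v\<bar>"
proof -
  obtain a where a: "closure \<Omega> \<subseteq> {homog v | v. a \<bullet> v \<noteq> 0}"
    using O unfolding properly_convex_domains_def affine_chart_def by blast
  have O': "\<Omega> \<noteq> {}" "open \<Omega>" "proj_convex \<Omega>" using O by (auto simp: properly_convex_domains_def proj_domain_def)
  obtain c where c: "0 < c" "\<And>v. v \<noteq> 0 \<Longrightarrow> homog v \<in> closure \<Omega> \<Longrightarrow> c * norm v \<le> \<bar>a \<bullet> v\<bar>"
    by (rule chart_lower_bound[OF a O'(1)]) (rule that)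
  have nz: "a \<bullet> v \<noteq> 0" if "v \<noteq> 0" "homog v \<in> \<Omega>" for v
  proof -
    have "c * norm v \<le> \<bar>a \<bullet> v\<bar>" using c(2)[OF that(1)] that(2) closure_subset by blast
    moreover have "0 < c * norm v" using c(1) that(1) by simp
    ultimately show ?thesis by auto
  qed
  define S where "S = {v. 0 < a \<bullet> v \<and> homog v \<in> \<Omega>}"
  have "S = {v. 0 < a \<bullet> v} \<inter> {v. v \<noteq> 0 \<and> homog v \<in> \<Omega>}" by (auto simp: S_def)
  moreover have "open {v. 0 < a \<bullet> v}" by (intro open_Collect_less continuous_intros)
  moreover have "open {v. v \<noteq> 0 \<and> homog v \<in> \<Omega>}" using O'(2) by (simp add: open_proj_space_def)
  ultimately have oS: "open S" by (simp add: open_Int)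
  have im: "\<Omega> = homog ` S"
  proof
    show "\<Omega> \<subseteq> homog ` S"
    proof
      fix p assume p: "p \<in> \<Omega>"
      obtain v where v: "v \<noteq> 0" "p = homog v" by (rule homog_cases)
      have "v \<in> S \<or> - v \<in> S"
        using nz[OF v(1)] p v homog_minus[OF v(1)] by (auto simp: S_def)
      then show "p \<in> homog ` S" using v homog_minus[OF v(1)] by (metis imageI)
    qed
  qed (auto simp: S_def)
  have conv: "convex S"
  proof (rule convexI)
    fix x y :: 'a and s t :: real
    assume xy: "x \<in> S" "y \<in> S" and st: "0 \<le> s" "0 \<le> t" "s + t = 1"
    have xy0: "x \<noteq> 0" "y \<noteq> 0" using xy by (auto simp: S_def)
    obtain T where T: "proj_segment T (homog x) (homog y)" "T \<subseteq> \<Omega>"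
      using O'(3) xy unfolding proj_convex_def S_def by blast
    then obtain u v where uv: "u \<noteq> 0" "v \<noteq> 0" "homog u = homog x" "homog v = homog y"
      "0 \<notin> closed_segment u v" "T = homog ` closed_segment u v"
      unfolding proj_segment_def by blast
    obtain p where p: "p \<noteq> 0" "x = p *\<^sub>R u" using homog_eq_iff[OF uv(1) xy0(1)] uv(3) by auto
    obtain q where q: "q \<noteq> 0" "y = q *\<^sub>R v" using homog_eq_iff[OF uv(2) xy0(2)] uv(4) by auto
    have seg: "w \<noteq> 0 \<and> homog w \<in> \<Omega>" if "w \<in> closed_segment u v" for w
      using uv(5,6) T(2) that by auto
    \<comment> \<open>The segment stays in \<open>\<Omega>\<close>, hence off the hyperplane;
      constancy of the sign excludes representatives of opposite orientation.\<close>
    have "(\<forall>w\<in>closed_segment u v. 0 < a \<bullet> w) \<or> (\<forall>w\<in>closed_segment u v. a \<bullet> w < 0)"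
      by (rule convex_inner_sign) (use seg nz in auto)
    then have pq: "0 < p * q"
    proof
      assume "\<forall>w\<in>closed_segment u v. 0 < a \<bullet> w"
      then have "0 < a \<bullet> u" "0 < a \<bullet> v" by auto
      then show ?thesis using xy p q by (auto simp: S_def zero_less_mult_iff)
    next
      assume "\<forall>w\<in>closed_segment u v. a \<bullet> w < 0"
      then have "a \<bullet> u < 0" "a \<bullet> v < 0" by auto
      then show ?thesis using xy p q by (auto simp: S_def zero_less_mult_iff)
    qed
    \<comment> \<open>Dividing by \<open>r\<close> turns the combination of \<open>x\<close> and
      \<open>y\<close> into a convex combination of \<open>u\<close> and \<open>v\<close>;
      \<open>r\<close> is negative when both representatives are reversed.\<close>
    define r where "r = s * p + t * q"
    have r: "r \<noteq> 0" "0 \<le> s * p / r" "0 \<le> t * q / r" "s * p / r + t * q / r = 1"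
    proof -
      have "0 < p \<and> 0 < q \<or> p < 0 \<and> q < 0" using pq by (auto simp: zero_less_mult_iff)
      then have *: "(0 < r \<and> 0 \<le> s * p \<and> 0 \<le> t * q) \<or> (r < 0 \<and> s * p \<le> 0 \<and> t * q \<le> 0)"
      proof (elim disj_forward conjE)
        assume "0 < p" "0 < q"
        then have "0 \<le> s * p" "0 \<le> t * q" "0 < s * p \<or> 0 < t * q" using st by (auto simp: zero_less_mult_iff)
        then show "0 < r \<and> 0 \<le> s * p \<and> 0 \<le> t * q" unfolding r_def by linarith
      next
        assume "p < 0" "q < 0"
        then have "s * p \<le> 0" "t * q \<le> 0" "s * p < 0 \<or> t * q < 0"
          using st by (auto simp: mult_le_0_iff mult_less_0_iff)
        then show "r < 0 \<and> s * p \<le> 0 \<and> t * q \<le> 0" unfolding r_def by linarith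
      qed
      then show "r \<noteq> 0" "0 \<le> s * p / r" "0 \<le> t * q / r"
        by (auto simp: zero_le_divide_iff)
      then show "s * p / r + t * q / r = 1" by (simp add: r_def add_divide_distrib[symmetric])
    qed
    define w where "w = (s * p / r) *\<^sub>R u + (t * q / r) *\<^sub>R v"
    have wseg: "w \<in> closed_segment u v"
    proof -
      have "s * p / r = 1 - t * q / r" "t * q / r \<le> 1" using r(2-4) by linarith+
      then show ?thesis
        unfolding w_def closed_segment_def using r(3) by (auto intro!: exI[of _ "t * q / r"])
    qed
    have comb: "s *\<^sub>R x + t *\<^sub>R y = r *\<^sub>R w" using r(1) by (simp add: w_def p q scaleR_add_right)
    have "homog (s *\<^sub>R x + t *\<^sub>R y) \<in> \<Omega>"
      unfolding comb using homog_scaleR[of w r] seg[OF wseg] r(1) by simp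
    moreover have "0 < a \<bullet> (s *\<^sub>R x + t *\<^sub>R y)"
    proof -
      have "0 < a \<bullet> x" "0 < a \<bullet> y" using xy by (auto simp: S_def)
      then show ?thesis using st by (cases "s = 0") (auto simp: inner_add_right intro: add_pos_nonneg)
    qed
    ultimately show "s *\<^sub>R x + t *\<^sub>R y \<in> S" by (simp add: S_def)
  qed
  have ne: "S \<noteq> {}" using im O'(1) by auto
  show ?thesis
    by (rule that[OF c(1) oS conv ne im _ c(2)]) (simp add: S_def)
qed

text \<open>\<open>homog\<close> is open, so small neighbourhoods of \<open>v\<close> in the
  half-space project onto neighbourhoods that meet \<open>\<Omega>\<close>.\<close>

lemma closure_lift:
  fixes \<Omega> :: "'a::euclidean_space proj_space set"
  assumes S: "\<And>v. v \<in> S \<longleftrightarrow> 0 < a \<bullet> v \<and> homog v \<in> \<Omega>" and v: "0 < a \<bullet> v" "homog v \<in> closure \<Omega>"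
  shows "v \<in> closure S"
  unfolding closure_approachable
proof (intro allI impI)
  fix e :: real assume e: "0 < e"
  let ?U = "ball v e \<inter> {w. 0 < a \<bullet> w}"
  have "open {w. 0 < a \<bullet> w}" by (intro open_Collect_less continuous_intros)
  then have "open (homog ` ?U)" by (intro open_homog_image open_Int) auto
  moreover have "homog v \<in> homog ` ?U" using e v by auto
  ultimately have "homog ` ?U \<inter> \<Omega> \<noteq> {}" using v(2) open_Int_closure_eq_empty[of "homog ` ?U" \<Omega>] by blast
  then obtain w where "w \<in> ?U" "homog w \<in> \<Omega>" by blast
  then show "\<exists>y\<in>S. dist y v < e" using S by (auto simp: dist_commute)
qed

lemma linear_bound_from_ball:
  fixes f :: "'a::euclidean_space \<Rightarrow> 'b::real_normed_vector"
  assumes f: "linear f" and e: "0 < e" and M: "\<And>v. norm v < e \<Longrightarrow> norm (f v) \<le> M"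
  shows "norm (f v) \<le> 2 * M / e * norm v"
proof (cases "v = 0")
  case False
  let ?w = "(e / (2 * norm v)) *\<^sub>R v"
  have "norm ?w < e" using False e by simp
  then have "norm (f ?w) \<le> M" by (rule M)
  then have "e / (2 * norm v) * norm (f v) \<le> M" using f e by (simp add: linear_scale)
  then show ?thesis using False e by (simp add: field_simps)
qed (simp add: linear_0[OF f])

lemma linear_sequence_limit:
  fixes H :: "nat \<Rightarrow> 'a::euclidean_space \<Rightarrow> 'a"
  assumes H: "\<And>m. linear (H m)" and K: "\<And>m v. norm (H m v) \<le> K * norm v"
  obtains r L where "strict_mono (r :: nat \<Rightarrow> nat)" "linear L"
    "\<And>v w. v \<longlonglongrightarrow> w \<Longrightarrow> (\<lambda>m. H (r m) (v m)) \<longlonglongrightarrow> L w"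
proof -
  have app: "blinfun_apply (Blinfun (H m)) = H m" for m
    using H[of m] by (intro bounded_linear_Blinfun_apply) (simp add: linear_conv_bounded_linear)
  have K0: "0 \<le> K"
  proof -
    obtain b :: 'a where "b \<in> Basis" using nonempty_Basis by blast
    then have "norm b = 1" by simp
    then show ?thesis using order_trans[OF norm_ge_zero K[of 0 b]] by simp
  qed
  have "norm (Blinfun (H m)) \<le> K" for m
    by (rule norm_blinfun_bound) (use K K0 app in auto)
  then have "bounded (range (\<lambda>m. Blinfun (H m)))" by (auto simp: bounded_iff)
  then obtain l r where r: "strict_mono (r :: nat \<Rightarrow> nat)" "((\<lambda>m. Blinfun (H m)) \<circ> r) \<longlonglongrightarrow> l"
    using bounded_imp_convergent_subsequence by blast
  show ?thesis
  proof (rule that[OF r(1)])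
    show "linear (blinfun_apply l)" by (simp add: linear_conv_bounded_linear blinfun.bounded_linear_right)
    fix v :: "nat \<Rightarrow> 'a" and w assume "v \<longlonglongrightarrow> w"
    with r(2) have "(\<lambda>m. blinfun_apply (((\<lambda>m. Blinfun (H m)) \<circ> r) m) (v m)) \<longlonglongrightarrow> blinfun_apply l w"
      by (rule blinfun.tendsto)
    then show "(\<lambda>m. H (r m) (v m)) \<longlonglongrightarrow> blinfun_apply l w" by (simp add: app)
  qed
qed

lemma bij_linear_inverse:
  fixes f :: "'a::euclidean_space \<Rightarrow> 'a"
  assumes "linear f" "bij f"
  obtains g where "linear g" "\<And>v. g (f v) = v" "\<And>v. f (g v) = v"
proof
  show "inv f (f v) = v" "f (inv f v) = v" for v
    using assms(2) by (simp_all add: bij_is_inj bij_is_surj surj_f_inv_f)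
  show "linear (inv f)"
    using assms by (metis bij_is_inj inj_linear_imp_inv_linear)
qed

context three_coordinates
begin

lemma admissible_convex: "admissible C f \<Longrightarrow> convex_on UNIV f"
  and admissible_superlinear: "admissible C f \<Longrightarrow> superlinear f"
  by (auto simp: admissible_def intro: balanced_convex balanced_superlinear)

lemma image_cone:
  assumes T: "linear T" "bij T" and f: "convex_on UNIV f"
  shows "convex (T ` ocone f)" "T ` ocone f \<noteq> {}" "\<And>v t. v \<in> T ` ocone f \<Longrightarrow> 0 < t \<Longrightarrow> t *\<^sub>R v \<in> T ` ocone f"
    "\<And>v. v \<in> T ` ocone f \<Longrightarrow> v \<noteq> 0"
proof -
  show "convex (T ` ocone f)" by (rule convex_linear_image[OF T(1) convex_ocone[OF f]])
  show "T ` ocone f \<noteq> {}" using ocone_nonempty by blast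
  show "t *\<^sub>R v \<in> T ` ocone f" if v: "v \<in> T ` ocone f" "0 < t" for v t
  proof -
    obtain u where u: "u \<in> ocone f" "v = T u" using v(1) by blast
    then have "t *\<^sub>R v = T (t *\<^sub>R u)" using T by (simp add: linear_scale)
    then show ?thesis using ocone_scale[OF u(1) v(2)] by blast
  qed
  show "v \<noteq> 0" if "v \<in> T ` ocone f" for v
    using that linear_bij_nonzero[OF T] zero_notin_ocone by (metis imageE)
qed

text \<open>The inequality selects one of the two opposite lifts of \<open>A\<close> and keeps it
  away from the hyperplane of \<open>a\<close> uniformly.\<close>

definition adapted :: "real \<Rightarrow> real ^ 'n \<Rightarrow> (real ^ 'n) proj_space set \<Rightarrow> (real ^ 'n \<Rightarrow> real ^ 'n) \<Rightarrow> (real \<Rightarrow> real) \<Rightarrow> bool" where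
  "adapted c a A U f \<longleftrightarrow> linear U \<and> bij U \<and> convex_on UNIV f \<and> homog ` U ` ocone f = A \<and>
     (\<forall>v\<in>U ` ocone f. c * norm v \<le> a \<bullet> v)"

text \<open>Both \<open>base + v\<close> and \<open>base - v\<close> lie in the cone, so
  \<open>a\<close> is nonnegative on both images; their sum being \<open>2 * v0\<close>, each image
  is bounded.\<close>

lemma adapted_bound:
  assumes H: "adapted c a A H g" "H base = v0" and g: "normalized g" and c: "0 < c"
  shows "norm (H v) \<le> 8 * (2 * (a \<bullet> v0) / c + norm v0) * norm v"
proof -
  have "norm (H v) \<le> 2 * (2 * (a \<bullet> v0) / c + norm v0) / (1 / 4) * norm v"
  proof (rule linear_bound_from_ball)
    show lin: "linear H" using H(1) by (simp add: adapted_def)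
    fix v :: "real ^ 'n" assume v: "norm v < 1 / 4"
    have cg: "convex_on UNIV g" and Ha: "\<And>v. v \<in> H ` ocone g \<Longrightarrow> c * norm v \<le> a \<bullet> v"
      using H(1) by (auto simp: adapted_def)
    have "base + v \<in> ocone g" "base + - v \<in> ocone g"
      by (rule base_ball[OF cg g], use v in simp)+
    then have in1: "H (base + v) \<in> H ` ocone g" and in2: "H (base + - v) \<in> H ` ocone g" by blast+
    have eq: "H (base + v) = v0 + H v" "H (base + - v) = v0 - H v"
      using lin H(2) by (simp_all add: linear_add linear_diff)
    have "0 \<le> c * norm (v0 - H v)" using c by simp
    then have "0 \<le> a \<bullet> (v0 - H v)" using Ha[OF in2] unfolding eq by linarith
    moreover have "c * norm (v0 + H v) \<le> a \<bullet> (v0 + H v)" using Ha[OF in1] unfolding eq .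
    ultimately have "c * norm (v0 + H v) \<le> 2 * (a \<bullet> v0)" by (simp add: inner_add_right inner_diff_right)
    then have "norm (v0 + H v) \<le> 2 * (a \<bullet> v0) / c" using c by (simp add: field_simps)
    then show "norm (H v) \<le> 2 * (a \<bullet> v0) / c + norm v0"
      using norm_triangle_ineq4[of "v0 + H v" v0] by simp
  qed simp
  then show ?thesis by simp
qed

text \<open>The symmetric argument for the inverse: \<open>v0 + w\<close> and \<open>v0 - w\<close>
  lie in the image, and \<open>height (2 * C) 2\<close>, supplied by
  \<open>normalized_lower\<close>, plays the role of \<open>a\<close>.\<close>

lemma adapted_inverse_bound:
  fixes G H :: "real ^ 'n \<Rightarrow> real ^ 'n"
  assumes G: "linear G" "\<And>v. G (H v) = v" and H: "H base = v0" "ball v0 e \<subseteq> H ` ocone g"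
    and g: "balanced C g" "normalized g" and e: "0 < e"
  shows "norm (G w) \<le> 2 * (2 * (height (2 * C) 2 \<bullet> base) + norm base) / e * norm w"
proof (rule linear_bound_from_ball[OF G(1) e])
  let ?h = "height (2 * C) 2"
  have C: "0 < C" using balanced_const_pos[OF g(1)] .
  have hb: "norm v \<le> ?h \<bullet> v" if "v \<in> ocone g" for v
  proof (rule norm_le_height[OF _ _ _ that])
    show "\<bar>x\<bar> \<le> 2 * C * g x + 2" for x
      using normalized_lower[OF g, of x] C by (simp add: field_simps)
  qed (use C in auto)
  fix w :: "real ^ 'n" assume w: "norm w < e"
  have "v0 + w \<in> ball v0 e" "v0 - w \<in> ball v0 e" using w by (auto simp: dist_norm)
  then obtain p q where p: "p \<in> ocone g" "v0 + w = H p" and q: "q \<in> ocone g" "v0 - w = H q"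
    using H(2) by blast
  have Gv0: "G v0 = base" using G(2)[of base] H(1) by simp
  have "p = base + G w" using G(2)[of p] G(1) p(2)[symmetric] Gv0 by (simp add: linear_add)
  moreover have "q = base - G w" using G(2)[of q] G(1) q(2)[symmetric] Gv0 by (simp add: linear_diff)
  ultimately have 1: "norm (base + G w) \<le> ?h \<bullet> (base + G w)" and 2: "norm (base - G w) \<le> ?h \<bullet> (base - G w)"
    using hb[OF p(1)] hb[OF q(1)] by auto
  have "0 \<le> ?h \<bullet> (base - G w)" using 2 norm_ge_zero order_trans by blast
  with 1 have "norm (base + G w) \<le> 2 * (?h \<bullet> base)" by (simp add: inner_add_right inner_diff_right)
  then show "norm (G w) \<le> 2 * (?h \<bullet> base) + norm base"
    using norm_triangle_ineq4[of "base + G w" base] by simp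
qed

lemma eventually_hausdorff_small:
  assumes lim: "(\<lambda>m. hausdorff_dist (closure (A m)) (closure \<Omega>)) \<longlonglongrightarrow> 0" and "0 < c" "0 < e" "0 \<le> K"
  obtains d where "norm a * d \<le> c" "d * K \<le> e"
    "\<forall>\<^sub>F m in sequentially. hausdorff_dist (closure (A m)) (closure \<Omega>) < d"
proof -
  define d where "d = min (c / (norm a + 1)) (e / (K + 1))"
  have a1: "0 < norm a + 1" by (simp add: add_nonneg_pos)
  then have d: "0 < d" using assms(2-4) by (simp add: d_def)
  have "norm a * d \<le> (norm a + 1) * (c / (norm a + 1))"
    by (rule mult_mono) (use d in \<open>auto simp: d_def\<close>)
  moreover have "d * K \<le> e / (K + 1) * (K + 1)"
    by (rule mult_mono) (use d assms(3,4) in \<open>auto simp: d_def\<close>)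
  ultimately have "norm a * d \<le> c" "d * K \<le> e" using a1 assms(4) by auto
  then show ?thesis using order_tendstoD(2)[OF lim d] by (rule that)
qed

text \<open>The radius and the threshold depend on \<open>v\<close> only, not on \<open>U\<close> or
  \<open>f\<close>, so the lemma applies before the maps are chosen.\<close>

lemma adapted_eventually_ball:
  assumes S: "open S" "\<forall>z\<in>S. z \<noteq> 0 \<and> homog z \<in> \<Omega> \<and> c * norm z \<le> a \<bullet> z" and c: "0 < c"
    and lim: "(\<lambda>m. hausdorff_dist (closure (A m)) (closure \<Omega>)) \<longlonglongrightarrow> 0" and v: "v \<in> S"
  obtains e where "0 < e" "\<forall>\<^sub>F m in sequentially. \<forall>U f. adapted c a (A m) U f \<longrightarrow> ball v e \<subseteq> U ` ocone f"
proof -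
  obtain e0 where e0: "0 < e0" "ball v e0 \<subseteq> S" using S(1) v open_contains_ball by blast
  define e where "e = e0 / 2"
  have e: "0 < e" "ball v (2 * e) \<subseteq> S" using e0 by (auto simp: e_def)
  have K: "0 \<le> norm v + 2 * e" using e(1) by simp
  obtain d where d: "norm a * d \<le> c" "d * (norm v + 2 * e) \<le> e"
    "\<forall>\<^sub>F m in sequentially. hausdorff_dist (closure (A m)) (closure \<Omega>) < d"
    by (rule eventually_hausdorff_small[OF lim c e(1) K]) (rule that)
  have "\<forall>\<^sub>F m in sequentially. \<forall>U f. adapted c a (A m) U f \<longrightarrow> ball v e \<subseteq> U ` ocone f"
    using d(3)
  proof eventually_elim
    case (elim m)
    show ?case
    proof (intro allI impI)
      fix U f assume "adapted c a (A m) U f"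
      then have U: "linear U" "bij U" "convex_on UNIV f" "homog ` U ` ocone f = A m"
        "\<And>v. v \<in> U ` ocone f \<Longrightarrow> c * norm v \<le> a \<bullet> v" by (auto simp: adapted_def)
      note im = image_cone[OF U(1-3)]
      show "ball v e \<subseteq> U ` ocone f"
      proof (rule ball_in_cone[OF im(1-3), where c = c and a = a and \<Omega> = \<Omega> and d = d])
        show "hausdorff_dist (closure (homog ` U ` ocone f)) (closure \<Omega>) < d" using elim U(4) by simp
        show "z \<noteq> 0 \<and> homog z \<in> \<Omega> \<and> c * norm z \<le> a \<bullet> z" if "z \<in> ball v (2 * e)" for z
          using S(2) e(2) that by blast
      qed (use c im(4) e(1) d U(5) in auto)
    qed
  qed
  with e(1) show ?thesis by (rule that)
qed

text \<open>The sign of \<open>T\<close> is corrected, and precomposition with the map of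
  \<open>ocone_normalize\<close> moves \<open>base\<close> to the preimage of \<open>v0\<close>. The
  ball is required for all adapted \<open>U\<close> because the sign is chosen inside the
  proof.\<close>

lemma normalized_lift:
  assumes T: "linear T" "bij T" and f: "admissible C f"
    and a: "\<And>v. v \<in> T ` ocone f \<Longrightarrow> c * norm v \<le> \<bar>a \<bullet> v\<bar>" "0 < c"
    and v0: "\<And>U. adapted c a (homog ` T ` ocone f) U f \<Longrightarrow> ball v0 e \<subseteq> U ` ocone f" and e: "0 < e"
  obtains H g where "adapted c a (homog ` T ` ocone f) H g" "admissible C g" "normalized g" "H base = v0"
    "ball v0 e \<subseteq> H ` ocone g"
proof -
  have f': "convex_on UNIV f" "balanced C f" using f by (auto simp: admissible_def intro: balanced_convex)
  note im = image_cone[OF T f'(1)]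
  have nz: "a \<bullet> v \<noteq> 0" if "v \<in> T ` ocone f" for v
  proof -
    have "0 < c * norm v" using im(4)[OF that] a(2) by simp
    then show ?thesis using a(1)[OF that] by auto
  qed
  have "(\<forall>v\<in>T ` ocone f. 0 < a \<bullet> v) \<or> (\<forall>v\<in>T ` ocone f. a \<bullet> v < 0)"
    by (rule convex_inner_sign[OF im(1) nz])
  then obtain U where U: "linear U" "bij U" "homog ` U ` ocone f = homog ` T ` ocone f"
    "\<And>v. v \<in> U ` ocone f \<Longrightarrow> c * norm v \<le> a \<bullet> v"
  proof
    assume pos: "\<forall>v\<in>T ` ocone f. 0 < a \<bullet> v"
    show thesis
      by (rule that[OF T refl]) (use a(1) pos in \<open>fastforce simp: abs_of_pos\<close>)
  next
    assume neg: "\<forall>v\<in>T ` ocone f. a \<bullet> v < 0"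
    have 1: "linear (\<lambda>v. - T v)" by (rule linear_compose_neg[OF T(1)])
    have 2: "bij (\<lambda>v. - T v)"
      using bij_comp[OF T(2) bij_uminus] by (simp add: o_def)
    have 3: "homog ` (\<lambda>v. - T v) ` ocone f = homog ` T ` ocone f"
      unfolding image_image using im(4) by (intro image_cong refl homog_minus) auto
    have 4: "c * norm v \<le> a \<bullet> v" if v: "v \<in> (\<lambda>v. - T v) ` ocone f" for v
    proof -
      have w: "- v \<in> T ` ocone f" using v by auto
      show ?thesis using a(1)[OF w] neg[rule_format, OF w] by simp
    qed
    show thesis by (rule that[OF 1 2 3 4])
  qed
  have bU: "ball v0 e \<subseteq> U ` ocone f" by (rule v0) (use U f'(1) in \<open>auto simp: adapted_def\<close>)
  then have "v0 \<in> U ` ocone f" using e by auto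
  then obtain u where u: "u \<in> ocone f" "v0 = U u" by blast
  obtain N A l t b d where N: "linear N" "bij N" "N base = u" "0 < A" "0 < l"
    "normalized (affine_change A l t b d f)" "\<And>v. N v \<in> ocone f \<longleftrightarrow> v \<in> ocone (affine_change A l t b d f)"
    by (rule ocone_normalize[OF f'(2) u(1)]) (rule that)
  let ?g = "affine_change A l t b d f"
  have Ng: "N ` ocone ?g = ocone f"
  proof
    show "N ` ocone ?g \<subseteq> ocone f" using N(7) by auto
    show "ocone f \<subseteq> N ` ocone ?g"
    proof
      fix w assume w: "w \<in> ocone f"
      obtain v where "w = N v" using N(2) by (metis bij_pointE)
      with w N(7) show "w \<in> N ` ocone ?g" by auto
    qed
  qed
  have H: "(U \<circ> N) ` ocone ?g = U ` ocone f" by (metis Ng image_comp)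
  show ?thesis
  proof (rule that[of "U \<circ> N" ?g])
    show adm: "admissible C ?g" by (rule admissible_affine_change[OF f N(4,5)])
    have "linear (U \<circ> N)" "bij (U \<circ> N)" using U N by (auto intro: linear_compose bij_comp)
    moreover have "convex_on UNIV ?g" using adm by (rule admissible_convex)
    ultimately show "adapted c a (homog ` T ` ocone f) (U \<circ> N) ?g"
      unfolding adapted_def H using U(3,4) by blast
    show "normalized ?g" by (rule N)
    show "(U \<circ> N) base = v0" using N(3) u(2) by simp
    show "ball v0 e \<subseteq> (U \<circ> N) ` ocone ?g" unfolding H by (rule bU)
  qed
qed

text \<open>The maps carrying the epigraph domains to \<open>A m\<close> may diverge, but the
  divergence can be absorbed into affine changes of the functions. What remains are bounded maps
  with bounded inverses and functions in a compact family, so all have limits.\<close>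

lemma projective_limit:
  assumes A: "\<And>m. projective_class (A m) = projective_class (epi_domain (f m))" "\<And>m. admissible C (f m)"
    and O: "\<Omega> \<in> properly_convex_domains"
    and lim: "(\<lambda>m. hausdorff_dist (closure (A m)) (closure \<Omega>)) \<longlonglongrightarrow> 0"
  shows "\<exists>g. admissible C g \<and> projective_class \<Omega> = projective_class (epi_domain g)"
proof -
  have "\<exists>T. linear T \<and> bij T \<and> A m = homog ` T ` ocone (f m)" for m
    using A(1)[of m] unfolding projective_class_eq_iff epi_domain_def mem_projective_class_homog[OF zero_notin_ocone] .
  then have "\<forall>m. \<exists>T. linear T \<and> bij T \<and> A m = homog ` T ` ocone (f m)" by blast
  then obtain T where T: "\<And>m. linear (T m)" "\<And>m. bij (T m)" "\<And>m. A m = homog ` T m ` ocone (f m)"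
    by (elim choice[THEN exE]) blast
  have One: "\<Omega> \<noteq> {}" using O by (auto simp: properly_convex_domains_def proj_domain_def)
  have Ane: "A m \<noteq> {}" for m using T(3)[of m] ocone_nonempty by auto
  obtain a c S where c: "0 < c" and S: "open S" "convex S" "S \<noteq> {}" "\<Omega> = homog ` S"
    "\<And>v. v \<in> S \<longleftrightarrow> 0 < a \<bullet> v \<and> homog v \<in> \<Omega>"
    and ac: "\<And>v. v \<noteq> 0 \<Longrightarrow> homog v \<in> closure \<Omega> \<Longrightarrow> c * norm v \<le> \<bar>a \<bullet> v\<bar>"
    by (rule properly_convex_lift[OF O]) (rule that)
  have S0: "\<forall>z\<in>S. z \<noteq> 0 \<and> homog z \<in> \<Omega> \<and> c / 2 * norm z \<le> a \<bullet> z"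
  proof
    fix z assume "z \<in> S"
    then have z: "0 < a \<bullet> z" "homog z \<in> \<Omega>" using S(5)[of z] by auto
    then have z0: "z \<noteq> 0" by auto
    have "c * norm z \<le> \<bar>a \<bullet> z\<bar>" using ac[OF z0] z(2) closure_subset by blast
    moreover have "0 \<le> c * norm z" using c by simp
    ultimately show "z \<noteq> 0 \<and> homog z \<in> \<Omega> \<and> c / 2 * norm z \<le> a \<bullet> z" using z z0 by simp
  qed
  have c2: "0 < c / 2" using c by simp
  note eventually_ball = adapted_eventually_ball[OF S(1) S0 c2 lim]
  \<comment> \<open>The common image of \<open>base\<close> under all normalized maps; fixing it is
    what bounds them.\<close>
  obtain v0 where v0: "v0 \<in> S" using S(3) by blast
  obtain e where e: "0 < e" and ev1: "\<forall>\<^sub>F m in sequentially. \<forall>U f. adapted (c / 2) a (A m) U f \<longrightarrow> ball v0 e \<subseteq> U ` ocone f"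
    by (rule eventually_ball[OF v0]) (rule that)
  obtain d where d: "norm a * d \<le> c / 2" and ev2: "\<forall>\<^sub>F m in sequentially. hausdorff_dist (closure (A m)) (closure \<Omega>) < d"
    by (rule eventually_hausdorff_small[OF lim c2 zero_less_one order_refl]) (rule that)
  define good where "good m H g \<longleftrightarrow> adapted (c / 2) a (A m) H g \<and> admissible C g \<and> normalized g \<and> H base = v0 \<and>
    ball v0 e \<subseteq> H ` ocone g" for m H g
  have "\<forall>\<^sub>F m in sequentially. \<exists>H g. good m H g"
    using ev1 ev2
  proof eventually_elim
    case (elim m)
    have near: "c / 2 * norm v \<le> \<bar>a \<bullet> v\<bar>" if v: "v \<in> T m ` ocone (f m)" for v
    proof (rule chart_lower_bound_near[OF ac Ane One elim(2) d])
      show "v \<noteq> 0" by (rule image_cone(4)[OF T(1,2) admissible_convex[OF A(2)] v])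
      have "homog v \<in> A m" unfolding T(3) using v by (rule imageI)
      then show "homog v \<in> closure (A m)" by (rule closure_subset[THEN subsetD])
    qed
    have v0in: "ball v0 e \<subseteq> U ` ocone (f m)" if "adapted (c / 2) a (homog ` T m ` ocone (f m)) U (f m)" for U
      using elim(1) that unfolding T(3)[symmetric] by blast
    obtain H g where Hg: "adapted (c / 2) a (homog ` T m ` ocone (f m)) H g" "admissible C g" "normalized g" "H base = v0"
      "ball v0 e \<subseteq> H ` ocone g"
      by (rule normalized_lift[OF T(1)[of m] T(2)[of m] A(2)[of m] near c2 v0in e]) (assumption | (rule that; assumption))+
    have "good m H g" unfolding good_def T(3) by (intro conjI Hg)
    then show ?case by blast
  qed
  then obtain N where N: "\<And>m. N \<le> m \<Longrightarrow> \<exists>H g. good m H g" unfolding eventually_sequentially by blast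
  have "\<forall>m. \<exists>x. good (m + N) (fst x) (snd x)" using N by simp
  then obtain x where x: "\<And>m. good (m + N) (fst (x m)) (snd (x m))" by (elim choice[THEN exE]) blast
  define H where "H m = fst (x m)" for m
  define g where "g m = snd (x m)" for m
  have Had: "adapted (c / 2) a (A (m + N)) (H m) (g m)" and H3: "H m base = v0"
    and g: "admissible C (g m)" "normalized (g m)" and Hb: "ball v0 e \<subseteq> H m ` ocone (g m)" for m
    using x[of m] by (auto simp: good_def H_def g_def)
  have H: "linear (H m)" "bij (H m)" "homog ` H m ` ocone (g m) = A (m + N)"
    and Ha: "\<And>v. v \<in> H m ` ocone (g m) \<Longrightarrow> c / 2 * norm v \<le> a \<bullet> v" for m
    using Had[of m] by (auto simp: adapted_def)
  have gc: "convex_on UNIV (g m)" "balanced C (g m)" for m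
    using g(1)[of m] by (auto simp: admissible_def intro: balanced_convex)
  have "\<forall>m. \<exists>G. linear G \<and> (\<forall>v. G (H m v) = v) \<and> (\<forall>v. H m (G v) = v)"
    using bij_linear_inverse[OF H(1,2)] by metis
  then obtain G where G: "\<And>m. linear (G m)" "\<And>m v. G m (H m v) = v" "\<And>m v. H m (G m v) = v"
    by (elim choice[THEN exE]) blast
  note Hbound = adapted_bound[OF Had H3 g(2) c2]
  note Gbound = adapted_inverse_bound[OF G(1,2) H3 Hb gc(2) g(2) e]
  obtain r1 \<psi> where r1: "strict_mono (r1 :: nat \<Rightarrow> nat)" "\<And>x. (\<lambda>m. g (r1 m) x) \<longlonglongrightarrow> \<psi> x" "admissible C \<psi>"
    by (rule admissible_compact[OF g]) (rule that)
  obtain r2 L where r2: "strict_mono (r2 :: nat \<Rightarrow> nat)" "linear L"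
    "\<And>v w. v \<longlonglongrightarrow> w \<Longrightarrow> (\<lambda>m. H (r1 (r2 m)) (v m)) \<longlonglongrightarrow> L w"
    by (rule linear_sequence_limit[of "\<lambda>m. H (r1 m)", OF H(1) Hbound]) (rule that)
  obtain r3 P where r3: "strict_mono (r3 :: nat \<Rightarrow> nat)" "linear P"
    "\<And>v w. v \<longlonglongrightarrow> w \<Longrightarrow> (\<lambda>m. G (r1 (r2 (r3 m))) (v m)) \<longlonglongrightarrow> P w"
    by (rule linear_sequence_limit[of "\<lambda>m. G (r1 (r2 m))", OF G(1) Gbound]) (rule that)
  define r where "r = r1 \<circ> (r2 \<circ> r3)"
  have r: "strict_mono r" unfolding r_def by (intro strict_mono_o r1 r2 r3)
  have gl: "(\<lambda>m. g (r m) x) \<longlonglongrightarrow> \<psi> x" for x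
    using LIMSEQ_subseq_LIMSEQ[OF r1(2) strict_mono_o[OF r2(1) r3(1)]] by (simp add: o_def r_def)
  have Gl: "(\<lambda>m. G (r m) (v m)) \<longlonglongrightarrow> P w" if "v \<longlonglongrightarrow> w" for v w
    using r3(3)[OF that] by (simp add: r_def)
  have Hl: "(\<lambda>m. H (r m) (v m)) \<longlonglongrightarrow> L w" if v: "v \<longlonglongrightarrow> w" for v w
  proof -
    \<comment> \<open>Convergence is known along \<open>r2\<close>. Along the further subsequence
      the argument is split into a fixed vector and a null sequence, and the latter is handled by
      the uniform bound.\<close>
    have c1: "(\<lambda>m. H (r1 (r2 m)) z) \<longlonglongrightarrow> L z" for z by (rule r2(3)) simp
    have "(\<lambda>m. H (r m) (v m - w)) \<longlonglongrightarrow> 0"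
    proof (rule Lim_null_comparison)
      show "\<forall>\<^sub>F m in sequentially. norm (H (r m) (v m - w)) \<le> 8 * (2 * (a \<bullet> v0) / (c / 2) + norm v0) * norm (v m - w)"
        using Hbound by (intro always_eventually allI)
      have "(\<lambda>m. norm (v m - w)) \<longlonglongrightarrow> 0" using v by (simp add: tendsto_norm_zero LIM_zero)
      then show "(\<lambda>m. 8 * (2 * (a \<bullet> v0) / (c / 2) + norm v0) * norm (v m - w)) \<longlonglongrightarrow> 0"
        by (rule tendsto_mult_right_zero)
    qed
    moreover have "(\<lambda>m. H (r m) w) \<longlonglongrightarrow> L w"
      using LIMSEQ_subseq_LIMSEQ[OF c1 r3(1)] by (simp add: r_def o_def)
    ultimately have "(\<lambda>m. H (r m) (v m - w) + H (r m) w) \<longlonglongrightarrow> 0 + L w" by (rule tendsto_add)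
    then show ?thesis using H(1) by (simp add: linear_diff)
  qed
  have LP: "L (P w) = w" for w
  proof (rule LIMSEQ_unique)
    have "(\<lambda>m. G (r m) w) \<longlonglongrightarrow> P w" by (rule Gl) simp
    then show "(\<lambda>m. H (r m) (G (r m) w)) \<longlonglongrightarrow> L (P w)" by (rule Hl)
    show "(\<lambda>m. H (r m) (G (r m) w)) \<longlonglongrightarrow> w" by (simp add: G)
  qed
  have PL: "P (L w) = w" for w
  proof (rule LIMSEQ_unique)
    have "(\<lambda>m. H (r m) w) \<longlonglongrightarrow> L w" by (rule Hl) simp
    then show "(\<lambda>m. G (r m) (H (r m) w)) \<longlonglongrightarrow> P (L w)" by (rule Gl)
    show "(\<lambda>m. G (r m) (H (r m) w)) \<longlonglongrightarrow> w" by (simp add: G)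
  qed
  have bijL: "bij L" by (rule bij_betw_byWitness[where f' = P]) (use LP PL in auto)
  have surjP: "surj P" using PL by (metis surjI)
  have \<psi>c: "convex_on UNIV \<psi>" "superlinear \<psi>" using r1(3) admissible_convex admissible_superlinear by blast+
  have limA: "(\<lambda>m. hausdorff_dist (closure (A (r m + N))) (closure \<Omega>)) \<longlonglongrightarrow> 0"
    using LIMSEQ_subseq_LIMSEQ[OF LIMSEQ_ignore_initial_segment[OF lim, of N] r] by (simp add: o_def)
  \<comment> \<open>Limits of points of the cones lie only in \<open>closure S\<close>; openness of
    the image and convexity of \<open>S\<close> remove the closure.\<close>
  have sub1: "L ` ocone \<psi> \<subseteq> S"
  proof -
    have "L v \<in> closure S" if v: "v \<in> ocone \<psi>" for v
    proof -
      have v0: "v \<noteq> 0" using v zero_notin_ocone by metis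
      have Lv0: "L v \<noteq> 0" by (rule linear_bij_nonzero[OF r2(2) bijL v0])
      have lv: "(\<lambda>m. H (r m) v) \<longlonglongrightarrow> L v" by (rule Hl) simp
      have "(\<lambda>m. v $ k * g (r m) (v $ i / v $ k)) \<longlonglongrightarrow> v $ k * \<psi> (v $ i / v $ k)" by (intro tendsto_intros gl)
      then have "\<forall>\<^sub>F m in sequentially. v $ k * g (r m) (v $ i / v $ k) < v $ j"
        by (rule order_tendstoD) (use v in \<open>simp add: ocone_def\<close>)
      then have ev: "\<forall>\<^sub>F m in sequentially. H (r m) v \<in> H (r m) ` ocone (g (r m))"
        by eventually_elim (use v in \<open>auto simp: ocone_def\<close>)
      have ev1: "\<forall>\<^sub>F m in sequentially. homog (H (r m) v) \<in> closure (A (r m + N))"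
        using ev
      proof eventually_elim
        case (elim m)
        then have "homog (H (r m) v) \<in> A (r m + N)" unfolding H(3)[symmetric] by (rule imageI)
        then show ?case using closure_subset by blast
      qed
      have "homog (L v) \<in> closure \<Omega>"
        by (rule hausdorff_tendsto_limit[OF limA One ev1 homog_tendsto[OF lv Lv0]])
      moreover have "\<forall>\<^sub>F m in sequentially. c / 2 * norm (H (r m) v) \<le> a \<bullet> H (r m) v"
        using ev by eventually_elim (rule Ha)
      then have "c / 2 * norm (L v) \<le> a \<bullet> L v"
        by (intro tendsto_le[OF _ tendsto_inner[OF tendsto_const lv] tendsto_mult[OF tendsto_const tendsto_norm[OF lv]]]) auto
      then have "0 < a \<bullet> L v" using c Lv0 by (smt (verit) mult_pos_pos half_gt_zero zero_less_norm_iff)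
      ultimately show ?thesis by (intro closure_lift[OF S(5)])
    qed
    moreover have "open (L ` ocone \<psi>)"
      by (rule open_surjective_linear_image[OF open_ocone[OF \<psi>c(1)] r2(2) bij_is_surj[OF bijL]])
    ultimately have "L ` ocone \<psi> \<subseteq> interior (closure S)" by (intro interior_maximal) auto
    then show ?thesis using convex_interior_closure[OF S(2)] interior_open[OF S(1)] by simp
  qed
  \<comment> \<open>Each point of \<open>S\<close> has a ball that is eventually inside the cones,
    so its preimages are points of the cones of \<open>g (r m)\<close> and converge.\<close>
  have "P ` S \<subseteq> ccone \<psi>"
  proof
    fix w assume "w \<in> P ` S"
    then obtain v where v: "v \<in> S" "w = P v" by blast
    obtain e' where "0 < e'" and ev: "\<forall>\<^sub>F m in sequentially. \<forall>U f. adapted (c / 2) a (A m) U f \<longrightarrow> ball v e' \<subseteq> U ` ocone f"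
      by (rule eventually_ball[OF v(1)]) (rule that)
    then obtain M where M: "\<And>m U f. M \<le> m \<Longrightarrow> adapted (c / 2) a (A m) U f \<Longrightarrow> ball v e' \<subseteq> U ` ocone f"
      unfolding eventually_sequentially by blast
    have "G (r (m + M)) v \<in> ocone (g (r (m + M)))" for m
    proof -
      have "M \<le> r (m + M) + N" using seq_suble[OF r, of "m + M"] by simp
      from M[OF this Had] have "v \<in> H (r (m + M)) ` ocone (g (r (m + M)))" using \<open>0 < e'\<close> by auto
      then show ?thesis using G(2) by auto
    qed
    moreover have "(\<lambda>m. G (r (m + M)) v) \<longlonglongrightarrow> w"
      unfolding v(2) by (rule LIMSEQ_ignore_initial_segment[OF Gl]) simp
    moreover have "(\<lambda>m. g (r (m + M)) x) \<longlonglongrightarrow> \<psi> x" for x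
      by (rule LIMSEQ_ignore_initial_segment[OF gl])
    ultimately show "w \<in> ccone \<psi>"
      by (intro ocone_limit[of "\<lambda>m. g (r (m + M))" \<psi> "\<lambda>m. G (r (m + M)) v" w] gc(1) \<psi>c(2))
  qed
  moreover have "open (P ` S)" by (rule open_surjective_linear_image[OF S(1) r3(2) surjP])
  ultimately have "P ` S \<subseteq> ocone \<psi>" by (intro open_subset_ccone[OF \<psi>c])
  then have "S \<subseteq> L ` ocone \<psi>" using LP by (metis image_subset_iff rev_image_eqI subsetI)
  with sub1 have "S = L ` ocone \<psi>" by simp
  then have "\<Omega> = homog ` L ` ocone \<psi>" using S(4) by simp
  then have "\<Omega> \<in> projective_class (epi_domain \<psi>)"
    unfolding epi_domain_def mem_projective_class_homog[OF zero_notin_ocone] using r2(2) bijL by blast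
  then have "projective_class \<Omega> = projective_class (epi_domain \<psi>)" by (rule projective_class_eqI)
  with r1(3) show ?thesis by blast
qed

end

section \<open>Contact with tangent lines\<close>

text \<open>As \<open>t\<close> takes both signs, a linear term cannot stay nonnegative by itself,
  and order 4 cannot repair it. A linear constraint satisfied by the curve is therefore satisfied by
  its tangent.\<close>

lemma nonneg_near_zero:
  fixes x y z :: real
  assumes ev: "\<forall>\<^sub>F t in at 0. 0 \<le> x + t * y + t ^ 4 * z"
  shows "0 \<le> x" "x = 0 \<Longrightarrow> y = 0" "\<forall>\<^sub>F t in at 0. 0 \<le> x + t * y"
proof -
  have "((\<lambda>t. x + t * y + t ^ 4 * z) \<longlongrightarrow> x + 0 * y + 0 ^ 4 * z) (at 0)"
    by (intro tendsto_intros)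
  then show x: "0 \<le> x" using tendsto_lowerbound[OF _ ev] by simp
  show y: "y = 0" if "x = 0"
  proof (rule antisym)
    have "((\<lambda>t. y + t ^ 3 * z) \<longlongrightarrow> y + 0 ^ 3 * z) (at 0)" by (intro tendsto_intros)
    then have l: "((\<lambda>t. y + t ^ 3 * z) \<longlongrightarrow> y) (at 0)" by simp
    have eq: "x + t * y + t ^ 4 * z = t * (y + t ^ 3 * z)" for t
      using that by (simp add: algebra_simps power_numeral_reduce)
    have r: "\<forall>\<^sub>F t in at_right 0. 0 \<le> y + t ^ 3 * z"
      using eventually_at_right_less[of 0] ev[unfolded eventually_at_split, THEN conjunct2]
      by eventually_elim (simp add: eq zero_le_mult_iff)
    show "0 \<le> y"
      by (rule tendsto_lowerbound[OF tendsto_mono[OF _ l] r]) (auto simp: at_le)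
    have lt: "\<forall>\<^sub>F t in at_left (0::real). t < 0" by (simp add: eventually_at_filter)
    have r: "\<forall>\<^sub>F t in at_left 0. y + t ^ 3 * z \<le> 0"
      using lt ev[unfolded eventually_at_split, THEN conjunct1]
      by eventually_elim (simp add: eq zero_le_mult_iff)
    show "y \<le> 0"
      by (rule tendsto_upperbound[OF tendsto_mono[OF _ l] r]) (auto simp: at_le)
  qed
  show "\<forall>\<^sub>F t in at 0. 0 \<le> x + t * y"
  proof (cases "x = 0")
    case True with y show ?thesis by simp
  next
    case False
    have "((\<lambda>t. x + t * y) \<longlongrightarrow> x + 0 * y) (at 0)" by (intro tendsto_intros)
    then have "\<forall>\<^sub>F t in at 0. 0 < x + t * y" by (rule order_tendstoD) (use False x in simp)
    then show ?thesis by eventually_elim simp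
  qed
qed

text \<open>The projective invariant that separates the two classes: the boundary of the cone is flat to order 4
  along a tangent line that leaves the cone on both sides.\<close>
definition flat :: "'a::real_normed_vector set \<Rightarrow> bool" where
  "flat K \<longleftrightarrow> (\<exists>e f h. \<forall>\<^sub>F t in at (0::real). e + t *\<^sub>R f + t ^ 4 *\<^sub>R h \<in> K \<and> e + t *\<^sub>R f \<notin> K)"

lemma flat_linear_image:
  assumes T: "linear T" "inj T" and K: "flat K"
  shows "flat (T ` K)"
proof -
  obtain e f h where *: "\<forall>\<^sub>F t in at (0::real). e + t *\<^sub>R f + t ^ 4 *\<^sub>R h \<in> K \<and> e + t *\<^sub>R f \<notin> K"
    using K unfolding flat_def by blast
  have "\<forall>\<^sub>F t in at (0::real). T e + t *\<^sub>R T f + t ^ 4 *\<^sub>R T h \<in> T ` K \<and> T e + t *\<^sub>R T f \<notin> T ` K"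
    using *
  proof eventually_elim
    case (elim t)
    have "T e + t *\<^sub>R T f + t ^ 4 *\<^sub>R T h = T (e + t *\<^sub>R f + t ^ 4 *\<^sub>R h)" "T e + t *\<^sub>R T f = T (e + t *\<^sub>R f)"
      using T(1) by (simp_all add: linear_add linear_scale)
    with elim show ?case using inj_image_mem_iff[OF T(2)] by metis
  qed
  then show ?thesis unfolding flat_def by blast
qed

definition cone3 :: "(real \<Rightarrow> real) \<Rightarrow> real \<Rightarrow> real \<Rightarrow> real \<Rightarrow> bool" where
  "cone3 f x y z \<longleftrightarrow> 0 < z \<and> z * f (x / z) \<le> y \<or> z = 0 \<and> x = 0 \<and> 0 \<le> y"

text \<open>The bound of \<open>cascade_above_subgradient\<close> multiplied by
  \<open>z ^ 3\<close>; in this form it remains valid on the ray \<open>z = 0\<close>.\<close>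

lemma cone3_cascade_cubic:
  assumes b: "\<And>u. cascade x0 + b * (u - x0) \<le> cascade u" and c: "cone3 cascade x y z"
  shows "\<bar>x - x0 * z\<bar> ^ 3 \<le> 5832 * (y - cascade x0 * z - b * (x - x0 * z)) * z\<^sup>2"
    "0 \<le> y - cascade x0 * z - b * (x - x0 * z)"
proof -
  have "\<bar>x - x0 * z\<bar> ^ 3 \<le> 5832 * (y - cascade x0 * z - b * (x - x0 * z)) * z\<^sup>2 \<and> 0 \<le> y - cascade x0 * z - b * (x - x0 * z)"
    using c unfolding cone3_def
  proof (elim disjE conjE)
    assume z: "0 < z" and y: "z * cascade (x / z) \<le> y"
    define d where "d = x / z - x0"
    have zd: "x - x0 * z = z * d" using z by (simp add: d_def right_diff_distrib mult.commute)
    have "z * (cascade x0 + b * d + \<bar>d\<bar> ^ 3 / 5832) \<le> z * cascade (x / z)"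
      using cascade_above_subgradient[OF b, of "x / z"] z unfolding d_def by (intro mult_left_mono) auto
    then have le: "z * \<bar>d\<bar> ^ 3 \<le> 5832 * (y - cascade x0 * z - b * (z * d))"
      using y by (simp add: algebra_simps)
    then have "(z * \<bar>d\<bar> ^ 3) * z\<^sup>2 \<le> 5832 * (y - cascade x0 * z - b * (z * d)) * z\<^sup>2"
      by (intro mult_right_mono) auto
    moreover have "\<bar>z * d\<bar> ^ 3 = (z * \<bar>d\<bar> ^ 3) * z\<^sup>2"
      using z by (simp add: abs_mult power_mult_distrib power2_eq_square power3_eq_cube)
    moreover have "0 \<le> z * \<bar>d\<bar> ^ 3" using z by simp
    ultimately show ?thesis unfolding zd using le by simp
  qed simp
  then show "\<bar>x - x0 * z\<bar> ^ 3 \<le> 5832 * (y - cascade x0 * z - b * (x - x0 * z)) * z\<^sup>2"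
    "0 \<le> y - cascade x0 * z - b * (x - x0 * z)" by auto
qed

text \<open>A nonzero \<open>x\<close> gives order 3 on the left against order 4 on the right. This
  is the clash between cubic contact and flatness.\<close>

lemma cube_small:
  fixes x y :: real and w :: "real \<Rightarrow> real"
  assumes ev: "\<forall>\<^sub>F t in at 0. \<bar>t * x + t ^ 4 * y\<bar> ^ 3 \<le> t ^ 4 * w t" and w: "(w \<longlongrightarrow> l) (at 0)"
  shows "x = 0"
proof -
  have "\<forall>\<^sub>F t in at 0. \<bar>x + t ^ 3 * y\<bar> ^ 3 \<le> \<bar>t\<bar> * w t"
  proof -
    have "\<forall>\<^sub>F t in at (0::real). t \<noteq> 0" by (simp add: eventually_at_filter)
    with ev show ?thesis
    proof eventually_elim
      case (elim t)
      then have t: "0 < \<bar>t\<bar> ^ 3" by simp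
      have "t * x + t ^ 4 * y = t * (x + t ^ 3 * y)" by (simp add: algebra_simps power_numeral_reduce)
      then have "\<bar>t\<bar> ^ 3 * \<bar>x + t ^ 3 * y\<bar> ^ 3 \<le> t ^ 4 * w t" using elim by (simp add: abs_mult power_mult_distrib)
      also have "t ^ 4 = \<bar>t\<bar> ^ 3 * \<bar>t\<bar>" using power_even_abs[of 4 t] by (simp add: power_numeral_reduce)
      finally have "\<bar>t\<bar> ^ 3 * \<bar>x + t ^ 3 * y\<bar> ^ 3 \<le> \<bar>t\<bar> ^ 3 * (\<bar>t\<bar> * w t)" by (simp add: mult.assoc)
      then show ?case using t by (rule mult_left_le_imp_le)
    qed
  qed
  moreover have "((\<lambda>t. \<bar>x + t ^ 3 * y\<bar> ^ 3) \<longlongrightarrow> \<bar>x + 0 ^ 3 * y\<bar> ^ 3) (at 0)" by (intro tendsto_intros)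
  moreover have "((\<lambda>t. \<bar>t\<bar> * w t) \<longlongrightarrow> \<bar>0\<bar> * l) (at 0)" by (intro tendsto_intros w)
  ultimately have "\<bar>x + 0 ^ 3 * y\<bar> ^ 3 \<le> \<bar>0\<bar> * l"
    by (intro tendsto_le[of "at 0" "\<lambda>t. \<bar>t\<bar> * w t" _ "\<lambda>t. \<bar>x + t ^ 3 * y\<bar> ^ 3"]) auto
  then have "\<bar>x\<bar> ^ 3 \<le> 0" by simp
  moreover have "0 \<le> \<bar>x\<bar> ^ 3" by simp
  ultimately show ?thesis by (metis abs_eq_0 order_antisym power_eq_0_iff)
qed

text \<open>In every position of the point \<open>(e1, e2, e3)\<close> the cubic bound keeps the
  tangent inside the cone, contrary to \<open>no\<close>.\<close>

lemma cone3_cascade_not_flat: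
  assumes ev: "\<forall>\<^sub>F t in at 0. cone3 cascade (e1 + t * f1 + t ^ 4 * h1) (e2 + t * f2 + t ^ 4 * h2) (e3 + t * f3 + t ^ 4 * h3)"
    and no: "\<forall>\<^sub>F t in at 0. \<not> cone3 cascade (e1 + t * f1) (e2 + t * f2) (e3 + t * f3)"
  shows False
proof -
  have contra: False if "\<forall>\<^sub>F t in at 0. cone3 cascade (e1 + t * f1) (e2 + t * f2) (e3 + t * f3)"
  proof -
    have "\<forall>\<^sub>F t in at (0::real). False" using that no by eventually_elim blast
    then show False by simp
  qed
  have evz: "\<forall>\<^sub>F t in at 0. 0 \<le> e3 + t * f3 + t ^ 4 * h3"
    using ev by eventually_elim (auto simp: cone3_def)
  note e3 = nonneg_near_zero[OF evz]
  let ?x = "\<lambda>t. e1 + t * f1 + t ^ 4 * h1"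
  let ?y = "\<lambda>t. e2 + t * f2 + t ^ 4 * h2"
  let ?z = "\<lambda>t. e3 + t * f3 + t ^ 4 * h3"
  show False
  proof (cases "e3 = 0")
    case True
    then have f3: "f3 = 0" using e3 by simp
    obtain b where b: "\<And>u. cascade 0 + b * (u - 0) \<le> cascade u" using convex_subgradient[OF cascade_convex] by metis
    \<comment> \<open>Here the homogenizing coordinate is \<open>t ^ 4 * h3\<close>. Its square
      supplies one factor \<open>t ^ 4\<close> for \<open>cube_small\<close> and another inside
      \<open>w\<close>, which makes the abscissa vanish to first order.\<close>
    define w where "w t = 5832 * (?y t - b * ?x t) * (t ^ 4 * h3\<^sup>2)" for t
    have "\<forall>\<^sub>F t in at 0. \<bar>?x t\<bar> ^ 3 \<le> t ^ 4 * w t \<and> 0 \<le> ?y t - b * ?x t"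
      using ev
    proof eventually_elim
      case (elim t)
      from cone3_cascade_cubic[OF b elim] show ?case
        by (simp add: True f3 cascade_at w_def power_mult_distrib) (simp add: power_numeral_reduce algebra_simps)
    qed
    then have cub: "\<forall>\<^sub>F t in at 0. \<bar>?x t\<bar> ^ 3 \<le> t ^ 4 * w t" and yb: "\<forall>\<^sub>F t in at 0. 0 \<le> ?y t - b * ?x t"
      by (simp_all add: eventually_conj_iff)
    have wl: "(w \<longlongrightarrow> 5832 * ((e2 + 0 * f2 + 0 ^ 4 * h2) - b * (e1 + 0 * f1 + 0 ^ 4 * h1)) * (0 ^ 4 * h3\<^sup>2)) (at 0)"
      unfolding w_def by (intro tendsto_intros)
    have e1: "e1 = 0"
    proof -
      have "((\<lambda>t. \<bar>?x t\<bar> ^ 3) \<longlongrightarrow> \<bar>e1 + 0 * f1 + 0 ^ 4 * h1\<bar> ^ 3) (at 0)" by (intro tendsto_intros)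
      moreover have "((\<lambda>t. t ^ 4 * w t) \<longlongrightarrow> 0 ^ 4 * (5832 * ((e2 + 0 * f2 + 0 ^ 4 * h2) - b * (e1 + 0 * f1 + 0 ^ 4 * h1)) * (0 ^ 4 * h3\<^sup>2))) (at 0)"
        by (intro tendsto_intros wl)
      ultimately have "\<bar>e1 + 0 * f1 + 0 ^ 4 * h1\<bar> ^ 3 \<le> 0 ^ 4 * (5832 * ((e2 + 0 * f2 + 0 ^ 4 * h2) - b * (e1 + 0 * f1 + 0 ^ 4 * h1)) * (0 ^ 4 * h3\<^sup>2))"
        using cub by (intro tendsto_le[OF trivial_limit_at]) auto
      then have "\<bar>e1\<bar> ^ 3 \<le> 0" by simp
      moreover have "0 \<le> \<bar>e1\<bar> ^ 3" by simp
      ultimately show ?thesis by (metis abs_eq_0 order_antisym power_eq_0_iff)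
    qed
    have f1: "f1 = 0" by (rule cube_small[OF _ wl]) (use cub e1 in simp)
    have "\<forall>\<^sub>F t in at 0. 0 \<le> e2 + t * f2 + t ^ 4 * (h2 - b * h1)"
      using yb by eventually_elim (simp add: e1 f1 algebra_simps)
    from nonneg_near_zero(3)[OF this] show False
      by (intro contra) (simp add: cone3_def True f3 e1 f1)
  next
    case False
    then have e3p: "0 < e3" using e3 by simp
    define x0 where "x0 = e1 / e3"
    have e1: "e1 = x0 * e3" using e3p by (simp add: x0_def)
    obtain b where b: "\<And>u. cascade x0 + b * (u - x0) \<le> cascade u" using convex_subgradient[OF cascade_convex] by metis
    define Xf Xh where "Xf = f1 - x0 * f3" and "Xh = h1 - x0 * h3"
    define Ye Yf Yh where "Ye = e2 - cascade x0 * e3" and "Yf = f2 - cascade x0 * f3 - b * Xf" and "Yh = h2 - cascade x0 * h3 - b * Xh"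
    have X: "?x t - x0 * ?z t = t * Xf + t ^ 4 * Xh" for t
      by (simp add: e1 Xf_def Xh_def algebra_simps)
    have Y: "?y t - cascade x0 * ?z t - b * (t * Xf + t ^ 4 * Xh) = Ye + t * Yf + t ^ 4 * Yh" for t
      by (simp add: Ye_def Yf_def Yh_def algebra_simps)
    have cub: "\<forall>\<^sub>F t in at 0. \<bar>t * Xf + t ^ 4 * Xh\<bar> ^ 3 \<le> 5832 * (Ye + t * Yf + t ^ 4 * Yh) * (?z t)\<^sup>2"
      and Yev: "\<forall>\<^sub>F t in at 0. 0 \<le> Ye + t * Yf + t ^ 4 * Yh"
    proof -
      have *: "\<bar>t * Xf + t ^ 4 * Xh\<bar> ^ 3 \<le> 5832 * (Ye + t * Yf + t ^ 4 * Yh) * (?z t)\<^sup>2" "0 \<le> Ye + t * Yf + t ^ 4 * Yh"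
        if "cone3 cascade (?x t) (?y t) (?z t)" for t
        using cone3_cascade_cubic[OF b that] unfolding X Y by auto
      show "\<forall>\<^sub>F t in at 0. \<bar>t * Xf + t ^ 4 * Xh\<bar> ^ 3 \<le> 5832 * (Ye + t * Yf + t ^ 4 * Yh) * (?z t)\<^sup>2"
        using ev by eventually_elim (rule *)
      show "\<forall>\<^sub>F t in at 0. 0 \<le> Ye + t * Yf + t ^ 4 * Yh"
        using ev by eventually_elim (rule *)
    qed
    have zl: "((\<lambda>t. e3 + t * f3) \<longlongrightarrow> e3 + 0 * f3) (at 0)" by (intro tendsto_intros)
    then have zpos: "\<forall>\<^sub>F t in at 0. 0 < e3 + t * f3" by (rule order_tendstoD) (use e3p in simp)
    note Ye = nonneg_near_zero(1,2)[OF Yev]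
    show False
    proof (cases "Ye = 0")
      \<comment> \<open>The point lies strictly above the graph, so by continuity the tangent stays
        there for small \<open>t\<close>.\<close>
      case False
      have xl: "((\<lambda>t. (e1 + t * f1) / (e3 + t * f3)) \<longlongrightarrow> (e1 + 0 * f1) / (e3 + 0 * f3)) (at 0)"
        by (intro tendsto_intros) (use e3p in simp)
      have "isCont cascade ((e1 + 0 * f1) / (e3 + 0 * f3))"
        using cascade_continuous[of UNIV] by (simp add: continuous_on_eq_continuous_at)
      then have "((\<lambda>t. cascade ((e1 + t * f1) / (e3 + t * f3))) \<longlongrightarrow> cascade ((e1 + 0 * f1) / (e3 + 0 * f3))) (at 0)"
        using xl by (rule isCont_tendsto_compose)
      then have "((\<lambda>t. (e2 + t * f2) - (e3 + t * f3) * cascade ((e1 + t * f1) / (e3 + t * f3))) \<longlongrightarrow>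
          (e2 + 0 * f2) - (e3 + 0 * f3) * cascade ((e1 + 0 * f1) / (e3 + 0 * f3))) (at 0)"
        by (intro tendsto_intros)
      then have "\<forall>\<^sub>F t in at 0. 0 < (e2 + t * f2) - (e3 + t * f3) * cascade ((e1 + t * f1) / (e3 + t * f3))"
        by (rule order_tendstoD) (use False Ye(1) in \<open>simp add: Ye_def x0_def mult.commute\<close>)
      with zpos have "\<forall>\<^sub>F t in at 0. cone3 cascade (e1 + t * f1) (e2 + t * f2) (e3 + t * f3)"
        by eventually_elim (simp add: cone3_def)
      then show False by (rule contra)
    next
      \<comment> \<open>The point lies on the graph. Once \<open>Yf\<close> and \<open>Xf\<close>
        vanish, the tangent runs along the ray of the cone through that point.\<close>
      case True
      have Yf: "Yf = 0" using Ye(2) True by simp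
      have "Xf = 0"
      proof (rule cube_small)
        show "\<forall>\<^sub>F t in at 0. \<bar>t * Xf + t ^ 4 * Xh\<bar> ^ 3 \<le> t ^ 4 * (5832 * Yh * (?z t)\<^sup>2)"
          using cub by eventually_elim (simp add: True Yf mult.left_commute)
        show "((\<lambda>t. 5832 * Yh * (?z t)\<^sup>2) \<longlongrightarrow> 5832 * Yh * (e3 + 0 * f3 + 0 ^ 4 * h3)\<^sup>2) (at 0)"
          by (intro tendsto_intros)
      qed
      then have f1: "f1 = x0 * f3" and f2: "f2 = cascade x0 * f3" and e2: "e2 = cascade x0 * e3"
        using True Yf by (simp_all add: Xf_def Yf_def Ye_def)
      have "\<forall>\<^sub>F t in at 0. cone3 cascade (e1 + t * f1) (e2 + t * f2) (e3 + t * f3)"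
        using zpos
      proof eventually_elim
        case (elim t)
        have "e1 + t * f1 = x0 * (e3 + t * f3)" "e2 + t * f2 = (e3 + t * f3) * cascade x0"
          by (simp_all add: e1 f1 f2 e2 algebra_simps)
        then show ?case using elim by (simp add: cone3_def)
      qed
      then show False by (rule contra)
    qed
  qed
qed

lemma closedin_domain_topologyD:
  fixes A :: "nat \<Rightarrow> _"
  assumes X: "closedin domain_topology X" and "\<And>k. A k \<in> X" "\<Omega> \<in> properly_convex_domains"
    "(\<lambda>k. hausdorff_dist (closure (A k)) (closure \<Omega>)) \<longlonglongrightarrow> 0"
  shows "\<Omega> \<in> X"
  by (rule X[unfolded closedin_domain_topology_iff, THEN conjunct2, rule_format, of A \<Omega>]) (use assms(2-) in simp)

context three_coordinates
begin

lemma ccone_cone3: "v \<in> ccone f \<longleftrightarrow> cone3 f (v $ i) (v $ j) (v $ k) \<and> (\<forall>m\<in>- {i, j, k}. 0 \<le> v $ m)"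
  by (auto simp: ccone_def cone3_def)

lemma ccone_cascade_not_flat: "\<not> flat (ccone cascade)"
proof
  assume "flat (ccone cascade)"
  then obtain e f h where ev: "\<forall>\<^sub>F t in at (0::real). e + t *\<^sub>R f + t ^ 4 *\<^sub>R h \<in> ccone cascade"
    and no: "\<forall>\<^sub>F t in at (0::real). e + t *\<^sub>R f \<notin> ccone cascade"
    unfolding flat_def eventually_conj_iff by blast
  have rest: "\<forall>\<^sub>F t in at (0::real). \<forall>m\<in>- {i, j, k}. 0 \<le> e $ m + t * f $ m"
  proof (rule eventually_ball_finite)
    show "\<forall>m\<in>- {i, j, k}. \<forall>\<^sub>F t in at 0. 0 \<le> e $ m + t * f $ m"
    proof
      fix m assume m: "m \<in> - {i, j, k}"
      show "\<forall>\<^sub>F t in at 0. 0 \<le> e $ m + t * f $ m"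
        by (rule nonneg_near_zero(3)[where z = "h $ m"]) (use ev m in \<open>auto simp: ccone_cone3 elim!: eventually_mono\<close>)
    qed
  qed simp
  show False
  proof (rule cone3_cascade_not_flat)
    show "\<forall>\<^sub>F t in at 0. cone3 cascade (e $ i + t * f $ i + t ^ 4 * h $ i) (e $ j + t * f $ j + t ^ 4 * h $ j) (e $ k + t * f $ k + t ^ 4 * h $ k)"
      using ev by eventually_elim (simp add: ccone_cone3)
    show "\<forall>\<^sub>F t in at 0. \<not> cone3 cascade (e $ i + t * f $ i) (e $ j + t * f $ j) (e $ k + t * f $ k)"
      using no rest by eventually_elim (simp add: ccone_cone3)
  qed
qed

text \<open>The curve starts on the vertical ray over infinity and its tangent runs in the abscissa
  direction, outside the cone. The order 4 term raises the homogenizing coordinate; the factor 16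
  turns the growth bound into
  \<open>(16 * t ^ 4 * q) ^ 3 \<le> (16 * t ^ 3 * X) ^ 4 = 1\<close>.\<close>

lemma ccone_flat:
  assumes g: "\<And>X. 1 \<le> \<bar>X\<bar> \<Longrightarrow> \<exists>q\<ge>0. g X \<le> q \<and> q ^ 3 \<le> 16 * X ^ 4"
  shows "flat (ccone g)"
proof -
  define e f h :: "real ^ 'n" where "e = (\<chi> m. if m = j then 1 else 0)" and "f = (\<chi> m. if m = i then 1 else 0)"
    and "h = (\<chi> m. if m = k then 16 else 0)"
  have "e + t *\<^sub>R f + t ^ 4 *\<^sub>R h \<in> ccone g \<and> e + t *\<^sub>R f \<notin> ccone g" if t: "t \<noteq> 0" "\<bar>t\<bar> < 1 / 4" for t
  proof -
    \<comment> \<open>The abscissa after division by the homogenizing coordinate;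
      \<open>\<bar>t\<bar> < 1 / 4\<close> makes it large enough for \<open>g\<close>.\<close>
    define X where "X = t / (16 * t ^ 4)"
    have tX: "16 * t ^ 3 * X = 1" using t(1) by (simp add: X_def power_numeral_reduce)
    have "\<bar>t\<bar> ^ 3 \<le> (1 / 4) ^ 3" using t by (intro power_mono) auto
    then have "16 * \<bar>t\<bar> ^ 3 \<le> 1" by (simp add: power_divide)
    moreover have "1 = 16 * \<bar>t\<bar> ^ 3 * \<bar>X\<bar>" using arg_cong[OF tX, of abs] by (simp add: abs_mult power_abs)
    ultimately have "1 \<le> 1 * \<bar>X\<bar>" by (metis abs_ge_zero mult_right_mono)
    then obtain q where q: "0 \<le> q" "g X \<le> q" "q ^ 3 \<le> 16 * X ^ 4" using g[of X] by auto
    have "(16 * t ^ 4 * q) ^ 3 = 16 ^ 3 * (t ^ 4) ^ 3 * q ^ 3" by (simp add: power_mult_distrib)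
    also have "\<dots> \<le> 16 ^ 3 * (t ^ 4) ^ 3 * (16 * X ^ 4)" by (intro mult_left_mono q) auto
    also have "\<dots> = (16 * t ^ 3 * X) ^ 4" by (simp add: power_mult_distrib power_mult[symmetric])
    also have "\<dots> = 1" by (simp add: tX)
    finally have "(16 * t ^ 4 * q) ^ 3 \<le> 1 ^ 3" by simp
    then have "16 * t ^ 4 * q \<le> 1" by (rule power_le_imp_le_base[of _ 2, simplified]) simp
    moreover have "16 * t ^ 4 * g X \<le> 16 * t ^ 4 * q" using q by (intro mult_left_mono) auto
    ultimately have le: "16 * t ^ 4 * g X \<le> 1" by linarith
    have "0 < t ^ 4" using t by simp
    then show ?thesis
      using le t distinct by (auto simp: ccone_def e_def f_def h_def X_def mult.commute)
  qed
  then have "\<forall>\<^sub>F t in at (0::real). e + t *\<^sub>R f + t ^ 4 *\<^sub>R h \<in> ccone g \<and> e + t *\<^sub>R f \<notin> ccone g"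
    unfolding eventually_at by (intro exI[of _ "1 / 4"]) auto
  then show ?thesis unfolding flat_def by blast
qed

text \<open>A projective equality determines the cones only up to sign; the functional
  \<open>height 1 B\<close>, positive on the cone of \<open>f\<close>, fixes the sign, and closures
  then correspond under a linear isomorphism.\<close>

lemma flat_projective_invariant:
  assumes f: "convex_on UNIV f" "superlinear f" and g: "convex_on UNIV g" "superlinear g"
    and eq: "projective_class (epi_domain g) = projective_class (epi_domain f)" and flat: "flat (ccone g)"
  shows "flat (ccone f)"
proof -
  have "epi_domain f \<in> projective_class (epi_domain g)" using eq self_in_projective_class[of "epi_domain f"] by simp
  then obtain T where T: "linear T" "bij T" "epi_domain f = homog ` T ` ocone g"
    unfolding epi_domain_def mem_projective_class_homog[OF zero_notin_ocone] by blast
  obtain B where B: "0 \<le> B" "\<And>x. \<bar>x\<bar> \<le> 1 * f x + B" by (rule superlinear_linear_bound[OF f]) (rule that)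
  let ?a = "height 1 B"
  have af: "0 < ?a \<bullet> v" if "v \<in> ocone f" for v
  proof -
    have "v \<noteq> 0" using that zero_notin_ocone by metis
    then show ?thesis using norm_le_height[OF _ B that] by (smt (verit) zero_less_norm_iff)
  qed
  note im = image_cone[OF T(1,2) g(1)]
  have sc: "\<exists>c w. c \<noteq> 0 \<and> w \<in> ocone f \<and> v = c *\<^sub>R w" if v: "v \<in> T ` ocone g" for v
  proof -
    have "homog v \<in> homog ` ocone f" using v T(3) by (auto simp: epi_domain_def)
    then obtain w where w: "w \<in> ocone f" "homog v = homog w" by blast
    have "w \<noteq> 0" using w(1) zero_notin_ocone by metis
    then show ?thesis using homog_eq_iff[of w v] im(4)[OF v] w by auto
  qed
  have nz: "?a \<bullet> v \<noteq> 0" if "v \<in> T ` ocone g" for v using sc[OF that] af by fastforce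
  obtain U where U: "linear U" "inj U" "\<And>v. v \<in> U ` ocone g \<Longrightarrow> 0 < ?a \<bullet> v" "homog ` U ` ocone g = homog ` ocone f"
    "\<And>v t. v \<in> U ` ocone g \<Longrightarrow> 0 < t \<Longrightarrow> t *\<^sub>R v \<in> U ` ocone g"
  proof -
    from convex_inner_sign[OF im(1) nz] show thesis
    proof
      assume "\<forall>v\<in>T ` ocone g. 0 < ?a \<bullet> v"
      then show thesis by (intro that[of T] T(1) bij_is_inj[OF T(2)] im(3)) (use T(3) in \<open>auto simp: epi_domain_def\<close>)
    next
      assume neg: "\<forall>v\<in>T ` ocone g. ?a \<bullet> v < 0"
      have 1: "linear (\<lambda>v. - T v)" by (rule linear_compose_neg[OF T(1)])
      have 2: "inj (\<lambda>v. - T v)" using bij_is_inj[OF T(2)] by (simp add: inj_def)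
      have "homog ` (\<lambda>v. - T v) ` ocone g = homog ` T ` ocone g"
        unfolding image_image using im(4) by (intro image_cong refl homog_minus) auto
      then have 4: "homog ` (\<lambda>v. - T v) ` ocone g = homog ` ocone f" using T(3) by (simp add: epi_domain_def)
      have 5: "t *\<^sub>R v \<in> (\<lambda>v. - T v) ` ocone g" if v: "v \<in> (\<lambda>v. - T v) ` ocone g" "0 < t" for v t
      proof -
        obtain u where u: "u \<in> ocone g" "v = - T u" using v(1) by blast
        then have "t *\<^sub>R v = - T (t *\<^sub>R u)" using T(1) by (simp add: linear_scale)
        then show ?thesis using ocone_scale[OF u(1) v(2)] by blast
      qed
      show thesis by (rule that[OF 1 2 _ 4 5]) (use neg in auto)
    qed
  qed
  have "U ` ocone g = ocone f"
  proof
    show "U ` ocone g \<subseteq> ocone f"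
    proof
      fix v assume v: "v \<in> U ` ocone g"
      then have "homog v \<in> homog ` ocone f" using U(4) by blast
      then obtain w where w: "w \<in> ocone f" "homog v = homog w" by blast
      have v0: "v \<noteq> 0" using U(3)[OF v] by auto
      have "w \<noteq> 0" using w(1) zero_notin_ocone by metis
      then obtain c where c: "v = c *\<^sub>R w" using homog_eq_iff[of w v] v0 w by auto
      have "0 < c" using U(3)[OF v] af[OF w(1)] by (simp add: c zero_less_mult_iff)
      then show "v \<in> ocone f" unfolding c by (rule ocone_scale[OF w(1)])
    qed
    show "ocone f \<subseteq> U ` ocone g"
    proof
      fix w assume w: "w \<in> ocone f"
      then have "homog w \<in> homog ` U ` ocone g" unfolding U(4) by blast
      then obtain v where v: "v \<in> U ` ocone g" "homog w = homog v" by blast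
      have v0: "v \<noteq> 0" using U(3)[OF v(1)] by auto
      have "w \<noteq> 0" using w zero_notin_ocone by metis
      then obtain c where c: "w = c *\<^sub>R v" using homog_eq_iff[of v w] v0 v by auto
      have "0 < c" using U(3)[OF v(1)] af[OF w] by (simp add: c zero_less_mult_iff)
      then show "w \<in> U ` ocone g" unfolding c by (rule U(5)[OF v(1)])
    qed
  qed
  then have "closure (ocone f) = U ` closure (ocone g)"
    using closure_injective_linear_image[OF U(1,2)] by metis
  then have "ccone f = U ` ccone g" unfolding closure_ocone[OF f] closure_ocone[OF g] .
  then show ?thesis using flat_linear_image[OF U(1,2) flat] by simp
qed

section \<open>The minimal closed set\<close>

lemma closedin_moduli_space:
  "closedin moduli_space K \<longleftrightarrow> K \<subseteq> projective_class ` properly_convex_domains \<and>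
    closedin domain_topology {\<Omega> \<in> properly_convex_domains. projective_class \<Omega> \<in> K}"
  for K :: "(real ^ 'n) proj_space set set set"
proof -
  have "quotient_map domain_topology moduli_space (projective_class :: (real ^ 'n) proj_space set \<Rightarrow> _)"
    unfolding moduli_space_def by (rule quotient_map_quotient_topology)
  from this[unfolded quotient_map_closedin] show ?thesis
    using closedin_subset[of moduli_space K] by (auto simp: moduli_space_def)
qed

text \<open>A nonempty closed part of the closure contains the class of an admissible function;
  zooming in leads back to the cascade and hence to the whole closure. Flatness separates two of its
  points.\<close>

lemma minimal_closed_class_cascade:
  "minimal_closed moduli_space (moduli_space closure_of {projective_class (epi_domain cascade)})" (is "minimal_closed _ ?M")
  and not_singleton_class_cascade:
  "\<not> is_singleton (moduli_space closure_of {projective_class (epi_domain cascade)})"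
proof -
  obtain C where C: "admissible C cascade" using cascade_admissible by blast
  have pcd: "epi_domain f \<in> properly_convex_domains" if "admissible C f" for f
    by (rule epi_domain_pcd[OF admissible_convex[OF that] admissible_superlinear[OF that]])
  have top: "projective_class (epi_domain f) \<in> topspace moduli_space" if "admissible C f" for f
    using pcd[OF that] by (auto simp: moduli_space_def)
  \<comment> \<open>One doubling constant for all members makes this set closed; as it contains the
    closure of the class, every point of that closure comes from an admissible function.\<close>
  define K where "K = {projective_class (epi_domain f) | f. admissible C f}"
  have K: "closedin moduli_space K"
    unfolding closedin_moduli_space closedin_domain_topology_iff
  proof (intro conjI allI impI)
    show "K \<subseteq> projective_class ` properly_convex_domains" using pcd by (auto simp: K_def)
    fix A \<Omega> assume *: "(\<forall>m::nat. A m \<in> {\<Omega> \<in> properly_convex_domains. projective_class \<Omega> \<in> K}) \<and> \<Omega> \<in> properly_convex_domains \<and>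
      (\<lambda>m. hausdorff_dist (closure (A m)) (closure \<Omega>)) \<longlonglongrightarrow> 0"
    then have "\<forall>m. \<exists>f. admissible C f \<and> projective_class (A m) = projective_class (epi_domain f)" by (auto simp: K_def)
    then obtain f where "\<And>m. projective_class (A m) = projective_class (epi_domain (f m))" "\<And>m. admissible C (f m)" by metis
    then have "\<exists>g. admissible C g \<and> projective_class \<Omega> = projective_class (epi_domain g)"
      using projective_limit[of A f C \<Omega>] * by blast
    then show "\<Omega> \<in> {\<Omega> \<in> properly_convex_domains. projective_class \<Omega> \<in> K}" using * by (auto simp: K_def)
  qed auto
  have "projective_class (epi_domain cascade) \<in> K" using C by (auto simp: K_def)
  then have MK: "?M \<subseteq> K" using K by (intro closure_of_minimal) auto
  have cascadeM: "projective_class (epi_domain cascade) \<in> ?M" using closure_of_subset[of "{projective_class (epi_domain cascade)}" moduli_space] top[OF C] by simp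
  \<comment> \<open>Affine changes stay in the class of \<open>f\<close>, so their limit lies in
    every closed set that contains this class.\<close>
  have orbit: "projective_class (epi_domain g) \<in> D"
    if D: "closedin moduli_space D" "projective_class (epi_domain f) \<in> D" and f: "admissible C f" and g: "admissible C g"
      and al: "\<And>m. 0 < a m" "\<And>m. 0 < l m"
      and lim: "\<And>x. (\<lambda>m::nat. affine_change (a m) (l m) (t m) (b m) (c m) f x) \<longlonglongrightarrow> g x"
    for D f g a l t b c
  proof -
    define h where "h m = affine_change (a m) (l m) (t m) (b m) (c m) f" for m
    have h: "admissible C (h m)" for m unfolding h_def by (rule admissible_affine_change[OF f al])
    have cl: "closedin domain_topology {\<Omega> \<in> properly_convex_domains. projective_class \<Omega> \<in> D}"
      using D(1) by (simp add: closedin_moduli_space)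
    have hD: "epi_domain (h m) \<in> {\<Omega> \<in> properly_convex_domains. projective_class \<Omega> \<in> D}" for m
      using pcd[OF h] D(2) epi_domain_affine_change[OF al] by (simp add: h_def)
    have hl: "(\<lambda>m. hausdorff_dist (closure (epi_domain (h m))) (closure (epi_domain g))) \<longlonglongrightarrow> 0"
      by (rule epi_domain_converges[OF admissible_convex[OF h] _ admissible_superlinear[OF g]]) (use lim in \<open>simp add: h_def\<close>)
    have "epi_domain g \<in> {\<Omega> \<in> properly_convex_domains. projective_class \<Omega> \<in> D}"
      by (rule closedin_domain_topologyD[OF cl hD pcd[OF g] hl])
    then show ?thesis by simp
  qed
  show "minimal_closed moduli_space ?M"
    unfolding minimal_closed_def
  proof (intro conjI notI)
    show "closedin moduli_space ?M" by simp
    show "?M = {} \<Longrightarrow> False" using cascadeM by auto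
    assume "\<exists>D. closedin moduli_space D \<and> D \<noteq> {} \<and> D \<subset> ?M"
    then obtain D where D: "closedin moduli_space D" "D \<noteq> {}" "D \<subset> ?M" by blast
    then obtain f where f: "admissible C f" "projective_class (epi_domain f) \<in> D" using MK by (auto simp: K_def)
    obtain a l t b c where "\<And>m. 0 < a m" "\<And>m. 0 < l m"
      "\<And>x. (\<lambda>m::nat. affine_change (a m) (l m) (t m) (b m) (c m) f x) \<longlonglongrightarrow> cascade x"
      by (rule admissible_limit_cascade[OF f(1)]) (rule that)
    then have "projective_class (epi_domain cascade) \<in> D" by (rule orbit[OF D(1) f(2,1) C])
    then have "?M \<subseteq> D" using D(1) by (intro closure_of_minimal) auto
    with D(3) show False by blast
  qed
  obtain a l t b c g where al: "\<And>m. 0 < a m" "\<And>m. 0 < l m"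
    and lim: "\<And>x. (\<lambda>m::nat. affine_change (a m) (l m) (t m) (b m) (c m) cascade x) \<longlonglongrightarrow> g x"
    and g1: "0 < sdiff g 0 1" and gflat: "\<And>X. 1 \<le> \<bar>X\<bar> \<Longrightarrow> \<exists>q\<ge>0. g X \<le> q \<and> q ^ 3 \<le> 16 * X ^ 4"
    by (rule flat_limit_of_cascade) (rule that)
  have g: "admissible C g"
    by (rule admissible_limit[OF admissible_affine_change[OF C al] lim g1]) simp
  have gM: "projective_class (epi_domain g) \<in> ?M"
    by (rule orbit[OF _ cascadeM C g al lim]) simp
  show "\<not> is_singleton ?M"
  proof
    assume "is_singleton ?M"
    then obtain x where "?M = {x}" by (rule is_singletonE)
    with gM cascadeM have "projective_class (epi_domain g) = projective_class (epi_domain cascade)" by simp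
    then have "flat (ccone cascade)"
      by (rule flat_projective_invariant[OF admissible_convex[OF C] admissible_superlinear[OF C]
          admissible_convex[OF g] admissible_superlinear[OF g] _ ccone_flat[OF gflat]])
    with ccone_cascade_not_flat show False ..
  qed
qed

end

theorem theorem1p3:
  fixes n :: nat
  assumes "n \<ge> 2" and "CARD('n::finite) = n + 1"
  shows "\<exists>M. minimal_closed (moduli_space :: (real ^ 'n) proj_space set set topology) M \<and>
             \<not> is_singleton M"
proof -
  \<comment> \<open>Three coordinates carry the planar cone; the remaining \<open>n - 2\<close>
    carry the orthant.\<close>
  have "3 \<le> card (UNIV :: 'n set)" using assms by simp
  then obtain S :: "'n set" where "card S = 3" using obtain_subset_with_card_n by metis
  then obtain i j k :: 'n where "i \<noteq> j" "i \<noteq> k" "j \<noteq> k" by (auto simp: card_3_iff)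
  then interpret three_coordinates i j k by unfold_locales
  show ?thesis using minimal_closed_class_cascade not_singleton_class_cascade by blast
qed

end
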